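(* Let $p$ be a prime, let $K$ be a finite extension of $\mathbb{Q}_p$, and let $\phi\in K(z)$ be a semi-hyperbolic rational map of degree at least $2$. Then $$J_{\mathbb{C}_p}(\phi)\cap\mathbb{P}^1_K=J_K(\phi).$$
   Context: $\mathbb{C}_p$ is the completion of an algebraic closure of $\mathbb{Q}_p$ (containing $K$), with $p$-adic absolute value $|\cdot|_p$. For $L\in\{K,\mathbb{C}_p\}$, $\mathbb{P}^1_L=L\cup\{\infty\}$ carries the spherical metric $\rho(x,y)=\frac{|x-y|_p}{\max\{|x|_p,1\}\max\{|y|_p,1\}}$ for $x,y\in L$, $\rho(x,\infty)=1$ if $|x|_p\le 1$ and $\rho(x,\infty)=1/|x|_p$ if $|x|_p>1$. The Fatou set $F_L(\phi)$ is the set of points of $\mathbb{P}^1_L$ having a neighborhood in $\mathbb{P}^1_L$ on which the family $\{\phi^n\}_{n\ge 0}$ of iterates (acting on $\mathbb{P}^1_L$) is equicontinuous with respect to $\rho$; the Julia set is $J_L(\phi)=\mathbb{P}^1_L\setminus F_L(\phi)$. A point $x\in\mathbb{P}^1_{\mathbb{C}_p}$ is non-recurrent under $\phi$ if $x$ is not accumulated by its forward orbit under $\phi$. The map $\phi$ is semi-hyperbolic if every critical point of $\phi$ (in $\mathbb{P}^1_{\mathbb{C}_p}$) lying in $J_{\mathbb{C}_p}(\phi)$ is non-recurrent. *)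

theory Defs
  imports "HOL-Analysis.Analysis" "HOL-Computational_Algebra.Computational_Algebra"
begin

section \<open>Non-archimedean absolute values and the field \<open>\<complex>\<^sub>p\<close>\<close>

locale nonarch_absolute_value =
  fixes av :: "'c::field_char_0 \<Rightarrow> real"
  assumes av_nonneg: "0 \<le> av x"
    and av_eq_0_iff: "av x = 0 \<longleftrightarrow> x = 0"
    and av_mult: "av (x * y) = av x * av y"
    and av_ultrametric: "av (x + y) \<le> max (av x) (av y)"

abbreviation av_topology :: "('c::field_char_0 \<Rightarrow> real) \<Rightarrow> 'c topology" where
  "av_topology av \<equiv> Metric_space.mtopology UNIV (\<lambda>x y. av (x - y))"

definition is_subfield :: "'c::field set \<Rightarrow> bool" where
  "is_subfield F \<longleftrightarrow> 0 \<in> F \<and> 1 \<in> F \<and>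
     (\<forall>x\<in>F. \<forall>y\<in>F. x + y \<in> F \<and> x * y \<in> F) \<and> (\<forall>x\<in>F. - x \<in> F \<and> inverse x \<in> F)"

definition poly_over :: "'c::field set \<Rightarrow> 'c poly \<Rightarrow> bool" where
  "poly_over F q \<longleftrightarrow> (\<forall>i. coeff q i \<in> F)"

definition is_algebraic_closure :: "'c::field set \<Rightarrow> 'c set \<Rightarrow> bool" where
  "is_algebraic_closure F A \<longleftrightarrow> is_subfield F \<and> is_subfield A \<and> F \<subseteq> A \<and>
     (\<forall>a\<in>A. \<exists>q. q \<noteq> 0 \<and> poly_over F q \<and> poly q a = 0) \<and>
     (\<forall>q. poly_over A q \<and> 0 < degree q \<longrightarrow> (\<exists>a\<in>A. poly q a = 0))"

definition finite_extension :: "'c::field set \<Rightarrow> 'c set \<Rightarrow> bool" where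
  "finite_extension F K \<longleftrightarrow> is_subfield F \<and> is_subfield K \<and> F \<subseteq> K \<and>
     (\<exists>B. finite B \<and> B \<subseteq> K \<and> K = {\<Sum>b\<in>B. c b * b |c. \<forall>b\<in>B. c b \<in> F})"

text \<open>
  Inside a complete field whose absolute value restricts to the \<open>p\<close>-adic one on \<open>\<rat>\<close>,
  the completion \<open>\<rat>\<^sub>p\<close> of \<open>\<rat>\<close> is the topological closure of \<open>\<rat>\<close>.
\<close>

definition Qp :: "('c::field_char_0 \<Rightarrow> real) \<Rightarrow> 'c set" where
  "Qp av = av_topology av closure_of \<rat>"

text \<open>
  \<open>\<complex>\<^sub>p\<close> is given up to isometric isomorphism, as a field \<open>'c\<close> with absolute value \<open>av\<close>
  that is a completion of an algebraic closure of \<open>\<rat>\<^sub>p\<close>.  A non-archimedean absolute value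
  with \<open>\<bar>p\<bar> = 1/p\<close> restricts to the usual \<open>p\<close>-adic absolute value on \<open>\<rat>\<close>, since any other
  prime \<open>q\<close> satisfies \<open>\<bar>q\<bar> \<le> 1\<close> and is invertible modulo \<open>p\<close>.
\<close>

locale padic_complex_numbers = nonarch_absolute_value av
  for p :: nat and av :: "'c::field_char_0 \<Rightarrow> real" +
  assumes prime_p: "prime p"
    and av_p: "av (of_nat p) = 1 / real p"
    and complete: "Metric_space.mcomplete UNIV (\<lambda>x y. av (x - y))"
    and dense_algebraic_closure:
      "\<exists>A. is_algebraic_closure (Qp av) A \<and> av_topology av closure_of A = UNIV"


section \<open>The projective line and the spherical metric\<close>

datatype 'c proj_line = Fin 'c | Infty

definition P1 :: "'c set \<Rightarrow> 'c proj_line set" where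
  "P1 L = insert Infty (Fin ` L)"

fun spherical :: "('c::field_char_0 \<Rightarrow> real) \<Rightarrow> 'c proj_line \<Rightarrow> 'c proj_line \<Rightarrow> real" where
  "spherical av (Fin x) (Fin y) = av (x - y) / (max (av x) 1 * max (av y) 1)"
| "spherical av (Fin x) Infty = (if av x \<le> 1 then 1 else 1 / av x)"
| "spherical av Infty (Fin x) = (if av x \<le> 1 then 1 else 1 / av x)"
| "spherical av Infty Infty = 0"


section \<open>Rational maps\<close>

text \<open>
  An element of \<open>K(z)\<close> is represented by a fraction \<open>f / g\<close> in lowest terms with \<open>f, g \<in> K[z]\<close>.
  Coprimality in \<open>'c[z]\<close> and in \<open>K[z]\<close> agree, by Bezout.
\<close>

definition rational_over :: "'c::field_char_0 set \<Rightarrow> 'c poly \<Rightarrow> 'c poly \<Rightarrow> bool" where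
  "rational_over K f g \<longleftrightarrow> poly_over K f \<and> poly_over K g \<and> g \<noteq> 0 \<and> coprime f g"

definition rat_degree :: "'c::field_char_0 poly \<Rightarrow> 'c poly \<Rightarrow> nat" where
  "rat_degree f g = max (degree f) (degree g)"

text \<open>In homogeneous coordinates the value at \<open>\<infinity> = [1 : 0]\<close> is \<open>[f\<^sub>d : g\<^sub>d]\<close> where
  \<open>d = rat_degree f g\<close>.\<close>

fun rat_map :: "'c::field_char_0 poly \<Rightarrow> 'c poly \<Rightarrow> 'c proj_line \<Rightarrow> 'c proj_line" where
  "rat_map f g (Fin z) = (if poly g z = 0 then Infty else Fin (poly f z / poly g z))"
| "rat_map f g Infty =
     (let d = rat_degree f g
      in if coeff g d = 0 then Infty else Fin (coeff f d / coeff g d))"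

definition quotient_deriv :: "'c::field_char_0 poly \<Rightarrow> 'c poly \<Rightarrow> 'c \<Rightarrow> 'c" where
  "quotient_deriv f g z =
     (poly (pderiv f) z * poly g z - poly f z * poly (pderiv g) z) / (poly g z)\<^sup>2"

text \<open>At a pole the derivative is taken in the coordinate \<open>1/w\<close> on the target.\<close>

definition finite_critical :: "'c::field_char_0 poly \<Rightarrow> 'c poly \<Rightarrow> 'c \<Rightarrow> bool" where
  "finite_critical f g z \<longleftrightarrow>
     (if poly g z \<noteq> 0 then quotient_deriv f g z = 0 else quotient_deriv g f z = 0)"

text \<open>\<open>rev_poly d q\<close> is \<open>z\<^sup>d q(1/z)\<close> for \<open>d \<ge> degree q\<close>, so that \<open>\<phi>(1/z)\<close> is the quotient of
  \<open>rev_poly d f\<close> and \<open>rev_poly d g\<close>, again in lowest terms if \<open>d = rat_degree f g\<close>.\<close>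

definition rev_poly :: "nat \<Rightarrow> 'c::field_char_0 poly \<Rightarrow> 'c poly" where
  "rev_poly d q = (\<Sum>i\<le>d. monom (coeff q (d - i)) i)"

fun critical_point :: "'c::field_char_0 poly \<Rightarrow> 'c poly \<Rightarrow> 'c proj_line \<Rightarrow> bool" where
  "critical_point f g (Fin z) = finite_critical f g z"
| "critical_point f g Infty =
     finite_critical (rev_poly (rat_degree f g) f) (rev_poly (rat_degree f g) g) 0"


section \<open>Fatou and Julia sets, semi-hyperbolicity\<close>

definition equicontinuous_family ::
  "('c::field_char_0 \<Rightarrow> real) \<Rightarrow> 'c proj_line set \<Rightarrow>
   (nat \<Rightarrow> 'c proj_line \<Rightarrow> 'c proj_line) \<Rightarrow> bool" where
  "equicontinuous_family av U F \<longleftrightarrow>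
     (\<forall>x\<in>U. \<forall>e>0. \<exists>d>0. \<forall>y\<in>U. spherical av x y < d \<longrightarrow>
        (\<forall>n. spherical av (F n x) (F n y) < e))"

definition fatou_set ::
  "('c::field_char_0 \<Rightarrow> real) \<Rightarrow> 'c set \<Rightarrow> 'c poly \<Rightarrow> 'c poly \<Rightarrow> 'c proj_line set" where
  "fatou_set av L f g =
     {x \<in> P1 L. \<exists>U. openin (Metric_space.mtopology (P1 L) (spherical av)) U \<and> x \<in> U \<and>
        equicontinuous_family av U (\<lambda>n. rat_map f g ^^ n)}"

definition julia_set ::
  "('c::field_char_0 \<Rightarrow> real) \<Rightarrow> 'c set \<Rightarrow> 'c poly \<Rightarrow> 'c poly \<Rightarrow> 'c proj_line set" where
  "julia_set av L f g = P1 L - fatou_set av L f g"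

text \<open>A point is accumulated by its forward orbit if it lies in its own \<open>\<omega>\<close>-limit set.\<close>

definition recurrent ::
  "('c::field_char_0 \<Rightarrow> real) \<Rightarrow> 'c poly \<Rightarrow> 'c poly \<Rightarrow> 'c proj_line \<Rightarrow> bool" where
  "recurrent av f g x \<longleftrightarrow>
     (\<forall>e>0. \<exists>\<^sub>\<infinity>n. spherical av ((rat_map f g ^^ n) x) x < e)"

definition semi_hyperbolic ::
  "('c::field_char_0 \<Rightarrow> real) \<Rightarrow> 'c poly \<Rightarrow> 'c poly \<Rightarrow> bool" where
  "semi_hyperbolic av f g \<longleftrightarrow>
     (\<forall>x. critical_point f g x \<and> x \<in> julia_set av UNIV f g \<longrightarrow> \<not> recurrent av f g x)"


section \<open>The two metrics\<close>

context nonarch_absolute_value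
begin

lemma av_zero: "av 0 = 0"
  using av_eq_0_iff[of 0] by blast

lemma av_one: "av 1 = 1"
  using av_mult[of 1 1] av_eq_0_iff[of 1] by simp

lemma av_minus: "av (- x) = av x"
proof -
  have "av (-1) * av (-1) = 1"
    using av_mult[of "-1" "-1"] av_one by simp
  then have "av (-1) = 1"
    using av_nonneg[of "-1"] by (metis abs_of_nonneg abs_square_eq_1 power2_eq_square)
  then show ?thesis
    using av_mult[of "-1" x] by simp
qed

lemma av_diff_commute: "av (x - y) = av (y - x)"
  using av_minus[of "x - y"] by simp

lemma av_triangle: "av (x + y) \<le> av x + av y"
  using av_ultrametric[of x y] av_nonneg[of x] av_nonneg[of y] by linarith

sublocale av: Metric_space UNIV "\<lambda>x y. av (x - y)"
proof
  show "av (x - z) \<le> av (x - y) + av (y - z)" for x y z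
    using av_triangle[of "x - y" "y - z"] by simp
qed (auto simp: av_nonneg av_eq_0_iff intro: av_diff_commute)

lemma spherical_Infty: "spherical av (Fin x) Infty = 1 / max (av x) 1"
  "spherical av Infty (Fin x) = 1 / max (av x) 1"
  by (auto simp: max_def)

lemma av_diff_le: "av (x - z) \<le> max (av x) 1 + max (av z) 1"
  using av_triangle[of x "- z"] by (simp add: av_minus)

lemma spherical_triangle_fin:
  "av (x - z) * max (av y) 1 \<le> av (x - y) * max (av z) 1 + av (y - z) * max (av x) 1"
proof (cases "av y \<le> 1")
  case True
  have "av (x - z) \<le> av (x - y) + av (y - z)"
    using av_triangle[of "x - y" "y - z"] by simp
  also have "\<dots> \<le> av (x - y) * max (av z) 1 + av (y - z) * max (av x) 1"
    by (intro add_mono) (auto simp: mult_le_cancel_left1 av_nonneg[THEN leD])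
  finally show ?thesis using True by (simp add: max_def)
next
  case False
  have "av (x - z) * av y = av ((x - y) * z + (y - z) * x)"
    by (simp add: av_mult[symmetric] algebra_simps)
  also have "\<dots> \<le> av (x - y) * av z + av (y - z) * av x"
    using av_triangle[of "(x - y) * z" "(y - z) * x"] by (simp add: av_mult)
  also have "\<dots> \<le> av (x - y) * max (av z) 1 + av (y - z) * max (av x) 1"
    by (intro add_mono mult_left_mono) (simp_all add: av_nonneg)
  finally show ?thesis using False by (simp add: max_def)
qed

lemma Metric_space_spherical: "Metric_space (P1 L) (spherical av)"
proof
  have pos: "0 < max (av x) 1" for x by simp
  show "0 \<le> spherical av x y" for x y
    by (cases x; cases y) (auto simp: av_nonneg)
  show "spherical av x y = spherical av y x" for x y
    by (cases x; cases y) (simp_all add: av_diff_commute mult.commute)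
  show "spherical av x y = 0 \<longleftrightarrow> x = y" for x y
    by (cases x; cases y) (auto simp: av_zero av_eq_0_iff max_def split: if_splits)
  have two: "c \<le> a + b \<Longrightarrow> c / (a * b) \<le> 1 / a + 1 / b" if "0 < a" "0 < b" for a b c :: real
    using that by (simp add: field_simps)
  show "spherical av x z \<le> spherical av x y + spherical av y z" for x y z
  proof (cases x)
    case x: (Fin a)
    show ?thesis
    proof (cases y)
      case y: (Fin b)
      show ?thesis
      proof (cases z)
        case z: (Fin c)
        show ?thesis
          using spherical_triangle_fin[of a c b] pos[of a] pos[of b] pos[of c]
          unfolding x y z spherical.simps
          by (simp add: divide_simps del: max_less_iff_conj less_max_iff_disj)
      next
        case z: Infty
        have "max (av b) 1 \<le> av (a - b) + max (av a) 1"
          using av_triangle[of "b - a" a] av_diff_commute[of a b] av_nonneg[of "a - b"]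
          by (smt (verit) diff_add_cancel)
        then show ?thesis
          using pos[of a] pos[of b] unfolding x y z spherical.simps(1) spherical_Infty
          by (simp add: divide_simps del: max_less_iff_conj less_max_iff_disj)
      qed
    next
      case y: Infty
      show ?thesis
        using two[OF pos[of a] pos, OF av_diff_le]
        unfolding x y by (cases z) (simp_all add: spherical_Infty del: spherical.simps(2,3))
    qed
  next
    case x: Infty
    show ?thesis
    proof (cases y)
      case y: (Fin b)
      show ?thesis
      proof (cases z)
        case z: (Fin c)
        have "max (av b) 1 \<le> av (b - c) + max (av c) 1"
          using av_triangle[of "b - c" c] av_nonneg[of "b - c"]
          by (smt (verit) diff_add_cancel)
        then show ?thesis
          using pos[of c] pos[of b] unfolding x y z spherical.simps(1) spherical_Infty
          by (simp add: divide_simps del: max_less_iff_conj less_max_iff_disj)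
      next
        case z: Infty
        then show ?thesis unfolding x y by simp
      qed
    next
      case y: Infty
      then show ?thesis unfolding x by simp
    qed
  qed
qed

end

end

theory Submission
  imports Defs
begin

text \<open>
  Let \<open>x \<in> \<bbbP>\<^sup>1(K)\<close> lie in the Julia set over \<open>\<complex>\<^sub>p\<close>.  Discs about \<open>x\<close>, however small, grow under iteration
  to a fixed size \<open>e\<close>.  The iterates have bounded degree \<open>N\<close> on them: a step of the orbit on which \<open>\<phi>\<close> does
  not merely rescale the disc must have a critical point \<open>c\<close> within a constant multiple of its
  radius, the disc about \<open>c\<close> then takes over, and nonrecurrence orders the critical points of the Julia
  set strictly by accumulation, so that induction along this order bounds the number of such steps.
  Hence the points of the disc of radius \<open>\<delta>\<close> that stay \<open>t\<^sup>N e\<close>-close to the orbit of \<open>x\<close> lie in \<open>N\<close> discs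
  of radius \<open>t \<delta>\<close>.  But \<open>K\<close> contains \<open>N + 1\<close> points \<open>x + p\<^sup>k j\<close> that are \<open>t \<delta>\<close>-separated, with \<open>t\<close> independent
  of \<open>k\<close> and \<open>\<delta> = \<bar>p\<bar>\<^sup>k\<close>, so the iterates are not equicontinuous at \<open>x\<close> over \<open>K\<close> either.
\<close>
section \<open>Discs under iteration in an ultrametric space\<close>

text \<open>One inclusion is formal: equicontinuity near a point of P^1(C_p) restricts to P^1(K), so
  the Julia set over K lies in the one over C_p. The work is in the converse. Two obstacles shape
  it. Since C_p is not locally compact, uniform constants cannot come from compactness; they are
  computed from Bezout relations and Gauss norms. Since the residue characteristic is positive, a
  disc without critical points may still be mapped with degree greater than one; only after
  shrinking it by \<open>kap = av (fact d) / 2\<close> does the linear term of the map dominate. The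
  degree of an iterate on a disc is never defined. Two estimates stand in for it: the exponent with
  which the image radius can shrink when the disc is shrunk by \<open>t\<close>, and the number of
  discs of relative radius \<open>t\<close> that cover the part of the disc sent close to a given
  point. Both are bounded by \<open>d\<close> to the number of bad steps. The locale collects what
  this argument asks of the map: \<open>d\<close> is the global degree, \<open>r0\<close> a radius
  below which a disc lies in one coordinate chart and the height of the map is constant on
  it.\<close>

locale ultrametric_map =
  fixes rho :: "'x \<Rightarrow> 'x \<Rightarrow> real" and phi :: "'x \<Rightarrow> 'x"
    and A :: "'x \<Rightarrow> real \<Rightarrow> real" and Crit :: "'x set"
    and d :: nat and r0 kap :: real
  assumes rho_nonneg: "0 \<le> rho x y"
    and rho_eq_0_iff: "rho x y = 0 \<longleftrightarrow> x = y"
    and rho_commute: "rho x y = rho y x"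
    and rho_ultra: "rho x z \<le> max (rho x y) (rho y z)"
    and d_pos: "1 \<le> d" and r0_pos: "0 < r0"
    and kap_pos: "0 < kap" and kap_less_1: "kap < 1"
    and finite_Crit: "finite Crit"
    and A_pos: "\<lbrakk>0 < r; r \<le> r0\<rbrakk> \<Longrightarrow> 0 < A a r"
    and A_mono: "\<lbrakk>0 < r; r \<le> s; s \<le> r0\<rbrakk> \<Longrightarrow> A a r \<le> A a s"
    and A_Lipschitz: "\<lbrakk>0 < r; r \<le> r0; rho a y \<le> r; rho a z \<le> r\<rbrakk>
      \<Longrightarrow> rho (phi y) (phi z) \<le> A a r / r * rho y z"
    and A_ratio: "\<lbrakk>0 < r; r \<le> r0; 0 < t; t \<le> 1\<rbrakk> \<Longrightarrow> t ^ d * A a r \<le> A a (t * r)"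
    and A_recenter: "\<lbrakk>0 < r; r \<le> r0; rho a b \<le> r\<rbrakk> \<Longrightarrow> A b r = A a r"
    and A_cover: "\<lbrakk>0 < r; r \<le> r0; 0 < t; t \<le> 1\<rbrakk>
      \<Longrightarrow> \<exists>Y. finite Y \<and> card Y \<le> d \<and>
        (\<forall>y. rho a y \<le> r \<longrightarrow> rho (phi a) (phi y) < t ^ d * A a r \<longrightarrow> (\<exists>w\<in>Y. rho w y < t * r))"
    and good_ratio: "\<lbrakk>0 < r; r \<le> kap * r0; \<forall>c\<in>Crit. r / kap < rho a c; 0 < t; t \<le> 1\<rbrakk>
      \<Longrightarrow> A a (t * r) = t * A a r"
    and good_scale: "\<lbrakk>0 < r; r \<le> kap * r0; \<forall>c\<in>Crit. r / kap < rho a c; rho a y \<le> r; rho a z \<le> r\<rbrakk>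
      \<Longrightarrow> rho (phi y) (phi z) = A a r / r * rho y z"
begin

text \<open>The number \<open>A a r\<close> plays the role of the radius of the image of the disc of radius \<open>r\<close> about \<open>a\<close>.
  In the application it is a Gauss norm, so it need not be attained as a distance.\<close>

primrec radius :: "'x \<Rightarrow> real \<Rightarrow> nat \<Rightarrow> real" where
  "radius x \<delta> 0 = \<delta>"
| "radius x \<delta> (Suc n) = A ((phi ^^ n) x) (radius x \<delta> n)"

lemma radius_add: "radius x \<delta> (k + m) = radius ((phi ^^ k) x) (radius x \<delta> k) m"
proof (induction m)
  case (Suc m)
  have "(phi ^^ (k + m)) x = (phi ^^ m) ((phi ^^ k) x)"
    by (simp add: funpow_add[symmetric, THEN fun_cong, unfolded o_def] add.commute)
  then show ?case using Suc by simp
qed simp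

lemma radius_pos:
  assumes "0 < \<delta>" "\<forall>i<n. radius x \<delta> i \<le> r0"
  shows "0 < radius x \<delta> n"
  using assms by (induction n) (auto intro!: A_pos)

lemma rho_self [simp]: "rho x x = 0"
  by (simp add: rho_eq_0_iff)

text \<open>The Lipschitz constants \<open>A a r / r\<close> of the successive steps telescope,
  because the image radius of one step is the radius of the next disc.\<close>

lemma iterate_Lipschitz:
  assumes "0 < \<delta>" "\<forall>i<n. radius x \<delta> i \<le> r0" "rho x y \<le> \<delta>" "rho x z \<le> \<delta>"
  shows "rho ((phi ^^ n) y) ((phi ^^ n) z) \<le> radius x \<delta> n / \<delta> * rho y z"
  using assms
proof (induction n arbitrary: y z)
  case (Suc n)
  have small: "\<forall>i<n. radius x \<delta> i \<le> r0" and r0n: "radius x \<delta> n \<le> r0"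
    using Suc.prems by auto
  have pos: "0 < radius x \<delta> n" by (rule radius_pos) (use Suc.prems in auto)
  have *: "rho ((phi ^^ n) x) ((phi ^^ n) v) \<le> radius x \<delta> n" if "rho x v \<le> \<delta>" for v
  proof -
    have "rho ((phi ^^ n) x) ((phi ^^ n) v) \<le> radius x \<delta> n / \<delta> * rho x v"
      by (rule Suc.IH) (use that Suc.prems in auto)
    also have "\<dots> \<le> radius x \<delta> n / \<delta> * \<delta>"
      using that pos Suc.prems by (intro mult_left_mono) auto
    finally show ?thesis using Suc.prems by simp
  qed
  have "rho ((phi ^^ Suc n) y) ((phi ^^ Suc n) z)
      \<le> radius x \<delta> (Suc n) / radius x \<delta> n * rho ((phi ^^ n) y) ((phi ^^ n) z)"
    using A_Lipschitz[OF pos r0n * *] Suc.prems by simp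
  also have "\<dots> \<le> radius x \<delta> (Suc n) / radius x \<delta> n * (radius x \<delta> n / \<delta> * rho y z)"
    using radius_pos[of \<delta> "Suc n" x] pos Suc.prems small
    by (intro mult_left_mono Suc.IH) auto
  also have "\<dots> = radius x \<delta> (Suc n) / \<delta> * rho y z" using pos by simp
  finally show ?case .
qed simp

lemma iterate_in_disc:
  assumes "0 < \<delta>" "\<forall>i<n. radius x \<delta> i \<le> r0" "rho x y \<le> \<delta>"
  shows "rho ((phi ^^ n) x) ((phi ^^ n) y) \<le> radius x \<delta> n"
proof -
  have "rho ((phi ^^ n) x) ((phi ^^ n) y) \<le> radius x \<delta> n / \<delta> * rho x y"
    using assms by (intro iterate_Lipschitz) auto
  also have "\<dots> \<le> radius x \<delta> n / \<delta> * \<delta>"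
    using assms radius_pos[of \<delta> n x] by (intro mult_left_mono) auto
  finally show ?thesis using assms by simp
qed

text \<open>Every point of an ultrametric disc is a center of it. This allows an orbit to be traded
  for that of a nearby critical point without changing any radius.\<close>

lemma radius_recenter:
  assumes "0 < \<delta>" "\<forall>i<n. radius x \<delta> i \<le> r0" "rho x y \<le> \<delta>" "j \<le> n"
  shows "radius y \<delta> j = radius x \<delta> j"
  using assms(4)
proof (induction j)
  case (Suc j)
  have *: "\<forall>i<j. radius x \<delta> i \<le> r0" using assms Suc.prems by auto
  have "radius y \<delta> (Suc j) = A ((phi ^^ j) y) (radius x \<delta> j)" using Suc by simp
  also have "\<dots> = A ((phi ^^ j) x) (radius x \<delta> j)"
    using assms Suc.prems
    by (intro A_recenter radius_pos * iterate_in_disc) auto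
  finally show ?case by simp
qed simp

text \<open>Only at the bad steps can the degree on the disc exceed one.  The factor \<open>1 / kap\<close> accounts for
  wild ramification: a disc free of critical points need not be mapped injectively.\<close>

definition bad :: "'x \<Rightarrow> real \<Rightarrow> nat \<Rightarrow> bool" where
  "bad x \<delta> i \<longleftrightarrow> (\<exists>c\<in>Crit. rho ((phi ^^ i) x) c \<le> radius x \<delta> i / kap)"

definition bad_count :: "'x \<Rightarrow> real \<Rightarrow> nat \<Rightarrow> nat" where
  "bad_count x \<delta> n = card {i. i < n \<and> bad x \<delta> i}"

lemma bad_count_0 [simp]: "bad_count x \<delta> 0 = 0"
  by (simp add: bad_count_def)

lemma bad_count_Suc:
  "bad_count x \<delta> (Suc n) = (if bad x \<delta> n then Suc (bad_count x \<delta> n) else bad_count x \<delta> n)"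
proof -
  have "{i. i < Suc n \<and> bad x \<delta> i} =
    (if bad x \<delta> n then insert n {i. i < n \<and> bad x \<delta> i} else {i. i < n \<and> bad x \<delta> i})"
    by (auto simp: less_Suc_eq)
  then show ?thesis by (simp add: bad_count_def)
qed

lemma bad_count_mono: "m \<le> n \<Longrightarrow> bad_count x \<delta> m \<le> bad_count x \<delta> n"
  unfolding bad_count_def by (rule card_mono) auto

text \<open>A bad step raises the ratio of the two radii at worst to the power \<open>d\<close>, by
  \<open>A_ratio\<close>; a good step preserves the ratio, by \<open>good_ratio\<close>. Hence the
  exponent \<open>d ^ bad_count\<close>.\<close>

lemma radius_mono_ratio:
  assumes "0 < \<delta>" "\<forall>i<n. radius x \<delta> i \<le> kap * r0" "0 < t" "t \<le> 1" "j \<le> n"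
  shows "radius x (t * \<delta>) j \<le> radius x \<delta> j \<and>
    t ^ (d ^ bad_count x \<delta> j) * radius x \<delta> j \<le> radius x (t * \<delta>) j \<and> 0 < radius x (t * \<delta>) j"
  using assms(5)
proof (induction j)
  case 0
  then show ?case using assms by simp
next
  case (Suc j)
  define x' R R' where "x' = (phi ^^ j) x" and "R = radius x \<delta> j" and "R' = radius x (t * \<delta>) j"
  have kr: "kap * r0 \<le> r0" using kap_less_1 r0_pos by simp
  have R: "0 < R'" "R' \<le> R" "R \<le> kap * r0" "t ^ (d ^ bad_count x \<delta> j) * R \<le> R'"
    using Suc assms by (auto simp: R_def R'_def)
  define u where "u = R' / R"
  have u: "0 < u" "u \<le> 1" "t ^ (d ^ bad_count x \<delta> j) \<le> u" and R'u: "R' = u * R"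
    using R by (auto simp: u_def field_simps)
  have Apos: "0 < A x' R" "0 < A x' R'"
    using R kr by (auto intro!: A_pos)
  have "t ^ (d ^ bad_count x \<delta> (Suc j)) * A x' R \<le> A x' R'"
  proof (cases "bad x \<delta> j")
    case True
    have "t ^ (d ^ bad_count x \<delta> (Suc j)) = (t ^ (d ^ bad_count x \<delta> j)) ^ d"
      using True by (simp add: bad_count_Suc power_mult[symmetric] mult.commute)
    also have "\<dots> \<le> u ^ d" using u assms by (intro power_mono) auto
    finally have "t ^ (d ^ bad_count x \<delta> (Suc j)) * A x' R \<le> u ^ d * A x' R"
      using Apos by (intro mult_right_mono) auto
    also have "\<dots> \<le> A x' R'" unfolding R'u using R kr u by (intro A_ratio) auto
    finally show ?thesis .
  next
    case False
    have "A x' R' = u * A x' R"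
      unfolding R'u using False R u
      by (intro good_ratio) (auto simp: bad_def R_def x'_def not_le)
    then show ?thesis using False u Apos by (simp add: bad_count_Suc)
  qed
  moreover have "A x' R' \<le> A x' R" using R kr by (intro A_mono) auto
  ultimately show ?case using Apos by (simp add: R_def R'_def x'_def)
qed

text \<open>\<open>A_cover\<close> only treats target discs centered at \<open>phi a\<close>. If
  some point \<open>b\<close> of the disc is sent close to \<open>w\<close>, the target disc about
  \<open>w\<close> is also one about \<open>phi b\<close>, and \<open>a\<close> can be replaced by
  \<open>b\<close>.\<close>

lemma cover_preimage:
  assumes "0 < r" "r \<le> r0" "0 < t" "t \<le> 1"
  shows "\<exists>Y. finite Y \<and> card Y \<le> d \<and>
    (\<forall>y. rho a y \<le> r \<longrightarrow> rho w (phi y) < t ^ d * A a r \<longrightarrow> (\<exists>v\<in>Y. rho v y < t * r))"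
proof (cases "\<exists>b. rho a b \<le> r \<and> rho w (phi b) < t ^ d * A a r")
  case True
  then obtain b where b: "rho a b \<le> r" "rho w (phi b) < t ^ d * A a r" by blast
  have Ab: "A b r = A a r" using A_recenter[OF assms(1,2) b(1)] .
  obtain Y where Y: "finite Y" "card Y \<le> d"
    "\<forall>y. rho b y \<le> r \<longrightarrow> rho (phi b) (phi y) < t ^ d * A b r \<longrightarrow> (\<exists>w\<in>Y. rho w y < t * r)"
    using A_cover[OF assms, of b] by blast
  have "\<exists>v\<in>Y. rho v y < t * r" if "rho a y \<le> r" "rho w (phi y) < t ^ d * A a r" for y
  proof -
    have "rho b y \<le> r" using rho_ultra[of b y a] rho_commute[of a b] that(1) b(1) by auto
    moreover have "rho (phi b) (phi y) < t ^ d * A b r"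
      using rho_ultra[of "phi b" "phi y" w] rho_commute[of w "phi b"] that(2) b(2) Ab by auto
    ultimately show ?thesis using Y by blast
  qed
  then show ?thesis using Y by blast
next
  case False
  then show ?thesis by (intro exI[of _ "{}"]) auto
qed

text \<open>Discs are pulled back from time \<open>n\<close> to time 0. The target center
  \<open>w\<close> is arbitrary because the induction hypothesis is applied to every center produced
  by the last step.\<close>

lemma iterate_cover:
  assumes "0 < \<delta>" "\<forall>i<n. radius x \<delta> i \<le> kap * r0" "0 < t" "t \<le> 1"
  shows "\<exists>Y. finite Y \<and> card Y \<le> d ^ bad_count x \<delta> n \<and>
    (\<forall>y. rho x y \<le> \<delta> \<longrightarrow> rho w ((phi ^^ n) y) < t ^ (d ^ bad_count x \<delta> n) * radius x \<delta> n
      \<longrightarrow> (\<exists>v\<in>Y. rho v y < t * \<delta>))"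
  using assms(2)
proof (induction n arbitrary: w)
  case 0
  show ?case
  proof (cases "\<exists>b. rho w b < t * \<delta>")
    case True
    then show ?thesis by (intro exI[of _ "{w}"]) auto
  next
    case False
    then show ?thesis by (intro exI[of _ "{}"]) auto
  qed
next
  case (Suc n)
  define R where "R = radius x \<delta> n"
  define N where "N = d ^ bad_count x \<delta> n"
  have kr: "kap * r0 \<le> r0" using kap_less_1 r0_pos by simp
  have small: "\<forall>i<n. radius x \<delta> i \<le> r0"
    using Suc.prems kr by (meson less_Suc_eq order_trans)
  have R: "R \<le> kap * r0" "R \<le> r0" "0 < R"
    using Suc.prems kr radius_pos[OF assms(1) small] by (auto simp: R_def)
  have tN: "0 < t ^ N" "t ^ N \<le> 1" using assms by (auto simp: power_le_one)
  have IH: "\<exists>Y. finite Y \<and> card Y \<le> N \<and>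
    (\<forall>y. rho x y \<le> \<delta> \<longrightarrow> rho w ((phi ^^ n) y) < t ^ N * R \<longrightarrow> (\<exists>v\<in>Y. rho v y < t * \<delta>))" for w
    using Suc.IH[of w] Suc.prems by (auto simp: N_def R_def)
  have inR: "rho ((phi ^^ n) x) ((phi ^^ n) y) \<le> R" if "rho x y \<le> \<delta>" for y
    unfolding R_def by (rule iterate_in_disc[OF assms(1) small that])
  show ?case
  proof (cases "bad x \<delta> n")
    case True
    have N: "d ^ bad_count x \<delta> (Suc n) = N * d" using True by (simp add: bad_count_Suc N_def)
    \<comment> \<open>The last step is covered with ratio \<open>t ^ N\<close> instead of
      \<open>t\<close>: its preimage discs of radius \<open>t ^ N * R\<close> are exactly what the
      induction hypothesis accepts as targets. Each of the at most \<open>d\<close> discs then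
      contributes at most \<open>N\<close>.\<close>
    obtain Y where Y: "finite Y" "card Y \<le> d"
      "\<And>y. rho ((phi ^^ n) x) y \<le> R \<Longrightarrow> rho w (phi y) < (t ^ N) ^ d * A ((phi ^^ n) x) R
        \<Longrightarrow> \<exists>v\<in>Y. rho v y < t ^ N * R"
      using cover_preimage[OF R(3,2) tN, of "(phi ^^ n) x" w] by blast
    obtain Z where Z: "\<And>v. finite (Z v)" "\<And>v. card (Z v) \<le> N"
      "\<And>v y. rho x y \<le> \<delta> \<Longrightarrow> rho v ((phi ^^ n) y) < t ^ N * R \<Longrightarrow> \<exists>z\<in>Z v. rho z y < t * \<delta>"
      using IH by metis
    have "card (\<Union>v\<in>Y. Z v) \<le> (\<Sum>v\<in>Y. card (Z v))" by (rule card_UN_le[OF Y(1)])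
    also have "\<dots> \<le> (\<Sum>v\<in>Y. N)" by (rule sum_mono) (rule Z)
    also have "\<dots> \<le> N * d" using Y(2) by simp
    finally have card: "card (\<Union>v\<in>Y. Z v) \<le> N * d" .
    have "\<exists>z\<in>(\<Union>v\<in>Y. Z v). rho z y < t * \<delta>"
      if y: "rho x y \<le> \<delta>" "rho w ((phi ^^ Suc n) y) < t ^ (N * d) * radius x \<delta> (Suc n)" for y
    proof -
      obtain v where "v \<in> Y" "rho v ((phi ^^ n) y) < t ^ N * R"
        using Y(3)[OF inR[OF y(1)]] y(2) unfolding power_mult R_def by auto
      then show ?thesis using Z(3)[OF y(1)] by blast
    qed
    then show ?thesis unfolding N using card Y(1) Z(1)
      by (intro exI[of _ "\<Union>v\<in>Y. Z v"]) auto
  next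
    case False
    then have N: "d ^ bad_count x \<delta> (Suc n) = N" by (simp add: bad_count_Suc N_def)
    show ?thesis
    proof (cases "\<exists>b. rho x b \<le> \<delta> \<and> rho w ((phi ^^ Suc n) b) < t ^ N * radius x \<delta> (Suc n)")
      case True
      then obtain b where b: "rho x b \<le> \<delta>" "rho w ((phi ^^ Suc n) b) < t ^ N * radius x \<delta> (Suc n)"
        by blast
      \<comment> \<open>On a good step \<open>phi\<close> scales all distances by one factor, so the
        points sent close to \<open>w\<close> lie in a single disc about the image of
        \<open>b\<close>, and the number of discs does not increase.\<close>
      have step: "rho ((phi ^^ n) b) ((phi ^^ n) y) < t ^ N * R"
        if y: "rho x y \<le> \<delta>" "rho w ((phi ^^ Suc n) y) < t ^ N * radius x \<delta> (Suc n)" for y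
      proof -
        have "A ((phi ^^ n) x) R / R * rho ((phi ^^ n) b) ((phi ^^ n) y)
            = rho ((phi ^^ Suc n) b) ((phi ^^ Suc n) y)"
          using good_scale[OF R(3,1) _ inR[OF b(1)] inR[OF y(1)]] False
          by (simp add: bad_def R_def not_le)
        also have "\<dots> < t ^ N * radius x \<delta> (Suc n)"
          using rho_ultra[of "(phi ^^ Suc n) b" "(phi ^^ Suc n) y" w]
            rho_commute[of w "(phi ^^ Suc n) b"] b(2) y(2) by (auto simp del: funpow.simps)
        also have "\<dots> = A ((phi ^^ n) x) R / R * (t ^ N * R)"
          using R by (simp add: R_def)
        finally show ?thesis
          using R A_pos[of R "(phi ^^ n) x"] by (subst (asm) mult_less_cancel_left_pos) auto
      qed
      then show ?thesis unfolding N using IH[of "(phi ^^ n) b"] by blast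
    next
      case False
      then show ?thesis unfolding N by (intro exI[of _ "{}"]) auto
    qed
  qed
qed

section \<open>Fatou points, and the growth of discs about Julia points\<close>

definition Fatou :: "'x set" where
  "Fatou = {x. \<exists>\<delta>>0. \<forall>y. rho x y < \<delta> \<longrightarrow> (\<forall>e>0. \<exists>h>0. \<forall>z. rho x z < \<delta> \<longrightarrow> rho y z < h \<longrightarrow>
     (\<forall>n. rho ((phi ^^ n) y) ((phi ^^ n) z) < e))}"

text \<open>If all radii stayed below \<open>e\<close>, the iterates would have the common Lipschitz
  constant \<open>e / \<delta>\<close> on the disc, making \<open>x\<close> a Fatou point.\<close>

lemma radius_escapes:
  assumes "x \<notin> Fatou" "0 < \<delta>" "e \<le> r0"
  shows "\<exists>n. e \<le> radius x \<delta> n"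
proof (rule ccontr)
  assume "\<not> ?thesis"
  then have less: "radius x \<delta> n < e" for n by (auto simp: not_le)
  have small: "radius x \<delta> n \<le> r0" for n using less[of n] assms(3) by linarith
  have e: "0 < e" using less[of 0] assms(2) by simp
  have "rho ((phi ^^ n) y) ((phi ^^ n) z) < e'"
    if "rho x y < \<delta>" "rho x z < \<delta>" "rho y z < e' * \<delta> / e" for y z n e'
  proof -
    have "rho ((phi ^^ n) y) ((phi ^^ n) z) \<le> radius x \<delta> n / \<delta> * rho y z"
      using that small assms by (intro iterate_Lipschitz) auto
    also have "\<dots> \<le> e / \<delta> * rho y z"
      using less[of n] assms(2) rho_nonneg by (intro mult_right_mono divide_right_mono) auto
    also have "\<dots> < e / \<delta> * (e' * \<delta> / e)"
      using that e assms(2) by (intro mult_strict_left_mono) auto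
    finally show ?thesis using e assms(2) by simp
  qed
  then have "\<exists>h>0. \<forall>z. rho x z < \<delta> \<longrightarrow> rho y z < h \<longrightarrow> (\<forall>n. rho ((phi ^^ n) y) ((phi ^^ n) z) < e')"
    if "rho x y < \<delta>" "0 < e'" for y e'
    using that assms(2) e by (intro exI[of _ "e' * \<delta> / e"]) auto
  then have "x \<in> Fatou" using assms(2) by (auto simp: Fatou_def)
  then show False using assms by simp
qed

lemma phi_continuous:
  assumes "0 < e"
  shows "\<exists>h>0. \<forall>y. rho x y < h \<longrightarrow> rho (phi x) (phi y) < e"
proof -
  define L where "L = A x r0 / r0"
  have L: "0 < L" using A_pos[of r0 x] r0_pos by (simp add: L_def)
  have "rho (phi x) (phi y) < e" if "rho x y < min r0 (e / L)" for y
  proof -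
    have "rho (phi x) (phi y) \<le> L * rho x y"
      unfolding L_def using that r0_pos by (intro A_Lipschitz) auto
    also have "\<dots> < L * (e / L)" using that L by (intro mult_strict_left_mono) auto
    finally show ?thesis using L by simp
  qed
  then show ?thesis using L r0_pos assms by (intro exI[of _ "min r0 (e / L)"]) auto
qed

lemma iterate_continuous:
  assumes "0 < e"
  shows "\<exists>h>0. \<forall>y. rho x y < h \<longrightarrow> rho ((phi ^^ n) x) ((phi ^^ n) y) < e"
  using assms
proof (induction n arbitrary: e)
  case (Suc n)
  obtain h where "h > 0" "\<And>y. rho ((phi ^^ n) x) y < h \<Longrightarrow> rho (phi ((phi ^^ n) x)) (phi y) < e"
    using phi_continuous[OF Suc.prems] by blast
  then show ?case using Suc.IH[of h] by force
qed auto

lemma Fatou_preimage: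
  assumes "phi x \<in> Fatou"
  shows "x \<in> Fatou"
proof -
  obtain \<delta> where \<delta>: "\<delta> > 0" "\<And>y e. rho (phi x) y < \<delta> \<Longrightarrow> 0 < e \<Longrightarrow> \<exists>h>0. \<forall>z. rho (phi x) z < \<delta> \<longrightarrow> rho y z < h \<longrightarrow>
     (\<forall>n. rho ((phi ^^ n) y) ((phi ^^ n) z) < e)"
    using assms by (auto simp: Fatou_def)
  obtain \<delta>' where \<delta>': "\<delta>' > 0" "\<And>y. rho x y < \<delta>' \<Longrightarrow> rho (phi x) (phi y) < \<delta>"
    using phi_continuous[OF \<delta>(1)] by blast
  have "\<exists>h>0. \<forall>z. rho x z < \<delta>' \<longrightarrow> rho y z < h \<longrightarrow> (\<forall>n. rho ((phi ^^ n) y) ((phi ^^ n) z) < e)"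
    if y: "rho x y < \<delta>'" and e: "0 < e" for y e
  proof -
    obtain h where h: "h > 0" "\<And>z n. rho (phi x) z < \<delta> \<Longrightarrow> rho (phi y) z < h \<Longrightarrow>
        rho ((phi ^^ n) (phi y)) ((phi ^^ n) z) < e"
      using \<delta>(2)[OF \<delta>'(2)[OF y] e] by blast
    obtain h' where h': "h' > 0" "\<And>z. rho y z < h' \<Longrightarrow> rho (phi y) (phi z) < h"
      using phi_continuous[OF h(1)] by blast
    have "rho ((phi ^^ n) y) ((phi ^^ n) z) < e" if "rho x z < \<delta>'" "rho y z < min h' e" for z n
    proof (cases n)
      case (Suc m)
      then show ?thesis using h(2)[OF \<delta>'(2)[OF that(1)] h'(2), of m] that
        by (simp add: funpow_swap1)
    qed (use that in auto)
    then show ?thesis using h' e by (intro exI[of _ "min h' e"]) auto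
  qed
  then show ?thesis using \<delta>' by (auto simp: Fatou_def)
qed

lemma Fatou_preimage_iterate: "(phi ^^ n) x \<in> Fatou \<Longrightarrow> x \<in> Fatou"
  by (induction n) (auto dest: Fatou_preimage)

text \<open>The witnessing ball serves all of its points, since each is a center of it.\<close>

lemma Fatou_open:
  assumes "x \<in> Fatou"
  shows "\<exists>e>0. \<forall>y. rho x y < e \<longrightarrow> y \<in> Fatou"
proof -
  obtain \<delta> where \<delta>: "\<delta> > 0" "\<forall>y. rho x y < \<delta> \<longrightarrow> (\<forall>e>0. \<exists>h>0. \<forall>z. rho x z < \<delta> \<longrightarrow> rho y z < h \<longrightarrow>
     (\<forall>n. rho ((phi ^^ n) y) ((phi ^^ n) z) < e))"
    using assms by (auto simp: Fatou_def)
  have "y \<in> Fatou" if "rho x y < \<delta>" for y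
  proof -
    have "rho y z < \<delta> \<longleftrightarrow> rho x z < \<delta>" for z
      using that rho_ultra[of y z x] rho_ultra[of x z y] rho_commute[of x y] by auto
    then show ?thesis using \<delta> by (auto simp: Fatou_def)
  qed
  then show ?thesis using \<delta>(1) by blast
qed

text \<open>A single visit at a time \<open>n \<ge> 1\<close> already counts. The negation is
  therefore a positive lower bound for the distance from \<open>c\<close> to the orbit at all
  positive times, which is the form used in \<open>expands_of_accum\<close>.\<close>

definition accum :: "'x \<Rightarrow> 'x \<Rightarrow> bool" where
  "accum c x \<longleftrightarrow> (\<forall>e>0. \<exists>n\<ge>1. rho ((phi ^^ n) x) c < e)"

lemma accum_trans:
  assumes "accum c b" "accum b a"
  shows "accum c a"
  unfolding accum_def
proof (intro allI impI)
  fix e :: real assume "0 < e"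
  then obtain m where m: "m \<ge> 1" "rho ((phi ^^ m) b) c < e"
    using assms by (auto simp: accum_def)
  obtain h where h: "h > 0" "\<And>y. rho b y < h \<Longrightarrow> rho ((phi ^^ m) b) ((phi ^^ m) y) < e"
    using iterate_continuous[OF \<open>0 < e\<close>] by blast
  obtain n where n: "rho ((phi ^^ n) a) b < h" using assms(2) h(1) by (auto simp: accum_def)
  then have "rho ((phi ^^ m) b) ((phi ^^ (m + n)) a) < e"
    using h(2) rho_commute[of b] by (simp add: funpow_add)
  then have "rho ((phi ^^ (m + n)) a) c < e"
    using m rho_ultra[of "(phi ^^ (m + n)) a" c "(phi ^^ m) b"] rho_commute[of "(phi ^^ m) b"]
    by auto
  then show "\<exists>n\<ge>1. rho ((phi ^^ n) a) c < e" using m by (intro exI[of _ "m + n"]) auto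
qed

text \<open>A periodic point returns to itself infinitely often. Otherwise finitely many close
  returns would have a positive least distance, which \<open>accum\<close> forces the orbit to
  beat.\<close>

lemma accum_self_recurrent:
  assumes "accum c c" "0 < e"
  shows "\<exists>\<^sub>\<infinity>n. rho ((phi ^^ n) c) c < e"
proof (cases "\<exists>n\<ge>1. (phi ^^ n) c = c")
  case True
  then obtain n where n: "n \<ge> 1" "(phi ^^ n) c = c" by blast
  have "(phi ^^ (n * k)) c = c" for k
    by (induction k) (use n in \<open>auto simp: funpow_add\<close>)
  then show ?thesis
    unfolding INFM_nat_le using n assms(2)
    by (intro allI) (metis mult.commute mult_le_mono2 nat_mult_1_right rho_self)
next
  case False
  show ?thesis
  proof (rule ccontr)
    assume "\<not> ?thesis"
    then have fin: "finite {n. rho ((phi ^^ n) c) c < e}"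
      by (simp add: INFM_iff_infinite)
    define S where "S = insert e ((\<lambda>n. rho ((phi ^^ n) c) c) ` ({n. rho ((phi ^^ n) c) c < e} \<inter> {1..}))"
    have S: "finite S" "S \<noteq> {}" using fin by (auto simp: S_def)
    have "0 < s" if "s \<in> S" for s
    proof -
      have "0 < rho ((phi ^^ n) c) c" if "1 \<le> n" for n
        using that False rho_nonneg[of "(phi ^^ n) c" c] rho_eq_0_iff[of "(phi ^^ n) c" c] by fastforce
      then show ?thesis using that assms(2) by (auto simp: S_def)
    qed
    then have "0 < Min S" using S by simp
    then obtain n where n: "n \<ge> 1" "rho ((phi ^^ n) c) c < Min S"
      using assms(1) by (auto simp: accum_def)
    moreover have "Min S \<le> e" using S by (simp add: S_def)
    ultimately have "rho ((phi ^^ n) c) c \<in> S" by (auto simp: S_def)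
    then show False using n S by auto
  qed
qed

text \<open>\<open>B\<close> is uniform over all scales \<open>\<delta>\<close>, which is the whole
  point. Stopping when the radius first reaches \<open>e\<close> keeps all earlier discs in the
  range where the local estimates hold.\<close>

definition expands :: "'x \<Rightarrow> real \<Rightarrow> nat \<Rightarrow> bool" where
  "expands x e B \<longleftrightarrow> (\<forall>\<delta>. 0 < \<delta> \<longrightarrow> \<delta> \<le> e \<longrightarrow>
     (\<exists>n. e \<le> radius x \<delta> n \<and> (\<forall>i<n. radius x \<delta> i < e) \<and> bad_count x \<delta> n \<le> B))"

lemma expands_mono:
  assumes "expands x e B" "e' \<le> e" "B \<le> B'"
  shows "expands x e' B'"
  unfolding expands_def
proof (intro allI impI)
  fix \<delta> assume \<delta>: "0 < \<delta>" "\<delta> \<le> e'"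
  then obtain n where n: "e \<le> radius x \<delta> n" "bad_count x \<delta> n \<le> B"
    using assms by (auto simp: expands_def)
  define m where "m = (LEAST m. e' \<le> radius x \<delta> m)"
  have m: "e' \<le> radius x \<delta> m" "m \<le> n"
    unfolding m_def using n assms by (auto intro: LeastI[of _ n] Least_le)
  have "\<forall>i<m. radius x \<delta> i < e'" unfolding m_def using not_less_Least not_le by blast
  moreover have "bad_count x \<delta> m \<le> B'"
    using bad_count_mono[OF m(2), of x \<delta>] n assms by simp
  ultimately show "\<exists>n. e' \<le> radius x \<delta> n \<and> (\<forall>i<n. radius x \<delta> i < e') \<and> bad_count x \<delta> n \<le> B'"
    using m by blast
qed

text \<open>At the first bad time \<open>k \<ge> 1\<close> the disc lies in a disc of radius
  \<open>s\<close> about some \<open>c\<close> in \<open>T\<close>, which reaches \<open>e\<close>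
  after \<open>m\<close> further steps, at most \<open>B\<close> of them bad. The disc of the orbit
  of \<open>x\<close> is \<open>kap\<close> times smaller, so at time \<open>k + m\<close> it has
  lost at most the factor \<open>kap ^ (d ^ B)\<close>, and every bad step it makes from time
  \<open>k\<close> on is bad for \<open>c\<close> as well. Time 0, about which \<open>near\<close>
  says nothing, accounts for the extra one in \<open>Suc B\<close>.\<close>

lemma expands_step:
  assumes x: "x \<notin> Fatou" and e: "0 < e" "e \<le> kap * r0"
    and T: "\<And>c. c \<in> T \<Longrightarrow> expands c e B"
    and near: "\<And>n c. \<lbrakk>n \<ge> 1; c \<in> Crit; rho ((phi ^^ n) x) c \<le> e\<rbrakk> \<Longrightarrow> c \<in> T"
  shows "expands x (kap ^ (1 + d ^ B) * e) (Suc B)"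
proof -
  \<comment> \<open>One factor \<open>kap\<close> makes the enlarged radius \<open>s\<close> at most
    \<open>e\<close>; the factor \<open>kap ^ (d ^ B)\<close> pays for passing from the disc of
    radius \<open>s\<close> to that of radius \<open>kap * s\<close>.\<close>
  define e1 where "e1 = kap ^ (1 + d ^ B) * e"
  have kr: "kap * r0 \<le> r0" using kap_less_1 r0_pos by simp
  have kap_pow: "kap ^ n \<le> 1" for n using kap_pos kap_less_1 by (simp add: power_le_one)
  have e1_kap: "e1 \<le> kap * e"
    using kap_pos e kap_pow[of "d ^ B"] by (simp add: e1_def mult.assoc mult_left_le_one_le)
  have e1_pow: "e1 \<le> kap ^ (d ^ B) * e"
    using kap_pos e kap_less_1 by (simp add: e1_def mult.assoc mult_left_le_one_le)
  have e1_e: "e1 \<le> e" using e1_pow e kap_pow[of "d ^ B"] kap_pos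
    by (smt (verit) mult_left_le_one_le zero_less_power)
  have "\<exists>n. e1 \<le> radius x \<delta> n \<and> (\<forall>i<n. radius x \<delta> i < e1) \<and> bad_count x \<delta> n \<le> Suc B"
    if \<delta>: "0 < \<delta>" "\<delta> \<le> e1" for \<delta>
  proof -
    obtain n' where n': "e1 \<le> radius x \<delta> n'"
      using radius_escapes[OF x \<delta>(1), of e1] e1_e e kr by auto
    define n where "n = (LEAST m. e1 \<le> radius x \<delta> m)"
    have n: "e1 \<le> radius x \<delta> n" unfolding n_def using n' by (rule LeastI)
    have before: "\<forall>i<n. radius x \<delta> i < e1" unfolding n_def using not_less_Least not_le by blast
    have n_le: "n \<le> m" if "e1 \<le> radius x \<delta> m" for m
      unfolding n_def using that by (rule Least_le)
    have "bad_count x \<delta> n \<le> Suc B"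
    proof (cases "\<exists>k. 1 \<le> k \<and> k < n \<and> bad x \<delta> k")
      case False
      then have "{i. i < n \<and> bad x \<delta> i} \<subseteq> {0}" by (auto simp: not_less_eq_eq)
      from card_mono[OF _ this] show ?thesis by (simp add: bad_count_def)
    next
      case True
      define k where "k = (LEAST k. 1 \<le> k \<and> k < n \<and> bad x \<delta> k)"
      have k: "1 \<le> k" "k < n" "bad x \<delta> k"
        unfolding k_def using LeastI_ex[OF True] by auto
      have k_least: "\<not> bad x \<delta> i" if "1 \<le> i" "i < k" for i
        using not_less_Least[of i "\<lambda>k. 1 \<le> k \<and> k < n \<and> bad x \<delta> k"] that k by (auto simp: k_def)
      define y s where "y = (phi ^^ k) x" and "s = radius x \<delta> k / kap"
      have small: "\<forall>i<k. radius x \<delta> i \<le> r0"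
        using before k e1_e e kr by (meson less_imp_le order_trans less_trans)
      have "0 < radius x \<delta> k" by (rule radius_pos[OF \<delta>(1) small])
      then have s: "0 < s" "kap * s = radius x \<delta> k" using kap_pos by (auto simp: s_def)
      have "s \<le> e" using before k(2) e1_kap kap_pos by (auto simp: s_def field_simps dest!: spec[of _ k])
      obtain c where c: "c \<in> Crit" "rho y c \<le> s"
        using k(3) by (auto simp: bad_def y_def s_def)
      have cT: "c \<in> T" using near[OF k(1) c(1)] c(2) \<open>s \<le> e\<close> by (auto simp: y_def)
      obtain m where m: "e \<le> radius c s m" "\<forall>i<m. radius c s i < e" "bad_count c s m \<le> B"
        using T[OF cT] s(1) \<open>s \<le> e\<close> by (auto simp: expands_def)
      have smallc: "\<forall>i<m. radius c s i \<le> r0" "\<forall>i<m. radius c s i \<le> kap * r0"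
        using m(2) e kr by (meson less_imp_le order_trans)+
      have cy: "rho c y \<le> s" using c(2) rho_commute by metis
      have rad: "radius y s j = radius c s j" if "j \<le> m" for j
        by (rule radius_recenter[OF s(1) smallc(1) cy that])
      have ratio: "radius y (kap * s) j \<le> radius y s j"
        "kap ^ (d ^ bad_count y s j) * radius y s j \<le> radius y (kap * s) j" if "j \<le> m" for j
        using radius_mono_ratio[of s m y kap j] s smallc rad kap_pos kap_less_1 that by auto
      \<comment> \<open>A disc about the orbit of \<open>y\<close> sits inside the one about the
        orbit of \<open>c\<close>, so a critical point near the former is near the latter. Both
        radii \<open>s\<close> and \<open>kap * s\<close> are treated: \<open>s\<close> bounds the
        exponent of the shrinkage, \<open>kap * s\<close> counts the bad steps of
        \<open>x\<close>.\<close>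
      have bad_sub: "bad c s j" if j: "j < m" and b: "bad y s' j" and s': "s' = s \<or> s' = kap * s" for j s'
      proof -
        obtain c' where c': "c' \<in> Crit" "rho ((phi ^^ j) y) c' \<le> radius y s' j / kap"
          using b by (auto simp: bad_def)
        have "radius y s' j \<le> radius c s j" using s' ratio(1)[of j] rad[of j] j by auto
        then have "rho ((phi ^^ j) y) c' \<le> radius c s j / kap"
          using c'(2) kap_pos by (smt (verit) divide_right_mono)
        moreover have smallj: "\<forall>i<j. radius c s i \<le> r0" using smallc(1) j by auto
        have "rho ((phi ^^ j) c) ((phi ^^ j) y) \<le> radius c s j"
          by (rule iterate_in_disc[OF s(1) smallj cy])
        moreover have "radius c s j \<le> radius c s j / kap"
          using radius_pos[OF s(1) smallj] kap_pos kap_less_1 by (simp add: field_simps)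
        ultimately show ?thesis
          using rho_ultra[of "(phi ^^ j) c" c' "(phi ^^ j) y"] c'(1) unfolding bad_def
          by (intro bexI[of _ c']) auto
      qed
      have count_sub: "bad_count y s' m \<le> B" if "s' = s \<or> s' = kap * s" for s'
        using card_mono[of "{i. i < m \<and> bad c s i}" "{i. i < m \<and> bad y s' i}"] bad_sub[OF _ _ that] m(3)
        by (fastforce simp: bad_count_def)
      have "kap ^ (d ^ B) \<le> kap ^ (d ^ bad_count y s m)"
        using kap_pos kap_less_1 count_sub[of s] d_pos by (intro power_decreasing power_increasing) auto
      then have "kap ^ (d ^ B) * e \<le> kap ^ (d ^ bad_count y s m) * radius y s m"
        using m(1) rad[of m] kap_pos e by (intro mult_mono) auto
      also have "\<dots> \<le> radius y (kap * s) m" using ratio(2) by simp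
      also have "\<dots> = radius x \<delta> (k + m)" by (simp add: radius_add s(2) y_def)
      finally have nm: "n \<le> k + m" using e1_pow by (intro n_le) auto
      \<comment> \<open>No time strictly between 0 and \<open>k\<close> is bad, and
        \<open>n \<le> k + m\<close> puts the remaining bad times into the stretch controlled by
        \<open>c\<close>.\<close>
      have "{i. i < n \<and> bad x \<delta> i} \<subseteq> insert 0 ((\<lambda>i. k + i) ` {i. i < m \<and> bad y (kap * s) i})"
      proof
        fix i assume i: "i \<in> {i. i < n \<and> bad x \<delta> i}"
        show "i \<in> insert 0 ((\<lambda>i. k + i) ` {i. i < m \<and> bad y (kap * s) i})"
        proof (cases "i < k")
          case True
          then show ?thesis using k_least[of i] i by (cases i) auto
        next
          case False
          then obtain j where j: "i = k + j" by (metis le_add_diff_inverse not_less)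
          have "bad y (kap * s) j \<longleftrightarrow> bad x \<delta> i"
            unfolding bad_def j radius_add s(2)[symmetric] y_def
            by (simp add: add.commute[of k] funpow_add s(2))
          then show ?thesis using i j nm by auto
        qed
      qed
      then have "bad_count x \<delta> n \<le> card (insert 0 ((\<lambda>i. k + i) ` {i. i < m \<and> bad y (kap * s) i}))"
        unfolding bad_count_def by (intro card_mono) auto
      also have "\<dots> \<le> Suc (card ((\<lambda>i. k + i) ` {i. i < m \<and> bad y (kap * s) i}))"
        by (rule card_insert_le_m1) auto
      also have "\<dots> \<le> Suc (card {i. i < m \<and> bad y (kap * s) i})"
        by (intro Suc_le_mono[THEN iffD2] card_image_le) auto
      also have "\<dots> \<le> Suc B" using count_sub[of "kap * s"] by (simp add: bad_count_def)
      finally show ?thesis .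
    qed
    then show ?thesis using n before by blast
  qed
  then show ?thesis unfolding expands_def e1_def by blast
qed

text \<open>The orbit of \<open>x\<close> keeps a positive distance from the critical points that it
  does not accumulate. Those that it does accumulate are Julia points, since the Fatou set is open
  and contains the preimages of its points, so \<open>acc\<close> supplies their expansion
  constants.\<close>

lemma expands_of_accum:
  assumes x: "x \<notin> Fatou"
    and acc: "\<And>c. \<lbrakk>c \<in> Crit; c \<notin> Fatou; accum c x\<rbrakk> \<Longrightarrow> \<exists>e>0. \<exists>B. expands c e B"
  shows "\<exists>e>0. e \<le> kap * r0 \<and> (\<exists>B. expands x e B)"
proof -
  define T where "T = {c \<in> Crit. accum c x}"
  have finT: "finite T" using finite_Crit by (simp add: T_def)
  have TJ: "c \<notin> Fatou" if "c \<in> T" for c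
  proof
    assume "c \<in> Fatou"
    then obtain e where e: "e > 0" "\<And>y. rho c y < e \<Longrightarrow> y \<in> Fatou" using Fatou_open by blast
    have "accum c x" using that by (simp add: T_def)
    then obtain n where "rho ((phi ^^ n) x) c < e" using e(1) unfolding accum_def by meson
    then have "(phi ^^ n) x \<in> Fatou" using e(2) rho_commute by metis
    then show False using Fatou_preimage_iterate x by blast
  qed
  obtain E Bf where E: "\<And>c. c \<in> T \<Longrightarrow> E c > 0 \<and> expands c (E c) (Bf c)"
    using acc TJ unfolding T_def by (metis (lifting) mem_Collect_eq)
  obtain h where h: "\<And>c. c \<in> Crit - T \<Longrightarrow> h c > 0 \<and> (\<forall>n\<ge>1. h c < rho ((phi ^^ n) x) c)"
  proof -
    have "\<exists>h>0. \<forall>n\<ge>1. h < rho ((phi ^^ n) x) c" if c: "c \<in> Crit - T" for c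
    proof -
      obtain h where "h > 0" "\<forall>n\<ge>1. h \<le> rho ((phi ^^ n) x) c"
        using c unfolding T_def accum_def by (auto simp: not_less)
      then show ?thesis by (intro exI[of _ "h / 2"]) force
    qed
    then show ?thesis using that by metis
  qed
  define e where "e = Min ({kap * r0} \<union> E ` T \<union> h ` (Crit - T))"
  define B where "B = Max (insert 0 (Bf ` T))"
  have fin: "finite ({kap * r0} \<union> E ` T \<union> h ` (Crit - T))"
    using finT finite_Crit by auto
  have e: "0 < e" unfolding e_def using fin E h kap_pos r0_pos by (subst Min_gr_iff) auto
  have e_le: "e \<le> kap * r0" "\<And>c. c \<in> T \<Longrightarrow> e \<le> E c" "\<And>c. c \<in> Crit - T \<Longrightarrow> e \<le> h c"
    unfolding e_def using fin by (auto intro!: Min_le)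
  have B: "Bf c \<le> B" if "c \<in> T" for c unfolding B_def using that finT by auto
  have "expands x (kap ^ (1 + d ^ B) * e) (Suc B)"
  proof (rule expands_step[OF x e e_le(1)])
    show "expands c e B" if "c \<in> T" for c
      using E[OF that] e_le(2)[OF that] B[OF that] by (blast intro: expands_mono)
    fix n c assume n: "1 \<le> n" "c \<in> Crit" "rho ((phi ^^ n) x) c \<le> e"
    show "c \<in> T"
    proof (rule ccontr)
      assume "c \<notin> T"
      then have "h c > 0" "h c < rho ((phi ^^ n) x) c" "e \<le> h c" using h e_le(3) n by auto
      then show False using n(3) by linarith
    qed
  qed
  moreover have "kap ^ (1 + d ^ B) * e \<le> 1 * e"
    using e kap_pos kap_less_1 by (intro mult_right_mono power_le_one) auto
  moreover have "0 < kap ^ (1 + d ^ B) * e" using e kap_pos by simp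
  ultimately show ?thesis using e_le(1) by (intro exI[of _ "kap ^ (1 + d ^ B) * e"]) auto
qed

theorem bounded_expansion:
  assumes nonrec: "\<forall>c\<in>Crit - Fatou. \<not> accum c c"
    and x: "x \<notin> Fatou"
  shows "\<exists>e>0. e \<le> kap * r0 \<and> (\<exists>B. expands x e B)"
proof -
  define CJ where "CJ = Crit - Fatou"
  have fin: "finite CJ" using finite_Crit by (simp add: CJ_def)
  have "\<exists>e>0. \<exists>B. expands c e B" if "c \<in> CJ" for c
    using that
  \<comment> \<open>On passing from \<open>c\<close> to a Julia critical point \<open>b\<close>
    accumulated by its orbit, transitivity keeps the set inside the old one, and nonrecurrence
    removes \<open>b\<close> itself, so the measure drops.\<close>
  proof (induction "card {b \<in> CJ. accum b c}" arbitrary: c rule: less_induct)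
    case less
    have "\<exists>e>0. \<exists>B. expands b e B" if b: "b \<in> CJ" "accum b c" for b
    proof (rule less.hyps[OF _ b(1)])
      have "{a \<in> CJ. accum a b} \<subseteq> {b \<in> CJ. accum b c}"
        using accum_trans[OF _ b(2)] by auto
      moreover have "b \<in> {b \<in> CJ. accum b c}" using b by simp
      moreover have "b \<notin> {a \<in> CJ. accum a b}" using nonrec b(1) by (auto simp: CJ_def)
      ultimately have "{a \<in> CJ. accum a b} \<subset> {b \<in> CJ. accum b c}" by (metis psubsetI)
      then show "card {a \<in> CJ. accum a b} < card {b \<in> CJ. accum b c}"
        using fin by (intro psubset_card_mono) auto
    qed
    then show ?case using expands_of_accum[of c] less.prems by (auto simp: CJ_def)
  qed
  then show ?thesis using expands_of_accum[OF x] by (auto simp: CJ_def)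
qed

text \<open>\<open>t\<close> does not depend on the scale \<open>\<delta>\<close>; this is what contradicts equicontinuity on a
  subset containing equally spread configurations at arbitrarily small scales.\<close>

theorem separated_points_spread:
  assumes nonrec: "\<forall>c\<in>Crit - Fatou. \<not> accum c c"
    and x: "x \<notin> Fatou"
  shows "\<exists>e N. 0 < e \<and> (\<forall>t \<delta> S. 0 < t \<longrightarrow> t \<le> 1 \<longrightarrow> 0 < \<delta> \<longrightarrow> \<delta> \<le> e \<longrightarrow>
    finite S \<longrightarrow> N < card S \<longrightarrow> (\<forall>y\<in>S. rho x y \<le> \<delta>) \<longrightarrow>
    (\<forall>y\<in>S. \<forall>z\<in>S. y \<noteq> z \<longrightarrow> t * \<delta> \<le> rho y z) \<longrightarrow>
    (\<exists>n. \<exists>y\<in>S. t ^ N * e \<le> rho ((phi ^^ n) x) ((phi ^^ n) y)))"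
proof -
  obtain e B where e: "0 < e" "e \<le> kap * r0" "expands x e B"
    using bounded_expansion[OF nonrec x] by blast
  have spread: "\<exists>n. \<exists>y\<in>S. t ^ (d ^ B) * e \<le> rho ((phi ^^ n) x) ((phi ^^ n) y)"
    if t: "0 < t" "t \<le> 1" and \<delta>: "0 < \<delta>" "\<delta> \<le> e" and S: "finite S" "d ^ B < card S" "\<forall>y\<in>S. rho x y \<le> \<delta>"
       "\<forall>y\<in>S. \<forall>z\<in>S. y \<noteq> z \<longrightarrow> t * \<delta> \<le> rho y z" for t \<delta> S
  proof -
    obtain n where n: "e \<le> radius x \<delta> n" "\<forall>i<n. radius x \<delta> i < e" "bad_count x \<delta> n \<le> B"
      using e(3) \<delta> by (auto simp: expands_def)
    have small: "\<forall>i<n. radius x \<delta> i \<le> kap * r0" using n(2) e(2) by (meson less_imp_le order_trans)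
    define N where "N = d ^ bad_count x \<delta> n"
    have N: "N \<le> d ^ B" unfolding N_def using n(3) d_pos by (intro power_increasing) auto
    obtain Y where Y: "finite Y" "card Y \<le> N"
      "\<And>y. rho x y \<le> \<delta> \<Longrightarrow> rho ((phi ^^ n) x) ((phi ^^ n) y) < t ^ N * radius x \<delta> n
      \<Longrightarrow> \<exists>v\<in>Y. rho v y < t * \<delta>"
      using iterate_cover[OF \<delta>(1) small t, of "(phi ^^ n) x"] unfolding N_def by blast
    have "t ^ (d ^ B) * e \<le> t ^ N * radius x \<delta> n"
      using t n(1) e N by (intro mult_mono power_decreasing) auto
    \<comment> \<open>Pigeonhole: if all points of \<open>S\<close> were covered by
      \<open>Y\<close>, two of them would share a disc of radius \<open>t * \<delta>\<close> and be
      closer than their separation.\<close>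
    moreover have "\<exists>y\<in>S. \<not> rho ((phi ^^ n) x) ((phi ^^ n) y) < t ^ N * radius x \<delta> n"
    proof (rule ccontr)
      assume "\<not> ?thesis"
      then have "\<forall>y\<in>S. \<exists>v\<in>Y. rho v y < t * \<delta>" using Y(3) S(3) by blast
      then obtain v where v: "\<And>y. y \<in> S \<Longrightarrow> v y \<in> Y \<and> rho (v y) y < t * \<delta>" by metis
      have "card (v ` S) \<le> card Y" using v Y(1) by (intro card_mono) auto
      then have "\<not> inj_on v S" using card_image[of v S] Y(2) N S(2) by auto
      then obtain y z where yz: "y \<in> S" "z \<in> S" "y \<noteq> z" "v y = v z" by (auto simp: inj_on_def)
      then have "rho y z < t * \<delta>"
        using v[of y] v[of z] rho_ultra[of y z "v y"] rho_commute[of "v y" y] by auto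
      then show False using S(4) yz by fastforce
    qed
    ultimately show ?thesis by (meson dual_order.trans not_less)
  qed
  show ?thesis
    by (rule exI[of _ e], rule exI[of _ "d ^ B"], intro conjI allI impI, rule e(1), rule spread)
qed

end

section \<open>Wronskians, reversed polynomials and Bezout\<close>

lemma all_nat_iff_0_Suc: "(\<forall>j. P j) \<longleftrightarrow> P 0 \<and> (\<forall>j. P (Suc j))"
  by (metis not0_implies_Suc)

text \<open>A nonzero combination of least degree divides every other combination, in particular
  \<open>p\<close> and \<open>q\<close>.\<close>

lemma poly_bezout:
  fixes p q :: "'a::field poly"
  assumes "coprime p q"
  shows "\<exists>a b. a * p + b * q = 1"
proof -
  define I where "I = {m. m \<noteq> 0 \<and> (\<exists>a b. m = a * p + b * q)}"
  have "p \<noteq> 0 \<or> q \<noteq> 0" using assms by auto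
  then have "p \<in> I \<or> q \<in> I"
    unfolding I_def by (metis (mono_tags, lifting) add_0 add.right_neutral mem_Collect_eq mult_1 mult_zero_left)
  then obtain m where m: "m \<in> I" "\<And>k. k \<in> I \<Longrightarrow> degree m \<le> degree k"
    using ex_has_least_nat[of "\<lambda>k. k \<in> I" _ degree] by blast
  obtain a b where ab: "m = a * p + b * q" "m \<noteq> 0" using m(1) by (auto simp: I_def)
  have dvd: "m dvd x" if "x = a' * p + b' * q" for x a' b'
  proof (rule ccontr)
    assume "\<not> m dvd x"
    then have nz: "x mod m \<noteq> 0" by (simp add: mod_eq_0_iff_dvd)
    have "x mod m = x - x div m * m" by (rule minus_div_mult_eq_mod[symmetric])
    also have "\<dots> = (a' - x div m * a) * p + (b' - x div m * b) * q"
      unfolding ab(1) that by (simp add: algebra_simps)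
    finally have "x mod m \<in> I" using nz by (auto simp: I_def)
    then show False using m(2)[of "x mod m"] degree_mod_less[of m x] ab(2) nz by auto
  qed
  have "m dvd p" using dvd[of p 1 0] by simp
  moreover have "m dvd q" using dvd[of q 0 1] by simp
  ultimately have "m dvd 1" using assms by (auto simp: coprime_def)
  then obtain k where "1 = m * k" by (rule dvdE)
  then have "(k * a) * p + (k * b) * q = 1" using ab(1) by (simp add: algebra_simps)
  then show ?thesis by blast
qed

section \<open>Reversed polynomials: the coordinate 1/z\<close>

lemma coeff_rev_poly: "coeff (rev_poly d q) i = (if i \<le> d then coeff q (d - i) else 0)"
  by (simp add: rev_poly_def coeff_sum if_distrib[of "\<lambda>x. x = _"] sum.delta cong: if_cong)

lemma degree_rev_poly: "degree (rev_poly d q) \<le> d"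
  by (rule degree_le) (simp add: coeff_rev_poly)

lemma poly_eq_sum_atMost:
  fixes p :: "'a::comm_semiring_1 poly"
  assumes "degree p \<le> n"
  shows "poly p x = (\<Sum>i\<le>n. coeff p i * x ^ i)"
  unfolding poly_altdef
  using assms by (intro sum.mono_neutral_left) (auto simp: coeff_eq_0)

lemma poly_rev_poly:
  assumes "degree q \<le> d" "u \<noteq> 0"
  shows "poly (rev_poly d q) u = u ^ d * poly q (1 / u)"
proof -
  have "poly (rev_poly d q) u = (\<Sum>i\<le>d. coeff q (d - i) * u ^ i)"
    by (simp add: poly_eq_sum_atMost[OF degree_rev_poly] coeff_rev_poly)
  also have "\<dots> = (\<Sum>i\<le>d. coeff q i * u ^ (d - i))"
    by (rule sum.reindex_bij_witness[of _ "\<lambda>i. d - i" "\<lambda>i. d - i"]) auto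
  also have "\<dots> = (\<Sum>i\<le>d. u ^ d * (coeff q i * (1 / u) ^ i))"
    using assms(2) by (intro sum.cong) (auto simp: power_diff field_simps)
  finally show ?thesis by (simp add: poly_eq_sum_atMost[OF assms(1)] sum_distrib_left)
qed

lemma poly_eqI_nonzero:
  fixes p q :: "'a::field_char_0 poly"
  assumes "\<And>u. u \<noteq> 0 \<Longrightarrow> poly p u = poly q u"
  shows "p = q"
proof -
  have "poly ([:0, 1:] * (p - q)) u = poly 0 u" for u
    using assms[of u] by (cases "u = 0") auto
  then have "[:0, 1:] * (p - q) = 0" by (intro poly_eq_poly_eq_iff[THEN iffD1] ext)
  then show ?thesis by (subst (asm) mult_eq_0_iff) auto
qed

lemma dvd_of_dvd_X_power_mult:
  fixes c :: "'a::field poly"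
  assumes "c dvd [:0, 1:] ^ m * y" "poly c 0 \<noteq> 0"
  shows "c dvd y"
  using assms(1)
proof (induction m)
  case (Suc m)
  then obtain k where k: "[:0, 1:] * ([:0, 1:] ^ m * y) = c * k" by (auto simp only: power_Suc mult.assoc dvd_def)
  have "poly c 0 * poly k 0 = poly ([:0, 1:] * ([:0, 1:] ^ m * y)) 0" unfolding k by simp
  then have "poly k 0 = 0" using assms(2) by (subst (asm) poly_mult) simp
  then obtain k' where "k = [:0, 1:] * k'" by (auto simp: poly_eq_0_iff_dvd)
  then have "[:0, 1:] * ([:0, 1:] ^ m * y) = [:0, 1:] * (c * k')" using k by (simp only: mult_ac)
  then have "[:0, 1:] ^ m * y = c * k'" by (subst (asm) mult_cancel_left) auto
  then show ?case using Suc.IH by simp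
qed simp

text \<open>Reversing a Bezout identity exhibits a power of \<open>X\<close> as a combination of the
  reversed polynomials, so a common divisor divides that power.\<close>

lemma coprime_rev_poly:
  fixes f g :: "'c::field_char_0 poly"
  assumes "coprime f g" and d: "d = rat_degree f g"
  shows "coprime (rev_poly d f) (rev_poly d g)"
proof (rule coprimeI)
  fix c assume c: "c dvd rev_poly d f" "c dvd rev_poly d g"
  have df: "degree f \<le> d" "degree g \<le> d" by (auto simp: d rat_degree_def)
  obtain a b where ab: "a * f + b * g = 1" using poly_bezout[OF assms(1)] by blast
  define e where "e = max (degree a) (degree b)"
  have "rev_poly e a * rev_poly d f + rev_poly e b * rev_poly d g = [:0, 1:] ^ (d + e)"
  proof (rule poly_eqI_nonzero)
    fix u :: 'c assume u: "u \<noteq> 0"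
    have "poly (a * f + b * g) (1 / u) = 1" unfolding ab by simp
    then have "u ^ (d + e) * (poly a (1 / u) * poly f (1 / u) + poly b (1 / u) * poly g (1 / u)) = u ^ (d + e)"
      by simp
    then show "poly (rev_poly e a * rev_poly d f + rev_poly e b * rev_poly d g) u = poly ([:0, 1:] ^ (d + e)) u"
      using u df by (simp add: poly_rev_poly e_def power_add algebra_simps)
  qed
  then have "c dvd [:0, 1:] ^ (d + e) * 1" using c by (metis dvd_add dvd_mult mult_1_right)
  \<comment> \<open>The values of the reversed polynomials at 0 are the coefficients of index
    \<open>d\<close>, and these do not both vanish because \<open>d\<close> is the larger
    degree.\<close>
  moreover have "poly c 0 \<noteq> 0"
  proof
    assume "poly c 0 = 0"
    then have "poly (rev_poly d f) 0 = 0" "poly (rev_poly d g) 0 = 0"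
      using c by (auto elim!: dvdE)
    then have fg: "coeff f d = 0" "coeff g d = 0" by (auto simp: poly_0_coeff_0 coeff_rev_poly)
    have zero: "p = 0 \<and> q = 0"
      if "coeff p (degree p) = 0" "coeff q (degree p) = 0" "degree q \<le> degree p" for p q :: "'c poly"
      using that by (metis degree_0 le_zero_eq leading_coeff_0_iff)
    have "d = degree f \<or> d = degree g" by (auto simp: d rat_degree_def max_def)
    then have "f = 0 \<and> g = 0" using zero fg df by metis
    then show False using assms(1) by simp
  qed
  ultimately show "is_unit c" using dvd_of_dvd_X_power_mult by blast
qed

section \<open>Wronskians and difference numerators\<close>

definition wronskian :: "'a::idom poly \<Rightarrow> 'a poly \<Rightarrow> 'a poly" where
  "wronskian F G = pderiv F * G - F * pderiv G"

lemma wronskian_commute: "wronskian G F = - wronskian F G"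
  by (simp add: wronskian_def algebra_simps)

text \<open>From \<open>pderiv F * G = F * pderiv G\<close> and coprimality \<open>G\<close> divides
  its own derivative, which in characteristic 0 only a constant can do.\<close>

lemma wronskian_eq_0_imp_degree:
  fixes F G :: "'a::field_char_0 poly"
  assumes "coprime F G" "wronskian F G = 0"
  shows "degree G = 0"
proof (rule ccontr)
  assume nz: "degree G \<noteq> 0"
  obtain a b where ab: "a * F + b * G = 1" using poly_bezout[OF assms(1)] by blast
  have "pderiv G = pderiv G * (a * F + b * G)" unfolding ab by simp
  also have "\<dots> = a * (F * pderiv G) + G * (b * pderiv G)" by (simp add: algebra_simps)
  also have "F * pderiv G = pderiv F * G" using assms(2) by (simp add: wronskian_def)
  finally have "pderiv G = G * (a * pderiv F + b * pderiv G)" by (simp add: algebra_simps)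
  then have "G dvd pderiv G" by (metis dvd_triv_left)
  moreover have "pderiv G \<noteq> 0" using nz by (simp add: pderiv_eq_0_iff)
  ultimately have "degree G \<le> degree (pderiv G)" by (rule dvd_imp_degree_le)
  then show False using nz by (simp add: degree_pderiv)
qed

text \<open>The chain rule for \<open>1/u\<close> with denominators cleared; it lets critical points
  be compared between the two coordinates.\<close>

lemma wronskian_rev_poly:
  fixes f g :: "'c::field_char_0 poly"
  assumes "degree f \<le> d" "degree g \<le> d" "u \<noteq> 0"
  shows "u\<^sup>2 * poly (wronskian (rev_poly d f) (rev_poly d g)) u
    = - (u ^ d)\<^sup>2 * poly (wronskian f g) (1 / u)"
proof -
  have D: "u\<^sup>2 * poly (pderiv (rev_poly d q)) u
    = u ^ d * (of_nat d * u * poly q (1 / u) - poly (pderiv q) (1 / u))" if q: "degree q \<le> d" for q :: "'c poly"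
  proof -
    have dp: "degree (pderiv p) \<le> n" if "degree p \<le> n" for p :: "'c poly" and n
      using that by (simp add: degree_pderiv)
    have X: "x * poly (pderiv p) x = (\<Sum>i\<le>d. of_nat i * coeff p i * x ^ i)" if "degree p \<le> d" for p :: "'c poly" and x
    proof -
      have "x * poly (pderiv p) x = poly (pCons 0 (pderiv p)) x" by simp
      also have "degree (pCons 0 (pderiv p)) \<le> d"
        using that by (cases "pderiv p = 0") (auto simp: degree_pderiv pderiv_eq_0_iff)
      then have "poly (pCons 0 (pderiv p)) x = (\<Sum>i\<le>d. coeff (pCons 0 (pderiv p)) i * x ^ i)"
        by (rule poly_eq_sum_atMost)
      also have "\<dots> = (\<Sum>i\<le>d. of_nat i * coeff p i * x ^ i)"
        by (intro sum.cong) (auto simp: coeff_pCons coeff_pderiv split: nat.split)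
      finally show ?thesis .
    qed
    have "u * poly (pderiv (rev_poly d q)) u = (\<Sum>i\<le>d. of_nat i * coeff q (d - i) * u ^ i)"
      by (simp add: X[OF degree_rev_poly] coeff_rev_poly)
    also have "\<dots> = (\<Sum>i\<le>d. of_nat (d - i) * coeff q i * u ^ (d - i))"
      by (rule sum.reindex_bij_witness[of _ "\<lambda>i. d - i" "\<lambda>i. d - i"]) auto
    also have "\<dots> = (\<Sum>i\<le>d. of_nat d * (u ^ d * (coeff q i * (1 / u) ^ i)) - u ^ d * (of_nat i * coeff q i * (1 / u) ^ i))"
      using assms(3) by (intro sum.cong) (auto simp: power_diff of_nat_diff field_simps)
    also have "\<dots> = of_nat d * (u ^ d * poly q (1 / u)) - u ^ d * (1 / u * poly (pderiv q) (1 / u))"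
      unfolding X[OF q] poly_eq_sum_atMost[OF q] by (simp add: sum_subtractf sum_distrib_left)
    finally have "u * (u * poly (pderiv (rev_poly d q)) u)
      = u * (of_nat d * (u ^ d * poly q (1 / u)) - u ^ d * (1 / u * poly (pderiv q) (1 / u)))" by simp
    then show ?thesis using assms(3) by (simp add: power2_eq_square algebra_simps)
  qed
  have "u\<^sup>2 * poly (wronskian (rev_poly d f) (rev_poly d g)) u
    = (u\<^sup>2 * poly (pderiv (rev_poly d f)) u) * poly (rev_poly d g) u
      - poly (rev_poly d f) u * (u\<^sup>2 * poly (pderiv (rev_poly d g)) u)"
    by (simp add: wronskian_def algebra_simps)
  then show ?thesis
    unfolding D[OF assms(1)] D[OF assms(2)] poly_rev_poly[OF assms(1,3)] poly_rev_poly[OF assms(2,3)]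
    by (simp add: wronskian_def power2_eq_square algebra_simps)
qed

text \<open>With \<open>h = F / G\<close>, the value of the twist at \<open>u\<close> is \<open>h (a + u) - h a\<close> with denominators cleared.\<close>

definition twist :: "'a::comm_ring_1 poly \<Rightarrow> 'a poly \<Rightarrow> 'a \<Rightarrow> 'a poly" where
  "twist F G a = smult (poly G a) (pcompose F [:a, 1:]) - smult (poly F a) (pcompose G [:a, 1:])"

lemma poly_twist: "poly (twist F G a) u = poly G a * poly F (a + u) - poly F a * poly G (a + u)"
  by (simp add: twist_def poly_pcompose)

lemma twist_commute: "twist G F a = - twist F G a"
  by (simp add: twist_def)

lemma coeff_0_twist [simp]: "coeff (twist F G a) 0 = 0"
  by (simp add: poly_0_coeff_0[symmetric] poly_twist)

lemma degree_twist:
  fixes F G :: "'a::idom poly"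
  assumes "degree F \<le> d" "degree G \<le> d"
  shows "degree (twist F G a) \<le> d"
  unfolding twist_def using assms
  by (intro degree_diff_le order_trans[OF degree_smult_le]) (auto simp: degree_pcompose)

text \<open>With \<open>h = F / G\<close>, the quotient of the twist by \<open>G (a + u)\<close> is
  \<open>G a\<close> times \<open>h (a + u) - h a\<close>, whose derivative is \<open>G a\<close>
  times \<open>h' (a + u)\<close>.\<close>

lemma wronskian_twist:
  fixes F G :: "'a::idom poly"
  shows "wronskian (twist F G a) (pcompose G [:a, 1:]) = smult (poly G a) (pcompose (wronskian F G) [:a, 1:])"
  by (simp add: wronskian_def twist_def pderiv_diff pderiv_smult pderiv_pcompose pderiv_pCons
      pcompose_diff pcompose_mult algebra_simps smult_diff_right)

text \<open>The identity \<open>h (a + s + u) - h (a + s) = (h (a + s + u) - h a) - (h (a + s) - h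
  a)\<close>, with denominators cleared.\<close>

lemma twist_translate:
  fixes F G :: "'a::{idom,ring_char_0} poly"
  shows "smult (poly G a) (twist F G (a + s)) =
    smult (poly G (a + s)) (pcompose (twist F G a) [:s, 1:]) - smult (poly (twist F G a) s) (pcompose G [:a + s, 1:])"
  by (rule poly_eq_poly_eq_iff[THEN iffD1], rule ext)
     (simp add: poly_twist poly_pcompose algebra_simps)

section \<open>Gauss norms\<close>

context nonarch_absolute_value
begin

lemma av_diff: "av (x - y) \<le> max (av x) (av y)"
  using av_ultrametric[of x "- y"] by (simp add: av_minus)

lemma av_power: "av (x ^ n) = av x ^ n"
  by (induction n) (simp_all add: av_one av_mult)

lemma av_inverse: "av (inverse x) = inverse (av x)"
proof (cases "x = 0")
  case False
  then have "av x * av (inverse x) = 1" by (simp add: av_mult[symmetric] av_one)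
  then show ?thesis by (metis inverse_unique)
qed (simp add: av_zero)

lemma av_divide: "av (x / y) = av x / av y"
  by (simp add: divide_inverse av_mult av_inverse)

lemma av_pos_iff: "0 < av x \<longleftrightarrow> x \<noteq> 0"
  using av_nonneg[of x] av_eq_0_iff[of x] by linarith

lemma av_of_nat_le_1: "av (of_nat n) \<le> 1"
proof (induction n)
  case (Suc n)
  then show ?case using av_ultrametric[of 1 "of_nat n"] by (auto simp: av_one)
qed (simp add: av_zero)

lemma av_sum_le:
  assumes "0 \<le> B" "\<And>i. i \<in> S \<Longrightarrow> av (h i) \<le> B"
  shows "av (sum h S) \<le> B"
  using assms(2)
proof (induction S rule: infinite_finite_induct)
  case (insert x S)
  then show ?case using av_ultrametric[of "h x" "sum h S"] by fastforce
qed (use assms(1) in \<open>auto simp: av_zero\<close>)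

lemma av_add_eq_left:
  assumes "av y < av x"
  shows "av (x + y) = av x"
  using av_ultrametric[of x y] av_diff[of "x + y" y] assms by (simp add: max_def split: if_splits)

lemma av_of_nat_mult_le: "av (of_nat n * x) \<le> av x"
  using av_of_nat_le_1[of n] av_nonneg by (simp add: av_mult mult_left_le_one_le)

lemma av_fact_mult_mono:
  assumes "j \<le> k"
  shows "av (fact k * x) \<le> av (fact j * x)"
proof -
  obtain m :: nat where "fact k = (fact j :: nat) * m" using fact_dvd[OF assms] by (auto elim: dvdE)
  then have "(fact k :: 'c) = of_nat m * fact j" by (metis of_nat_fact of_nat_mult mult.commute)
  then show ?thesis using av_of_nat_mult_le[of m "fact j * x"] by (simp add: mult.assoc)
qed

text \<open>An upper bound on the Gauss norm, stated coefficientwise so that it can be carried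
  through inductions on the polynomial.\<close>

definition coeff_bound :: "real \<Rightarrow> real \<Rightarrow> 'c poly \<Rightarrow> bool" where
  "coeff_bound r B p \<longleftrightarrow> (\<forall>j. av (coeff p j) * r ^ j \<le> B)"

lemma coeff_bound_nonneg: "coeff_bound r B p \<Longrightarrow> 0 \<le> B"
  unfolding coeff_bound_def by (metis av_nonneg mult_cancel_left2 order_trans power_0)

lemma coeff_bound_pCons:
  assumes "0 < r"
  shows "coeff_bound r B (pCons c q) \<longleftrightarrow> av c \<le> B \<and> coeff_bound r (B / r) q"
proof -
  have "av (coeff q j) * r ^ Suc j \<le> B \<longleftrightarrow> av (coeff q j) * r ^ j \<le> B / r" for j
    using assms by (simp add: field_simps)
  moreover have "(\<forall>j. av (coeff (pCons c q) j) * r ^ j \<le> B) \<longleftrightarrow>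
      av c \<le> B \<and> (\<forall>j. av (coeff q j) * r ^ Suc j \<le> B)"
    by (rule trans[OF all_nat_iff_0_Suc]) simp
  ultimately show ?thesis by (simp only: coeff_bound_def)
qed

lemma coeff_bound_add:
  assumes "coeff_bound r B p" "coeff_bound r B q" "0 \<le> r"
  shows "coeff_bound r B (p + q)"
  unfolding coeff_bound_def
proof
  fix j
  have "av (coeff (p + q) j) * r ^ j \<le> max (av (coeff p j)) (av (coeff q j)) * r ^ j"
    using assms av_ultrametric by (intro mult_right_mono) auto
  then show "av (coeff (p + q) j) * r ^ j \<le> B"
    using assms by (auto simp: coeff_bound_def max_def split: if_splits intro: order_trans)
qed

lemma coeff_bound_smult:
  assumes "coeff_bound r B p"
  shows "coeff_bound r (av c * B) (smult c p)"
  unfolding coeff_bound_def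
proof
  fix j
  have "av c * (av (coeff p j) * r ^ j) \<le> av c * B"
    using assms by (intro mult_left_mono av_nonneg) (simp add: coeff_bound_def)
  then show "av (coeff (smult c p) j) * r ^ j \<le> av c * B" by (simp add: av_mult mult.assoc)
qed

lemma coeff_bound_minus: "coeff_bound r B (- p) \<longleftrightarrow> coeff_bound r B p"
  by (simp add: coeff_bound_def av_minus)

lemma coeff_bound_diff:
  assumes "coeff_bound r B p" "coeff_bound r B q" "0 \<le> r"
  shows "coeff_bound r B (p - q)"
  using coeff_bound_add[of r B p "- q"] assms by (simp add: coeff_bound_minus)

text \<open>Submultiplicativity of the Gauss norm: each summand of a convolution obeys the bound,
  and the ultrametric inequality passes it to the sum.\<close>

lemma coeff_bound_mult:
  assumes "coeff_bound r B p" "coeff_bound r D q" "0 \<le> r"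
  shows "coeff_bound r (B * D) (p * q)"
  unfolding coeff_bound_def
proof
  fix n
  have nn: "0 \<le> B" "0 \<le> D" using assms by (auto intro: coeff_bound_nonneg)
  have "coeff (p * q) n * s ^ n = (\<Sum>i\<le>n. (coeff p i * s ^ i) * (coeff q (n - i) * s ^ (n - i)))" for s
    by (auto simp: coeff_mult sum_distrib_right power_add[symmetric] intro!: sum.cong)
  show "av (coeff (p * q) n) * r ^ n \<le> B * D"
  proof (cases "r = 0")
    case True
    have "av (coeff p 0 * coeff q 0) \<le> B * D"
      using assms nn unfolding av_mult coeff_bound_def by (intro mult_mono av_nonneg) (auto dest: spec[of _ 0])
    then show ?thesis using True nn by (cases n) (auto simp: coeff_mult)
  next
    case False
    then have r: "0 < r" using assms by simp
    have "av (coeff (p * q) n) \<le> B * D / r ^ n"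
      unfolding coeff_mult
    proof (rule av_sum_le)
      fix i assume i: "i \<in> {..n}"
      have "(av (coeff p i) * r ^ i) * (av (coeff q (n - i)) * r ^ (n - i)) \<le> B * D"
        using assms nn r unfolding coeff_bound_def
        by (intro mult_mono) (auto intro!: mult_nonneg_nonneg av_nonneg)
      moreover have "r ^ n = r ^ i * r ^ (n - i)" using i by (simp add: power_add[symmetric])
      ultimately show "av (coeff p i * coeff q (n - i)) \<le> B * D / r ^ n"
        using r by (simp add: av_mult field_simps)
    qed (use nn r in auto)
    then show ?thesis using r by (simp add: field_simps)
  qed
qed

lemma coeff_bound_poly:
  assumes "coeff_bound r B p" "av u \<le> r"
  shows "av (poly p u) \<le> B"
  unfolding poly_altdef
proof (rule av_sum_le)
  fix i
  have "av (coeff p i * u ^ i) \<le> av (coeff p i) * r ^ i"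
    using assms by (auto simp: av_mult av_power intro!: mult_left_mono power_mono av_nonneg)
  then show "av (coeff p i * u ^ i) \<le> B" using assms by (auto simp: coeff_bound_def intro: order_trans)
qed (rule coeff_bound_nonneg[OF assms(1)])

text \<open>Horner's scheme: every stage multiplies by \<open>[:s, 1:]\<close>, whose Gauss norm is
  \<open>r\<close> because \<open>av s \<le> r\<close>, exactly like that of
  \<open>X\<close>.\<close>

lemma coeff_bound_translate:
  assumes "coeff_bound r B p" "av s \<le> r" "0 < r"
  shows "coeff_bound r B (pcompose p [:s, 1:])"
  using assms(1)
proof (induction p arbitrary: B)
  case 0
  then show ?case by simp
next
  case (pCons c q)
  then have c: "av c \<le> B" "coeff_bound r (B / r) q" using assms(3) by (auto simp: coeff_bound_pCons)
  have "0 \<le> B" using coeff_bound_nonneg pCons.prems by blast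
  have "coeff_bound r r [:s, 1:]" using assms by (simp add: coeff_bound_pCons av_one) (simp add: coeff_bound_def av_zero)
  then have "coeff_bound r (r * (B / r)) ([:s, 1:] * pcompose q [:s, 1:])"
    using assms by (intro coeff_bound_mult pCons.IH c) auto
  moreover have "coeff_bound r B [:c:]"
    using c assms \<open>0 \<le> B\<close> by (simp add: coeff_bound_pCons) (simp add: coeff_bound_def av_zero)
  ultimately show ?case using assms(3) by (simp add: pcompose_pCons coeff_bound_add)
qed

text \<open>The constant term cancels in the difference, so only indices \<open>j \<ge> 1\<close>
  are constrained. These are the coefficients that \<open>admissible\<close> keeps strictly below
  the height.\<close>

lemma av_poly_diff_le:
  assumes "0 < r" "\<And>j. 1 \<le> j \<Longrightarrow> av (coeff p j) * r ^ j \<le> B" "av u \<le> r" "av v \<le> r"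
  shows "av (poly p u - poly p v) \<le> B / r * av (u - v)"
  using assms(2)
proof (induction p arbitrary: B)
  case 0
  have "0 \<le> B" using 0[of 1] by (simp add: av_zero)
  then show ?case using assms(1) by (simp add: av_zero av_nonneg)
next
  case (pCons c q)
  have "av (coeff q j) * r ^ j \<le> B / r" for j
    using pCons.prems[of "Suc j"] assms(1) by (simp add: field_simps)
  then have q: "coeff_bound r (B / r) q" by (simp add: coeff_bound_def)
  have "0 \<le> B / r" using coeff_bound_nonneg[OF q] .
  have "av (poly (pCons c q) u - poly (pCons c q) v) = av ((u - v) * poly q u + v * (poly q u - poly q v))"
    by (simp add: algebra_simps)
  also have "\<dots> \<le> max (av (u - v) * av (poly q u)) (av v * av (poly q u - poly q v))"
    using av_ultrametric by (simp add: av_mult[symmetric])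
  also have "\<dots> \<le> B / r * av (u - v)"
  proof (rule max.boundedI)
    show "av (u - v) * av (poly q u) \<le> B / r * av (u - v)"
      using mult_left_mono[OF coeff_bound_poly[OF q assms(3)] av_nonneg[of "u - v"]] by (simp add: mult.commute)
    have "av (poly q u - poly q v) \<le> B / r / r * av (u - v)"
      using q by (intro pCons.IH) (auto simp: coeff_bound_def)
    then have "av v * av (poly q u - poly q v) \<le> r * (B / r / r * av (u - v))"
      using assms av_nonneg by (intro mult_mono) auto
    then show "av v * av (poly q u - poly q v) \<le> B / r * av (u - v)" using assms(1) by simp
  qed
  finally show ?case .
qed

text \<open>Newton interpolation. Splitting off a node \<open>w\<close> lowers the degree, and by
  separation the values of the quotient at the other nodes are below \<open>E / (t * r)\<close>;
  over \<open>n\<close> divisions this accumulates the factor \<open>1 / t ^ n\<close>.\<close>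

lemma coeff_less_of_separated_values:
  assumes "0 < r" "0 < t" "t \<le> 1"
    and "degree p \<le> n" "finite S" "card S = Suc n"
    and "\<And>u. u \<in> S \<Longrightarrow> av u \<le> r" "\<And>u. u \<in> S \<Longrightarrow> av (poly p u) < E"
    and "\<And>u v. u \<in> S \<Longrightarrow> v \<in> S \<Longrightarrow> u \<noteq> v \<Longrightarrow> t * r \<le> av (u - v)"
  shows "av (coeff p j) * r ^ j < E / t ^ n"
  using assms(4-9)
proof (induction n arbitrary: p S E j)
  case 0
  then obtain u where "u \<in> S" by fastforce
  obtain c where "p = [:c:]" using 0 by (auto elim: degree_eq_zeroE)
  moreover have "0 < E" using 0(5)[OF \<open>u \<in> S\<close>] av_nonneg by (meson order_le_less_trans)
  ultimately show ?case using 0(5)[OF \<open>u \<in> S\<close>] by (cases j) (auto simp: av_zero)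
next
  case (Suc n)
  then obtain w where w: "w \<in> S" by fastforce
  have E: "0 < E" using Suc.prems(5)[OF w] av_nonneg by (meson order_le_less_trans)
  define q where "q = synthetic_div p w"
  have p: "p = [:- w, 1:] * q + [:poly p w:]" using synthetic_div_correct'[of w p] by (simp add: q_def)
  have q: "av (coeff q i) * r ^ i < E / (t * r) / t ^ n" for i
  proof (rule Suc.IH[of q "S - {w}"])
    show "degree q \<le> n" using Suc.prems by (simp add: q_def degree_synthetic_div)
    show "card (S - {w}) = Suc n" using Suc.prems w by simp
    show "av (poly q u) < E / (t * r)" if u: "u \<in> S - {w}" for u
    proof -
      have "poly p u = (u - w) * poly q u + poly p w" by (subst p) (simp add: algebra_simps)
      then have "av (u - w) * av (poly q u) = av (poly p u - poly p w)" by (simp add: av_mult)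
      also have "\<dots> < E" using av_diff[of "poly p u" "poly p w"] Suc.prems(5)[of u] Suc.prems(5)[OF w] u by auto
      finally have "av (u - w) * av (poly q u) < E" .
      moreover have "t * r * av (poly q u) \<le> av (u - w) * av (poly q u)"
        using Suc.prems(6)[of u w] u w by (intro mult_right_mono av_nonneg) auto
      ultimately show ?thesis using assms by (simp add: field_simps)
    qed
  qed (use Suc.prems in auto)
  define M where "M = E / t ^ Suc n"
  have qM: "av (coeff q i) * r ^ i * r < M" for i
    using q[of i] assms by (simp add: M_def field_simps)
  have const: "av (poly p w) < M"
  proof -
    have "t ^ Suc n \<le> 1" using assms by (intro power_le_one) auto
    then have "E \<le> M" unfolding M_def using E assms by (simp add: field_simps del: power_Suc)
    then show ?thesis using Suc.prems(5)[OF w] by simp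
  qed
  have wq: "av (w * coeff q i) * r ^ i < M" for i
  proof -
    have "av (w * coeff q i) * r ^ i \<le> r * av (coeff q i) * r ^ i"
      using Suc.prems(4)[OF w] assms by (auto simp: av_mult intro!: mult_right_mono av_nonneg)
    then show ?thesis using qM[of i] by (simp add: mult_ac)
  qed
  show ?case
  proof (cases j)
    case 0
    have "coeff p 0 = poly p w - w * coeff q 0" by (subst p) simp
    then show ?thesis using av_diff[of "poly p w" "w * coeff q 0"] const wq[of 0] by (auto simp: 0 M_def)
  next
    case (Suc i)
    have "coeff p j = coeff q i - w * coeff q j" by (subst p) (simp add: Suc)
    then have "av (coeff p j) * r ^ j \<le> max (av (coeff q i)) (av (w * coeff q j)) * r ^ j"
      using av_diff assms by (auto intro!: mult_right_mono)
    also have "\<dots> < M" using qM[of i] wq[of j] by (auto simp: max_def Suc mult_ac)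
    finally show ?thesis by (simp add: M_def)
  qed
qed

section \<open>Gauss norms and sublevel sets of polynomials\<close>

definition gauss_norm :: "real \<Rightarrow> 'c poly \<Rightarrow> real" where
  "gauss_norm r p = Max ((\<lambda>j. av (coeff p j) * r ^ j) ` {..degree p})"

lemma coeff_le_gauss_norm:
  assumes "0 \<le> r"
  shows "av (coeff p j) * r ^ j \<le> gauss_norm r p"
proof (cases "j \<le> degree p")
  case True
  then show ?thesis unfolding gauss_norm_def by (intro Max_ge) auto
next
  case False
  have "0 \<le> av (coeff p 0) * r ^ 0" by (simp add: av_nonneg)
  also have "\<dots> \<le> gauss_norm r p" unfolding gauss_norm_def by (intro Max_ge imageI) auto
  finally show ?thesis using False by (simp add: coeff_eq_0 av_zero)
qed

lemma gauss_norm_attained: "\<exists>j\<le>degree p. gauss_norm r p = av (coeff p j) * r ^ j"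
proof -
  have "gauss_norm r p \<in> (\<lambda>j. av (coeff p j) * r ^ j) ` {..degree p}"
    unfolding gauss_norm_def by (intro Max_in) auto
  then show ?thesis by auto
qed

lemma gauss_norm_le_iff:
  assumes "0 \<le> r"
  shows "gauss_norm r p \<le> B \<longleftrightarrow> coeff_bound r B p"
proof
  show "coeff_bound r B p" if "gauss_norm r p \<le> B"
    using that coeff_le_gauss_norm[OF assms] unfolding coeff_bound_def by (blast intro: order_trans)
  show "gauss_norm r p \<le> B" if "coeff_bound r B p"
    using that gauss_norm_attained[of p r] by (auto simp: coeff_bound_def)
qed

lemma coeff_bound_gauss_norm: "0 \<le> r \<Longrightarrow> coeff_bound r (gauss_norm r p) p"
  by (simp add: coeff_bound_def coeff_le_gauss_norm)

lemma gauss_norm_minus: "gauss_norm r (- p) = gauss_norm r p"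
  by (simp add: gauss_norm_def av_minus)

lemma gauss_norm_pos:
  assumes "0 < r" "p \<noteq> 0"
  shows "0 < gauss_norm r p"
proof -
  have "0 < av (lead_coeff p) * r ^ degree p" using assms by (simp add: av_pos_iff)
  also have "\<dots> \<le> gauss_norm r p" using assms by (intro coeff_le_gauss_norm) auto
  finally show ?thesis .
qed

lemma gauss_norm_mono:
  assumes "0 \<le> r" "r \<le> s"
  shows "gauss_norm r p \<le> gauss_norm s p"
proof -
  obtain j where "gauss_norm r p = av (coeff p j) * r ^ j" using gauss_norm_attained by blast
  also have "\<dots> \<le> av (coeff p j) * s ^ j" using assms by (intro mult_left_mono power_mono av_nonneg) auto
  also have "\<dots> \<le> gauss_norm s p" using assms by (intro coeff_le_gauss_norm) auto
  finally show ?thesis .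
qed

lemma gauss_norm_scale:
  assumes "0 \<le> r" "0 < t" "t \<le> 1" "degree p \<le> d"
  shows "t ^ d * gauss_norm r p \<le> gauss_norm (t * r) p"
proof -
  obtain j where j: "j \<le> degree p" "gauss_norm r p = av (coeff p j) * r ^ j" using gauss_norm_attained by blast
  have "t ^ d * gauss_norm r p \<le> t ^ j * gauss_norm r p"
    using assms j av_nonneg by (intro mult_right_mono power_decreasing) auto
  also have "\<dots> = av (coeff p j) * (t * r) ^ j" by (simp add: j power_mult_distrib)
  also have "\<dots> \<le> gauss_norm (t * r) p" using assms by (intro coeff_le_gauss_norm) auto
  finally show ?thesis .
qed

text \<open>A separated subset of largest cardinality already covers, since an uncovered point could
  be added to it.\<close>

lemma finite_cover_of_separated:
  fixes V :: "'c set"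
  assumes "\<And>S. \<lbrakk>S \<subseteq> V; finite S; \<forall>u\<in>S. \<forall>v\<in>S. u \<noteq> v \<longrightarrow> h \<le> av (u - v)\<rbrakk> \<Longrightarrow> card S \<le> n" "0 < h"
  shows "\<exists>Y. finite Y \<and> card Y \<le> n \<and> (\<forall>u\<in>V. \<exists>w\<in>Y. av (u - w) < h)"
proof -
  define Q where "Q S \<longleftrightarrow> S \<subseteq> V \<and> finite S \<and> (\<forall>u\<in>S. \<forall>v\<in>S. u \<noteq> v \<longrightarrow> h \<le> av (u - v))" for S
  have "Q {}" by (simp add: Q_def)
  moreover have "\<forall>S. Q S \<longrightarrow> card S < Suc n" using assms(1) by (auto simp: Q_def less_Suc_eq_le)
  ultimately obtain Y where Y: "Q Y" "\<And>S. Q S \<Longrightarrow> card S \<le> card Y"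
    using ex_has_greatest_nat[of Q "{}" card "Suc n"] by blast
  have "\<exists>w\<in>Y. av (u - w) < h" if u: "u \<in> V" for u
  proof (rule ccontr)
    assume far: "\<not> ?thesis"
    then have "u \<notin> Y" using assms(2) by (force simp: av_zero)
    have "Q (insert u Y)"
      using Y(1) u far av_diff_commute[of u] by (auto simp: Q_def not_less)
    then have "card (insert u Y) \<le> card Y" by (rule Y(2))
    then show False using \<open>u \<notin> Y\<close> Y(1) by (simp add: Q_def)
  qed
  then show ?thesis using Y(1) assms(1)[of Y] by (auto simp: Q_def)
qed

text \<open>If the sublevel set contained \<open>n + 1\<close> separated points, interpolation would
  push every coefficient term strictly below the Gauss norm, which is attained by one of them. The
  covering is found without locating any roots.\<close>

lemma polynomial_sublevel_cover:
  assumes "0 < r" "0 < t" "t \<le> 1" "degree p \<le> n"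
  shows "\<exists>Y. finite Y \<and> card Y \<le> n \<and>
    (\<forall>u. av u \<le> r \<longrightarrow> av (poly p u) < t ^ n * gauss_norm r p \<longrightarrow> (\<exists>w\<in>Y. av (u - w) < t * r))"
proof -
  define V where "V = {u. av u \<le> r \<and> av (poly p u) < t ^ n * gauss_norm r p}"
  have "card S \<le> n" if S: "S \<subseteq> V" "finite S" "\<forall>u\<in>S. \<forall>v\<in>S. u \<noteq> v \<longrightarrow> t * r \<le> av (u - v)" for S
  proof (rule ccontr)
    assume "\<not> ?thesis"
    then obtain S' where S': "S' \<subseteq> S" "card S' = Suc n" "finite S'"
      using obtain_subset_with_card_n[of "Suc n" S] by auto
    obtain j where "gauss_norm r p = av (coeff p j) * r ^ j" using gauss_norm_attained by blast
    moreover have "av (coeff p j) * r ^ j < t ^ n * gauss_norm r p / t ^ n"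
      using assms S S' by (intro coeff_less_of_separated_values[of r t p n S']) (auto simp: V_def)
    ultimately show False using assms by simp
  qed
  then show ?thesis
    using finite_cover_of_separated[of V "t * r" n] assms by (auto simp: V_def)
qed

text \<open>After translation to \<open>a\<close> each factor is \<open>(a - x) + u\<close>, whose
  constant term dominates on the disc of radius \<open>s\<close>; so does the constant term of the
  product.\<close>

lemma coeff_bound_prod_linear:
  assumes "0 < s" "\<And>x. x \<in># M \<Longrightarrow> s \<le> av (a - x)"
  shows "coeff_bound s (av (poly (\<Prod>x\<in>#M. [:- x, 1:]) a)) (pcompose (\<Prod>x\<in>#M. [:- x, 1:]) [:a, 1:])"
  using assms(2)
proof (induction M)
  case empty
  show ?case by (auto simp: pcompose_1 coeff_bound_def coeff_pCons av_zero av_one split: nat.split)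
next
  case (add x M)
  have "coeff_bound s (av (a - x)) [:a - x, 1:]"
    using add.prems[of x] assms(1) by (auto simp: coeff_bound_def coeff_pCons av_zero av_one av_nonneg split: nat.split)
  then have "coeff_bound s (av (a - x) * av (poly (\<Prod>x\<in>#M. [:- x, 1:]) a))
      ([:a - x, 1:] * pcompose (\<Prod>x\<in>#M. [:- x, 1:]) [:a, 1:])"
    using assms(1) add by (intro coeff_bound_mult) auto
  moreover have "pcompose [:- x, 1:] [:a, 1:] = [:a - x, 1:]" by (simp add: pcompose_pCons)
  ultimately show ?case by (simp add: pcompose_mult av_mult[symmetric] del: mult_pCons_left)
qed

text \<open>\<open>V\<close> is the derivative of \<open>P / Q\<close> with denominators cleared.  Integrating its power series costs the
  factors \<open>m!\<close>, which is the origin of the constant \<open>\<bar>d!\<bar> / 2\<close> relating discs to critical points.\<close>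

lemma coeff_bound_of_wronskian:
  assumes s: "0 < s" and P0: "coeff P 0 = 0" and Q0: "coeff Q 0 \<noteq> 0"
    and Q: "coeff_bound s (av (coeff Q 0)) Q"
    and W: "wronskian P Q = smult (coeff Q 0) V" and V: "coeff_bound s (av (coeff V 0)) V"
  shows "coeff P 1 = coeff V 0" "av (fact m * coeff P m) * s ^ m \<le> av (coeff P 1) * s"
proof -
  define c where "c = coeff P"
  have rec: "(\<Sum>i\<le>k. of_nat (Suc i) * c (Suc i) * coeff Q (k - i))
     - (\<Sum>i\<le>k. c i * (of_nat (Suc (k - i)) * coeff Q (Suc (k - i)))) = coeff Q 0 * coeff V k" for k
    using arg_cong[OF W, of "\<lambda>p. coeff p k"]
    by (simp add: wronskian_def coeff_mult coeff_pderiv c_def)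
  have c1: "c 1 = coeff V 0" using rec[of 0] P0 Q0 by (simp add: c_def)
  then show "coeff P 1 = coeff V 0" by (simp add: c_def)
  have Qb: "av (coeff Q i) \<le> av (coeff Q 0) / s ^ i" for i
    using Q s by (simp add: coeff_bound_def field_simps)
  have "av (fact m * c m) * s ^ m \<le> av (c 1) * s"
  proof (induction m rule: less_induct)
    case (less m)
    show ?case
    proof (cases m)
      case 0
      then show ?thesis using P0 s by (simp add: c_def av_zero av_nonneg)
    next
      case (Suc k)
      \<comment> \<open>\<open>B\<close> is the bound sought for
        \<open>av (fact m * c m * coeff Q 0)\<close>. The recursion is multiplied by
        \<open>fact k\<close> because the factor \<open>Suc k\<close> in front of
        \<open>c (Suc k)\<close> completes it to \<open>fact m\<close>; in the remaining terms
        \<open>fact k\<close> is traded for the smaller factorial that the induction hypothesis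
        needs.\<close>
      define B where "B = av (c 1) * s / s ^ m * av (coeff Q 0)"
      have B: "0 \<le> B" using s by (simp add: B_def av_nonneg)
      have term1: "av (fact k * (of_nat a * c j * (of_nat b * coeff Q l))) \<le> B"
        if "j \<le> k" "j + l = m" for a b j l
      proof -
        have "av (fact k * (of_nat a * c j * (of_nat b * coeff Q l)))
            = av (of_nat a) * av (of_nat b) * (av (fact k * c j) * av (coeff Q l))"
          by (simp add: av_mult)
        also have "\<dots> \<le> 1 * (av (fact k * c j) * av (coeff Q l))"
          using av_of_nat_le_1 by (intro mult_right_mono mult_nonneg_nonneg av_nonneg mult_le_one)
        also have "\<dots> \<le> av (fact j * c j) * (av (coeff Q 0) / s ^ l)"
          unfolding mult_1 by (intro mult_mono av_fact_mult_mono[OF that(1)] Qb av_nonneg)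
        also have "\<dots> \<le> (av (c 1) * s / s ^ j) * (av (coeff Q 0) / s ^ l)"
          using less[of j] that Suc s by (intro mult_right_mono) (auto simp: field_simps av_nonneg)
        also have "\<dots> = B" using that(2)[symmetric] s by (simp add: B_def power_add)
        finally show ?thesis .
      qed
      have term2: "av (fact k * (of_nat (Suc i) * c (Suc i) * coeff Q (k - i))) \<le> B" if "i < k" for i
        using term1[of "Suc i" "k - i" "Suc i" 1] that Suc by simp
      have term3: "av (fact k * (c i * (of_nat (Suc (k - i)) * coeff Q (Suc (k - i))))) \<le> B" if "i \<le> k" for i
        using term1[of i "Suc (k - i)" 1 "Suc (k - i)"] that Suc by simp
      have V': "av (fact k * (coeff Q 0 * coeff V k)) \<le> B"
      proof -
        have "av (fact k * (coeff Q 0 * coeff V k)) \<le> av (coeff Q 0 * coeff V k)"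
          using av_fact_mult_mono[of 0 k "coeff Q 0 * coeff V k"] by simp
        also have "\<dots> \<le> av (coeff Q 0) * (av (c 1) / s ^ k)"
          unfolding av_mult c1 using V s
          by (intro mult_left_mono av_nonneg) (simp add: coeff_bound_def field_simps)
        also have "\<dots> = B" using s by (simp add: B_def Suc field_simps)
        finally show ?thesis .
      qed
      have "{..k} = insert k {..<k}" by auto
      then have "of_nat (Suc k) * c (Suc k) * coeff Q 0 = coeff Q 0 * coeff V k
          - (\<Sum>i<k. of_nat (Suc i) * c (Suc i) * coeff Q (k - i))
          + (\<Sum>i\<le>k. c i * (of_nat (Suc (k - i)) * coeff Q (Suc (k - i))))"
        using rec[of k] by (simp add: algebra_simps)
      then have "fact m * c m * coeff Q 0 = fact k * (coeff Q 0 * coeff V k)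
          - (\<Sum>i<k. fact k * (of_nat (Suc i) * c (Suc i) * coeff Q (k - i)))
          + (\<Sum>i\<le>k. fact k * (c i * (of_nat (Suc (k - i)) * coeff Q (Suc (k - i)))))"
        unfolding Suc by (simp only: sum_distrib_left[symmetric] right_diff_distrib[symmetric] distrib_left[symmetric])
          (simp add: mult_ac)
      also have "av \<dots> \<le> B"
        using V' B term2 term3
        by (intro order_trans[OF av_ultrametric] max.boundedI order_trans[OF av_diff] av_sum_le) auto
      finally have "av (fact m * c m) * av (coeff Q 0) \<le> av (c 1) * s / s ^ m * av (coeff Q 0)"
        by (simp add: B_def av_mult)
      moreover have "0 < av (coeff Q 0)" using Q0 by (simp add: av_pos_iff)
      ultimately have "av (fact m * c m) \<le> av (c 1) * s / s ^ m"
        by (metis mult_le_cancel_right_pos)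
      then show ?thesis using s by (simp add: field_simps)
    qed
  qed
  then show "av (fact m * coeff P m) * s ^ m \<le> av (coeff P 1) * s" by (simp add: c_def)
qed

end

section \<open>A rational function on a disc\<close>

context nonarch_absolute_value
begin

definition height :: "'c poly \<Rightarrow> 'c poly \<Rightarrow> 'c \<Rightarrow> real" where
  "height F G a = max (av (poly F a)) (av (poly G a))"

lemma height_commute: "height G F a = height F G a"
  by (simp add: height_def max.commute)

text \<open>On an admissible disc about \<open>a\<close> the dominating one of \<open>F\<close> and \<open>G\<close> has constant absolute value,
  so that \<open>F / G\<close> or \<open>G / F\<close> behaves there like a polynomial.\<close>

definition admissible :: "'c poly \<Rightarrow> 'c poly \<Rightarrow> 'c \<Rightarrow> real \<Rightarrow> bool" where
  "admissible F G a r \<longleftrightarrow> 0 < r \<and> (\<exists>B<height F G a. \<forall>j\<ge>1.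
     av (coeff (pcompose F [:a, 1:]) j) * r ^ j \<le> B \<and> av (coeff (pcompose G [:a, 1:]) j) * r ^ j \<le> B)"

lemma admissible_commute: "admissible G F a r \<longleftrightarrow> admissible F G a r"
  unfolding admissible_def height_commute[of G F] by (simp add: conj_commute)

lemma admissible_value_diff:
  assumes "admissible F G a r" "av u \<le> r"
  shows "av (poly G (a + u) - poly G a) < height F G a"
proof -
  obtain B where B: "0 < r" "B < height F G a" "\<And>j. 1 \<le> j \<Longrightarrow> av (coeff (pcompose G [:a, 1:]) j) * r ^ j \<le> B"
    using assms(1) by (auto simp: admissible_def)
  have "av (poly (pcompose G [:a, 1:]) u - poly (pcompose G [:a, 1:]) 0) \<le> B / r * av (u - 0)"
    using B assms(2) by (intro av_poly_diff_le) (auto simp: av_zero)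
  also have "\<dots> \<le> B / r * r"
  proof -
    have "0 \<le> av (coeff (pcompose G [:a, 1:]) 1) * r ^ 1" using B(1) av_nonneg by simp
    also have "\<dots> \<le> B" by (rule B(3)) simp
    finally show ?thesis using B(1) assms(2) by (intro mult_left_mono) auto
  qed
  finally show ?thesis using B by (simp add: poly_pcompose)
qed

text \<open>Both values change by less than the larger of the two at \<open>a\<close>, so the larger
  one keeps its absolute value and the other cannot overtake it.\<close>

lemma height_translate:
  assumes "admissible F G a r" "av u \<le> r"
  shows "height F G (a + u) = height F G a"
proof -
  have G: "av (poly G (a + u) - poly G a) < height F G a"
    by (rule admissible_value_diff[OF assms])
  have F: "av (poly F (a + u) - poly F a) < height F G a"
    using admissible_value_diff[of G F a r u] assms by (simp add: admissible_commute height_commute[of G F])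
  have *: "av (poly H (a + u)) \<le> max (av (poly H a)) (av (poly H (a + u) - poly H a))"
    "av (poly H a) = av (poly H (a + u) - poly H a) \<or> av (poly H (a + u)) = av (poly H a) \<or> av (poly H a) < av (poly H (a + u) - poly H a)" for H
    using av_ultrametric[of "poly H (a + u) - poly H a" "poly H a"]
      av_add_eq_left[of "poly H (a + u) - poly H a" "poly H a"] by auto
  show ?thesis using F G *[of F] *[of G] unfolding height_def by (auto simp: max_def split: if_splits)
qed

lemma height_eq:
  assumes "av (poly F a) \<le> av (poly G a)"
  shows "height F G a = av (poly G a)"
  using assms by (simp add: height_def)

text \<open>The left side contains the numerator of \<open>h (a + u) - h (a + v)\<close>; it is
  rewritten through differences based at the center \<open>a\<close>, where coefficient bounds are
  available.\<close>

lemma cross_identity: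
  fixes F G :: "'c poly"
  shows "poly G a * (poly F (a + u) * poly G (a + v) - poly F (a + v) * poly G (a + u)) =
    (poly (twist F G a) u - poly (twist F G a) v) * poly G (a + v)
      - poly (twist F G a) v * (poly (pcompose G [:a, 1:]) u - poly (pcompose G [:a, 1:]) v)"
  by (simp add: poly_twist poly_pcompose algebra_simps)

text \<open>Both terms of \<open>cross_identity\<close> are at most
  \<open>N / r * av (u - v)\<close> times \<open>av (poly G a)\<close>, and that last factor
  cancels. The case where \<open>F\<close> dominates follows by exchanging \<open>F\<close> and
  \<open>G\<close>, that is, by passing to \<open>1 / h\<close>.\<close>

lemma cross_le_aux:
  assumes FG: "av (poly F a) \<le> av (poly G a)"
    and adm: "admissible F G a r" and uv: "av u \<le> r" "av v \<le> r"
  shows "av (poly F (a + u) * poly G (a + v) - poly F (a + v) * poly G (a + u))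
    \<le> gauss_norm r (twist F G a) / r * av (u - v)"
proof -
  define P where "P = twist F G a"
  define h where "h = av (poly G a)"
  define N where "N = gauss_norm r P"
  have H: "height F G a = h" unfolding h_def by (rule height_eq[OF FG])
  obtain B where B: "0 < r" "B < h" "\<And>j. 1 \<le> j \<Longrightarrow> av (coeff (pcompose G [:a, 1:]) j) * r ^ j \<le> B"
    using adm H by (auto simp: admissible_def)
  have "0 \<le> av (coeff (pcompose G [:a, 1:]) 1) * r ^ 1" using B(1) av_nonneg by simp
  also have "\<dots> \<le> B" by (rule B(3)) simp
  finally have h: "0 < h" using B(2) by simp
  have Nb: "coeff_bound r N P" unfolding N_def using B(1) by (intro coeff_bound_gauss_norm) auto
  have "0 \<le> N" using Nb by (rule coeff_bound_nonneg)
  have Gv: "av (poly G (a + v)) \<le> h"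
    using height_translate[OF adm uv(2)] H by (simp add: height_def)
  have "av (poly P u - poly P v) \<le> N / r * av (u - v)"
    using Nb B(1) uv by (intro av_poly_diff_le) (auto simp: coeff_bound_def)
  then have 1: "av (poly P u - poly P v) * av (poly G (a + v)) \<le> N / r * av (u - v) * h"
    using Gv B(1) \<open>0 \<le> N\<close> by (intro mult_mono) (auto simp: av_nonneg)
  have "av (poly (pcompose G [:a, 1:]) u - poly (pcompose G [:a, 1:]) v) \<le> B / r * av (u - v)"
    using B uv by (intro av_poly_diff_le) auto
  also have "\<dots> \<le> h / r * av (u - v)"
    using B by (intro mult_right_mono divide_right_mono av_nonneg) auto
  finally have "av (poly P v) * av (poly (pcompose G [:a, 1:]) u - poly (pcompose G [:a, 1:]) v)
      \<le> N * (h / r * av (u - v))"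
    using coeff_bound_poly[OF Nb uv(2)] \<open>0 \<le> N\<close> by (intro mult_mono) (auto simp: av_nonneg)
  then have 2: "av (poly P v) * av (poly (pcompose G [:a, 1:]) u - poly (pcompose G [:a, 1:]) v)
      \<le> N / r * av (u - v) * h" by (simp add: mult_ac)
  have "h * av (poly F (a + u) * poly G (a + v) - poly F (a + v) * poly G (a + u)) \<le> N / r * av (u - v) * h"
    unfolding h_def av_mult[symmetric] cross_identity P_def[symmetric]
    by (rule order_trans[OF av_diff]) (use 1 2 in \<open>simp add: av_mult h_def\<close>)
  then have "h * av (poly F (a + u) * poly G (a + v) - poly F (a + v) * poly G (a + u)) \<le> h * (N / r * av (u - v))"
    by (simp only: mult.commute[of h])
  then show ?thesis unfolding N_def P_def using h by (subst (asm) mult_le_cancel_left_pos)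
qed

lemma cross_commute:
  "av (poly G x * poly F y - poly G y * poly F x) = av (poly F x * poly G y - poly F y * poly G x)"
  using av_diff_commute[of "poly G x * poly F y" "poly G y * poly F x"] by (simp add: mult.commute)

lemma cross_le:
  assumes adm: "admissible F G a r" and uv: "av u \<le> r" "av v \<le> r"
  shows "av (poly F (a + u) * poly G (a + v) - poly F (a + v) * poly G (a + u))
    \<le> gauss_norm r (twist F G a) / r * av (u - v)"
proof (cases "av (poly F a) \<le> av (poly G a)")
  case True
  then show ?thesis using assms by (intro cross_le_aux)
next
  case False
  then have "av (poly G (a + u) * poly F (a + v) - poly G (a + v) * poly F (a + u))
    \<le> gauss_norm r (twist G F a) / r * av (u - v)"
    using assms by (intro cross_le_aux) (auto simp: admissible_commute)
  then show ?thesis by (simp add: cross_commute twist_commute[of G F] gauss_norm_minus)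
qed

text \<open>When the linear coefficient strictly dominates, the first term of
  \<open>cross_identity\<close> has an exactly known absolute value, and the second is strictly
  smaller because \<open>B\<close> is below the height; the ultrametric inequality then gives
  equality.\<close>

lemma cross_eq_aux:
  assumes FG: "av (poly F a) \<le> av (poly G a)"
    and adm: "admissible F G a r" and uv: "av u \<le> r" "av v \<le> r"
    and dom: "\<And>j. 2 \<le> j \<Longrightarrow> av (coeff (twist F G a) j) * r ^ j \<le> D" "D < av (coeff (twist F G a) 1) * r"
  shows "av (poly F (a + u) * poly G (a + v) - poly F (a + v) * poly G (a + u))
    = av (coeff (twist F G a) 1) * av (u - v)"
proof (cases "u = v")
  case True
  then show ?thesis by (simp add: av_zero)
next
  case False
  then have uvpos: "0 < av (u - v)" by (simp add: av_pos_iff)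
  define P where "P = twist F G a"
  define c where "c = coeff P 1"
  define h where "h = av (poly G a)"
  have H: "height F G a = h" unfolding h_def by (rule height_eq[OF FG])
  obtain B where B: "0 < r" "B < h" "\<And>j. 1 \<le> j \<Longrightarrow> av (coeff (pcompose G [:a, 1:]) j) * r ^ j \<le> B"
    using adm H by (auto simp: admissible_def)
  have "0 \<le> av (coeff (pcompose G [:a, 1:]) 1) * r ^ 1" using B(1) av_nonneg by simp
  also have "\<dots> \<le> B" by (rule B(3)) simp
  finally have h: "0 < h" "0 \<le> B" using B(2) by simp_all
  have D: "0 \<le> D" using dom(1)[of 2] B(1) av_nonneg[of "coeff (twist F G a) 2"]
    by (meson order_trans mult_nonneg_nonneg zero_le_power less_imp_le order_refl)
  have cr: "D < av c * r" using dom(2) by (simp add: c_def P_def)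
  have "0 < av c * r" using cr D by linarith
  then have c: "0 < av c" using B(1) by (simp add: zero_less_mult_iff)
  have Nb: "coeff_bound r (av c * r) P"
    unfolding coeff_bound_def
  proof
    fix j :: nat
    consider "j = 0" | "j = 1" | "2 \<le> j" by linarith
    then show "av (coeff P j) * r ^ j \<le> av c * r"
      using dom(1)[of j] cr B(1) c by cases (auto simp: P_def av_zero c_def)
  qed
  have Gv: "av (poly G (a + v)) = h"
  proof -
    have "av (poly G (a + v) - poly G a) < h" using admissible_value_diff[OF adm uv(2)] H by simp
    then show ?thesis using av_add_eq_left[of "poly G (a + v) - poly G a" "poly G a"] by (simp add: h_def)
  qed
  have lin: "av (poly P u - poly P v) = av c * av (u - v)"
  proof -
    define Q where "Q = P - [:0, c:]"
    have "av (poly Q u - poly Q v) \<le> D / r * av (u - v)"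
    proof (rule av_poly_diff_le[OF B(1) _ uv])
      fix j :: nat assume "1 \<le> j"
      then consider "j = 1" | "2 \<le> j" by linarith
      then show "av (coeff Q j) * r ^ j \<le> D"
        using dom(1)[of j] D by cases (auto simp: Q_def c_def P_def av_zero coeff_pCons split: nat.split)
    qed
    also have "\<dots> < av c * av (u - v)"
      using cr B(1) uvpos by (intro mult_strict_right_mono) (auto simp: field_simps)
    also have "\<dots> = av (c * (u - v))" by (simp add: av_mult)
    finally have "av (c * (u - v) + (poly Q u - poly Q v)) = av (c * (u - v))" by (rule av_add_eq_left)
    moreover have "c * (u - v) + (poly Q u - poly Q v) = poly P u - poly P v"
      by (simp add: Q_def algebra_simps)
    ultimately show ?thesis by (simp add: av_mult)
  qed
  have "av (poly (pcompose G [:a, 1:]) u - poly (pcompose G [:a, 1:]) v) \<le> B / r * av (u - v)"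
    using B uv by (intro av_poly_diff_le) auto
  then have "av (poly P v) * av (poly (pcompose G [:a, 1:]) u - poly (pcompose G [:a, 1:]) v)
      \<le> (av c * r) * (B / r * av (u - v))"
    using coeff_bound_poly[OF Nb uv(2)] c B(1) by (intro mult_mono) (auto simp: av_nonneg)
  also have "\<dots> = av c * av (u - v) * B" using B(1) by simp
  also have "\<dots> < av c * av (u - v) * h" using B(2) c uvpos by (intro mult_strict_left_mono) auto
  finally have less: "av (poly P v * (poly (pcompose G [:a, 1:]) u - poly (pcompose G [:a, 1:]) v))
      < av ((poly P u - poly P v) * poly G (a + v))"
    by (simp add: av_mult lin Gv)
  have "h * av (poly F (a + u) * poly G (a + v) - poly F (a + v) * poly G (a + u)) = av c * av (u - v) * h"
    unfolding h_def av_mult[symmetric] cross_identity P_def[symmetric]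
    using av_add_eq_left[of "- (poly P v * (poly (pcompose G [:a, 1:]) u - poly (pcompose G [:a, 1:]) v))"
        "(poly P u - poly P v) * poly G (a + v)"] less
    by (simp add: av_minus) (simp add: av_mult lin Gv h_def)
  then show ?thesis using h by (simp add: c_def P_def)
qed

lemma cross_eq:
  assumes adm: "admissible F G a r" and uv: "av u \<le> r" "av v \<le> r"
    and dom: "\<And>j. 2 \<le> j \<Longrightarrow> av (coeff (twist F G a) j) * r ^ j \<le> D" "D < av (coeff (twist F G a) 1) * r"
  shows "av (poly F (a + u) * poly G (a + v) - poly F (a + v) * poly G (a + u))
    = av (coeff (twist F G a) 1) * av (u - v)"
proof (cases "av (poly F a) \<le> av (poly G a)")
  case True
  then show ?thesis using assms by (intro cross_eq_aux)
next
  case False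
  have "av (poly G (a + u) * poly F (a + v) - poly G (a + v) * poly F (a + u))
    = av (coeff (twist G F a) 1) * av (u - v)"
    using False assms by (intro cross_eq_aux[of _ _ _ r _ _ D]) (auto simp: admissible_commute twist_commute[of G F] av_minus)
  then show ?thesis by (simp add: cross_commute twist_commute[of G F] av_minus)
qed

lemma gauss_norm_eq_linear:
  assumes "0 < r" "coeff P 0 = 0" "\<And>j. 2 \<le> j \<Longrightarrow> av (coeff P j) * r ^ j \<le> av (coeff P 1) * r"
  shows "gauss_norm r P = av (coeff P 1) * r"
proof (rule antisym)
  have "coeff_bound r (av (coeff P 1) * r) P"
    unfolding coeff_bound_def
  proof
    fix j :: nat
    consider "j = 0" | "j = 1" | "2 \<le> j" by linarith
    then show "av (coeff P j) * r ^ j \<le> av (coeff P 1) * r"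
      using assms av_nonneg by cases (auto simp: av_zero)
  qed
  then show "gauss_norm r P \<le> av (coeff P 1) * r" using assms by (simp add: gauss_norm_le_iff)
  show "av (coeff P 1) * r \<le> gauss_norm r P" using coeff_le_gauss_norm[of r P 1] assms by simp
qed

text \<open>Both terms of \<open>twist_translate\<close> have Gauss norm at most
  \<open>av (poly G a)\<close> times that of the twist at \<open>a\<close>. Equality is obtained
  later by exchanging the two centers.\<close>

lemma gauss_norm_twist_translate_aux:
  assumes FG: "av (poly F a) \<le> av (poly G a)"
    and adm: "admissible F G a r" and s: "av s \<le> r"
  shows "gauss_norm r (twist F G (a + s)) \<le> gauss_norm r (twist F G a)"
proof -
  define P where "P = twist F G a"
  define h where "h = av (poly G a)"
  define N where "N = gauss_norm r P"
  have H: "height F G a = h" unfolding h_def by (rule height_eq[OF FG])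
  obtain B where B: "0 < r" "B < h" "\<And>j. 1 \<le> j \<Longrightarrow> av (coeff (pcompose G [:a, 1:]) j) * r ^ j \<le> B"
    using adm H by (auto simp: admissible_def)
  have "0 \<le> av (coeff (pcompose G [:a, 1:]) 1) * r ^ 1" using B(1) av_nonneg by simp
  also have "\<dots> \<le> B" by (rule B(3)) simp
  finally have h: "0 < h" using B(2) by simp
  have Gb: "coeff_bound r h (pcompose G [:a, 1:])"
    unfolding coeff_bound_def
  proof
    fix j
    show "av (coeff (pcompose G [:a, 1:]) j) * r ^ j \<le> h"
    proof (cases j)
      case 0
      then show ?thesis by (simp add: h_def poly_0_coeff_0[symmetric] poly_pcompose)
    qed (use B(2) B(3)[of j] in auto)
  qed
  have "coeff_bound r h (pcompose (pcompose G [:a, 1:]) [:s, 1:])"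
    by (rule coeff_bound_translate[OF Gb s B(1)])
  then have Gs: "coeff_bound r h (pcompose G [:a + s, 1:])"
    by (simp add: pcompose_assoc[symmetric] pcompose_pCons)
  have Nb: "coeff_bound r N P" unfolding N_def using B(1) by (intro coeff_bound_gauss_norm) auto
  have N: "0 \<le> N" using Nb by (rule coeff_bound_nonneg)
  have mono: "coeff_bound r (h * N) p" if "coeff_bound r (x * y) p" "x \<le> h" "y \<le> N" "0 \<le> x" "0 \<le> y" for x y p
    using that mult_mono[of x h y N] h unfolding coeff_bound_def by (meson less_imp_le order_trans)
  have Gas: "av (poly G (a + s)) \<le> h" using height_translate[OF adm s] H by (simp add: height_def)
  have "coeff_bound r (h * N) (smult (poly G (a + s)) (pcompose P [:s, 1:]))"
    by (rule mono[OF coeff_bound_smult[OF coeff_bound_translate[OF Nb s B(1)]] Gas order_refl av_nonneg N])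
  moreover have "coeff_bound r (h * N) (smult (poly P s) (pcompose G [:a + s, 1:]))"
    by (rule mono[OF _ order_refl coeff_bound_poly[OF Nb s]])
       (use coeff_bound_smult[OF Gs, of "poly P s"] h in \<open>auto simp: mult.commute av_nonneg\<close>)
  ultimately have "coeff_bound r (h * N) (smult (poly G a) (twist F G (a + s)))"
    unfolding twist_translate P_def[symmetric] using B(1) by (intro coeff_bound_diff) auto
  then have "h * (av (coeff (twist F G (a + s)) j) * r ^ j) \<le> h * N" for j
    by (simp add: coeff_bound_def av_mult h_def mult.assoc)
  then have "coeff_bound r N (twist F G (a + s))"
    unfolding coeff_bound_def using h by (metis mult_le_cancel_left_pos)
  then show ?thesis using B(1) by (simp add: gauss_norm_le_iff N_def P_def)
qed

lemma gauss_norm_twist_translate: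
  assumes adm: "admissible F G a r" and s: "av s \<le> r"
  shows "gauss_norm r (twist F G (a + s)) \<le> gauss_norm r (twist F G a)"
proof (cases "av (poly F a) \<le> av (poly G a)")
  case True
  then show ?thesis using assms by (intro gauss_norm_twist_translate_aux)
next
  case False
  then show ?thesis using gauss_norm_twist_translate_aux[of G a F r s] assms
    by (simp add: admissible_commute twist_commute[of G F] gauss_norm_minus)
qed

text \<open>\<open>coeff_bound_of_wronskian\<close> applies with the translates of \<open>G\<close>
  and of the Wronskian as \<open>Q\<close> and \<open>V\<close>: the first has dominant constant
  term by admissibility, the second because no root is closer to \<open>a\<close> than
  \<open>s\<close>.\<close>

lemma twist_dominated_aux:
  assumes FG: "av (poly F a) \<le> av (poly G a)" and adm: "admissible F G a s"
    and W: "wronskian F G = smult l (\<Prod>x\<in>#M. [:- x, 1:])" "\<And>x. x \<in># M \<Longrightarrow> s \<le> av (a - x)"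
  shows "coeff (twist F G a) 1 = poly (wronskian F G) a"
    "av (fact m * coeff (twist F G a) m) * s ^ m \<le> av (coeff (twist F G a) 1) * s"
proof -
  define Q where "Q = pcompose G [:a, 1:]"
  define V where "V = pcompose (wronskian F G) [:a, 1:]"
  obtain B where B: "0 < s" "B < height F G a" "\<And>j. 1 \<le> j \<Longrightarrow> av (coeff Q j) * s ^ j \<le> B"
    using adm by (auto simp: admissible_def Q_def)
  have Q0: "coeff Q 0 = poly G a" by (simp add: Q_def poly_0_coeff_0[symmetric] poly_pcompose)
  have V0: "coeff V 0 = poly (wronskian F G) a" by (simp add: V_def poly_0_coeff_0[symmetric] poly_pcompose)
  have H: "height F G a = av (poly G a)" by (rule height_eq[OF FG])
  have "0 \<le> av (coeff Q 1) * s ^ 1" using B(1) av_nonneg by simp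
  also have "\<dots> \<le> B" by (rule B(3)) simp
  finally have nz: "coeff Q 0 \<noteq> 0" using B(2) H by (auto simp: Q0 av_zero)
  have Qb: "coeff_bound s (av (coeff Q 0)) Q"
    unfolding coeff_bound_def
  proof
    fix j show "av (coeff Q j) * s ^ j \<le> av (coeff Q 0)"
      using B(2) B(3)[of j] H by (cases j) (auto simp: Q0)
  qed
  have "coeff_bound s (av l * av (poly (\<Prod>x\<in>#M. [:- x, 1:]) a)) (smult l (pcompose (\<Prod>x\<in>#M. [:- x, 1:]) [:a, 1:]))"
    using B(1) W(2) by (intro coeff_bound_smult coeff_bound_prod_linear)
  then have Vb: "coeff_bound s (av (coeff V 0)) V"
    unfolding V0 by (simp add: V_def W(1) pcompose_smult av_mult)
  have W': "wronskian (twist F G a) Q = smult (coeff Q 0) V"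
    unfolding Q0 unfolding V_def Q_def by (rule wronskian_twist)
  show "coeff (twist F G a) 1 = poly (wronskian F G) a"
    using coeff_bound_of_wronskian(1)[OF B(1) coeff_0_twist nz Qb W' Vb] V0 by simp
  show "av (fact m * coeff (twist F G a) m) * s ^ m \<le> av (coeff (twist F G a) 1) * s"
    by (rule coeff_bound_of_wronskian(2)[OF B(1) coeff_0_twist nz Qb W' Vb])
qed

lemma twist_dominated:
  assumes adm: "admissible F G a s"
    and W: "wronskian F G = smult l (\<Prod>x\<in>#M. [:- x, 1:])" "\<And>x. x \<in># M \<Longrightarrow> s \<le> av (a - x)"
  shows "av (coeff (twist F G a) 1) = av (poly (wronskian F G) a)"
    "av (fact m * coeff (twist F G a) m) * s ^ m \<le> av (coeff (twist F G a) 1) * s"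
proof -
  have W': "wronskian G F = smult (- l) (\<Prod>x\<in>#M. [:- x, 1:])" by (simp add: wronskian_commute[of G F] W(1))
  show "av (coeff (twist F G a) 1) = av (poly (wronskian F G) a)"
  proof (cases "av (poly F a) \<le> av (poly G a)")
    case True
    then show ?thesis using twist_dominated_aux(1)[OF True adm W] by simp
  next
    case False
    then show ?thesis using twist_dominated_aux(1)[of G a F s "- l" M] adm W' W(2)
      by (simp add: admissible_commute twist_commute[of G F] wronskian_commute[of G F] av_minus)
  qed
  show "av (fact m * coeff (twist F G a) m) * s ^ m \<le> av (coeff (twist F G a) 1) * s"
  proof (cases "av (poly F a) \<le> av (poly G a)")
    case True
    then show ?thesis using twist_dominated_aux(2)[OF True adm W] by simp
  next
    case False
    then show ?thesis using twist_dominated_aux(2)[of G a F s "- l" M m] adm W' W(2)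
      by (simp add: admissible_commute twist_commute[of G F] av_minus)
  qed
qed

text \<open>Put \<open>q = r / s\<close>. For \<open>j \<ge> 2\<close> the shrinking gains at least
  \<open>q ^ 2\<close>: one factor \<open>q\<close> turns \<open>s\<close> into \<open>r\<close>,
  the other absorbs \<open>1 / av (fact d)\<close> and leaves \<open>1 / 2\<close>, which makes the
  domination strict.\<close>

lemma twist_linear_term_dominates:
  assumes adm: "admissible F G a s"
    and W: "wronskian F G = smult l (\<Prod>x\<in>#M. [:- x, 1:])" "\<And>x. x \<in># M \<Longrightarrow> s \<le> av (a - x)"
    and d: "degree F \<le> d" "degree G \<le> d" and r: "0 < r" "r \<le> av (fact d) / 2 * s" and j: "2 \<le> j"
  shows "av (coeff (twist F G a) j) * r ^ j \<le> av (coeff (twist F G a) 1) * r / 2"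
proof (cases "j \<le> d")
  case True
  define k where "k = av (fact d) / 2"
  have fd: "0 < av (fact d)" "av (fact d) \<le> 1"
    using av_fact_mult_mono[of 0 d 1] by (auto simp: av_pos_iff av_one)
  have k: "0 < k" "k \<le> 1" using fd by (auto simp: k_def)
  have s: "0 < s" using adm by (simp add: admissible_def)
  have "av (fact d) * (av (coeff (twist F G a) j) * s ^ j) \<le> av (fact j * coeff (twist F G a) j) * s ^ j"
    using mult_right_mono[OF av_fact_mult_mono[OF True, of "coeff (twist F G a) j"], of "s ^ j"] s
    by (simp add: av_mult mult.assoc)
  also have "\<dots> \<le> av (coeff (twist F G a) 1) * s" by (rule twist_dominated(2)[OF adm W])
  finally have *: "av (coeff (twist F G a) j) * s ^ j \<le> av (coeff (twist F G a) 1) * s / av (fact d)"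
    using fd by (simp add: field_simps)
  define q where "q = r / s"
  have q: "0 < q" "q \<le> k" "r = q * s" using r s by (auto simp: q_def k_def field_simps)
  have "av (coeff (twist F G a) j) * r ^ j = q ^ j * (av (coeff (twist F G a) j) * s ^ j)"
    by (simp add: q(3) power_mult_distrib)
  also have "\<dots> \<le> q ^ 2 * (av (coeff (twist F G a) 1) * s / av (fact d))"
    using * q k j s by (intro mult_mono power_decreasing) (auto simp: av_nonneg)
  also have "\<dots> = av (coeff (twist F G a) 1) * r * (q / av (fact d))" by (simp add: q(3) power2_eq_square)
  also have "\<dots> \<le> av (coeff (twist F G a) 1) * r * (1 / 2)"
    using q(2) fd r av_nonneg by (intro mult_left_mono mult_nonneg_nonneg) (auto simp: k_def field_simps)
  finally show ?thesis by simp
next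
  case False
  then show ?thesis using degree_twist[OF d, of a] r
    by (simp add: coeff_eq_0 av_zero av_nonneg)
qed

end

section \<open>Charts of the projective line\<close>

definition hpt :: "'c::field \<Rightarrow> 'c \<Rightarrow> 'c proj_line" where
  "hpt x y = (if y = 0 then Infty else Fin (x / y))"

text \<open>The closed unit disc in the coordinate \<open>z\<close> (chart \<open>True\<close>) and the open unit disc in the
  coordinate \<open>1/z\<close> (chart \<open>False\<close>) partition the projective line.  The spherical metric is
  \<open>\<bar>u - v\<bar>\<close> inside each chart and \<open>1\<close> between them.\<close>

definition chart_pt :: "bool \<Rightarrow> 'c::field \<Rightarrow> 'c proj_line" where
  "chart_pt b u = (if b then hpt u 1 else hpt 1 u)"

definition chart_poly :: "nat \<Rightarrow> bool \<Rightarrow> 'c::field_char_0 poly \<Rightarrow> 'c poly" where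
  "chart_poly d b q = (if b then q else rev_poly d q)"

lemma rat_map_chart_pt:
  assumes "d = rat_degree f g"
  shows "rat_map f g (chart_pt b u) = hpt (poly (chart_poly d b f) u) (poly (chart_poly d b g) u)"
proof (cases b)
  case True
  then show ?thesis by (simp add: chart_pt_def hpt_def chart_poly_def)
next
  case b: False
  have dfg: "degree f \<le> d" "degree g \<le> d" by (auto simp: assms rat_degree_def)
  show ?thesis
  proof (cases "u = 0")
    case True
    then show ?thesis using b
      by (simp add: chart_pt_def hpt_def chart_poly_def poly_0_coeff_0 coeff_rev_poly assms Let_def)
  next
    case False
    then show ?thesis using b by (simp add: chart_pt_def hpt_def chart_poly_def poly_rev_poly dfg)
  qed
qed

context nonarch_absolute_value
begin

text \<open>The homogeneous form of the spherical metric, which treats both coordinates and infinity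
  alike.\<close>

lemma spherical_hpt:
  assumes "x \<noteq> 0 \<or> y \<noteq> 0" "x' \<noteq> 0 \<or> y' \<noteq> 0"
  shows "spherical av (hpt x y) (hpt x' y') =
    av (x * y' - x' * y) / (max (av x) (av y) * max (av x') (av y'))"
proof -
  have m: "max (av s / av t) 1 = max (av s) (av t) / av t" if "t \<noteq> 0" for s t
  proof -
    have "0 < av t" using that by (simp add: av_pos_iff)
    then show ?thesis by (simp add: av_divide max_def field_simps)
  qed
  have y: "max (av s) 0 = av s" for s using av_nonneg[of s] by (simp add: max_def)
  consider "y = 0" "y' = 0" | "y = 0" "y' \<noteq> 0" | "y \<noteq> 0" "y' = 0" | "y \<noteq> 0" "y' \<noteq> 0" by blast
  then show ?thesis
  proof cases
    case 1
    then show ?thesis by (simp add: hpt_def av_zero)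
  next
    case 2
    then have "0 < av x" using assms by (simp add: av_pos_iff)
    then show ?thesis using 2
      by (simp add: hpt_def spherical_Infty m av_divide av_zero y av_mult del: spherical.simps(2,3))
  next
    case 3
    then have "0 < av x'" using assms by (simp add: av_pos_iff)
    then show ?thesis using 3
      by (simp add: hpt_def spherical_Infty m av_divide av_zero y av_mult av_minus del: spherical.simps(2,3))
  next
    case 4
    have "x / y - x' / y' = (x * y' - x' * y) / (y * y')" using 4 by (simp add: field_simps)
    then show ?thesis using 4 av_pos_iff[of y] av_pos_iff[of y']
      by (simp add: hpt_def m av_divide av_mult)
  qed
qed

definition ch :: "'c proj_line \<Rightarrow> bool" where
  "ch x = (case x of Fin z \<Rightarrow> av z \<le> 1 | Infty \<Rightarrow> False)"

definition co :: "'c proj_line \<Rightarrow> 'c" where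
  "co x = (case x of Fin z \<Rightarrow> if av z \<le> 1 then z else inverse z | Infty \<Rightarrow> 0)"

lemma chart_pt_co: "chart_pt (ch x) (co x) = x"
  by (cases x) (auto simp: chart_pt_def hpt_def ch_def co_def field_simps av_zero)

lemma av_co_le_1: "av (co x) \<le> 1"
  by (cases x) (auto simp: co_def av_inverse av_zero inverse_le_1_iff)

lemma av_co_less_1: "\<not> ch x \<Longrightarrow> av (co x) < 1"
  by (cases x) (auto simp: ch_def co_def av_inverse av_zero inverse_less_1_iff)

lemma ch_co_chart_pt:
  assumes "av u \<le> 1" "b \<or> av u < 1"
  shows "ch (chart_pt b u) = b" "co (chart_pt b u) = u"
proof -
  have "1 < inverse (av u)" if "u \<noteq> 0" "av u < 1"
    using that av_pos_iff[of u] by (simp add: one_less_inverse_iff)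
  then show "ch (chart_pt b u) = b" "co (chart_pt b u) = u"
    using assms by (auto simp: chart_pt_def hpt_def ch_def co_def av_inverse divide_inverse)
qed

lemma spherical_chart_pt:
  assumes "av u \<le> 1" "av v \<le> 1"
  shows "spherical av (chart_pt b u) (chart_pt b v) = av (u - v)"
  using assms by (cases b) (simp_all add: chart_pt_def spherical_hpt av_one max_def av_diff_commute[of v])

lemma spherical_eq:
  "spherical av x y = (if ch x = ch y then av (co x - co y) else 1)"
proof -
  have 1: "spherical av (chart_pt True u) (chart_pt False v) = 1"
    "spherical av (chart_pt False v) (chart_pt True u) = 1" if "av u \<le> 1" "av v < 1" for u v
  proof -
    have "av u * av v \<le> 1 * av v" using that av_nonneg by (intro mult_right_mono) auto
    then have uv: "av (u * v) < av 1" using that by (simp add: av_mult av_one)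
    have "av (u * v - 1) = 1" "av (1 - u * v) = 1"
      using av_add_eq_left[of "- (u * v)" 1] uv av_diff_commute[of "u * v" 1]
      by (simp_all add: av_minus av_one)
    then show "spherical av (chart_pt True u) (chart_pt False v) = 1"
      "spherical av (chart_pt False v) (chart_pt True u) = 1"
      using that by (simp_all add: chart_pt_def spherical_hpt av_one max_def)
  qed
  have "spherical av (chart_pt (ch x) (co x)) (chart_pt (ch y) (co y)) = (if ch x = ch y then av (co x - co y) else 1)"
    using 1 av_co_le_1 av_co_less_1 spherical_chart_pt by (cases "ch x"; cases "ch y") auto
  then show ?thesis by (simp only: chart_pt_co)
qed

lemma spherical_le_1: "spherical av x y \<le> 1"
  using av_diff[of "co x" "co y"] av_co_le_1[of x] av_co_le_1[of y] by (auto simp: spherical_eq)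

lemma spherical_ultrametric: "spherical av x z \<le> max (spherical av x y) (spherical av y z)"
proof (cases "ch x = ch y \<and> ch y = ch z")
  case True
  then show ?thesis using av_ultrametric[of "co x - co y" "co y - co z"] by (simp add: spherical_eq)
next
  case False
  then have "spherical av x y = 1 \<or> spherical av y z = 1" by (auto simp: spherical_eq)
  then show ?thesis using spherical_le_1[of x z] by auto
qed

lemma disc_chart:
  assumes "spherical av x y \<le> r" "r < 1"
  shows "ch y = ch x" "av (co y - co x) = spherical av x y"
  using assms by (auto simp: spherical_eq av_diff_commute[of "co x"] split: if_splits)

end

text \<open>Splitting places all zeros of the Wronskian in the field itself. A disc free of critical
  points is then far from every linear factor, as \<open>coeff_bound_prod_linear\<close>
  demands.\<close>

locale split_rational_map = nonarch_absolute_value av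
  for av :: "'c::field_char_0 \<Rightarrow> real" +
  fixes f g :: "'c poly" and d :: nat
  assumes coprime_fg: "coprime f g" and d_eq: "d = rat_degree f g" and d_pos: "1 \<le> d"
    and wronskian_splits: "\<exists>l M. wronskian (chart_poly d b f) (chart_poly d b g) = smult l (\<Prod>x\<in>#M. [:- x, 1:])"
begin

abbreviation "num b \<equiv> chart_poly d b f"
abbreviation "den b \<equiv> chart_poly d b g"

lemma degree_le_d: "degree f \<le> d" "degree g \<le> d"
  by (auto simp: d_eq rat_degree_def)

lemma degree_chart: "degree (num b) \<le> d" "degree (den b) \<le> d"
  using degree_le_d degree_rev_poly by (auto simp: chart_poly_def)

lemma coprime_chart: "coprime (num b) (den b)"
  using coprime_fg coprime_rev_poly[OF coprime_fg d_eq] by (simp add: chart_poly_def)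

text \<open>A vanishing Wronskian would make both polynomials constant. In the coordinate
  \<open>z\<close> this contradicts \<open>d \<ge> 1\<close>; in the coordinate \<open>1/z\<close>
  it makes 0 a common zero of \<open>f\<close> and \<open>g\<close>.\<close>

lemma wronskian_chart_nonzero: "wronskian (num b) (den b) \<noteq> 0"
proof
  assume W: "wronskian (num b) (den b) = 0"
  then have W': "wronskian (den b) (num b) = 0" by (simp add: wronskian_commute[of "den b"])
  have deg: "degree (num b) = 0" "degree (den b) = 0"
    using wronskian_eq_0_imp_degree[OF coprime_chart W]
      wronskian_eq_0_imp_degree[OF coprime_chart[THEN coprime_commute[THEN iffD1]] W'] by auto
  show False
  proof (cases b)
    case True
    then show ?thesis using deg d_pos by (simp add: chart_poly_def d_eq rat_degree_def)
  next
    case False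
    have "coeff (num b) d = 0" "coeff (den b) d = 0"
      using deg d_pos by (auto intro!: coeff_eq_0)
    then have "poly f 0 = 0" "poly g 0 = 0"
      using False by (auto simp: chart_poly_def coeff_rev_poly poly_0_coeff_0)
    then have "[:0, 1:] dvd f" "[:0, 1:] dvd g" by (auto simp: poly_eq_0_iff_dvd)
    then have "is_unit [:0, 1 :: 'c:]" using coprime_fg by (auto simp: coprime_def)
    then show False by (simp add: is_unit_poly_iff)
  qed
qed

lemma chart_value_nonzero: "poly (num b) u \<noteq> 0 \<or> poly (den b) u \<noteq> 0"
proof -
  obtain s t where "s * num b + t * den b = 1" using poly_bezout[OF coprime_chart] by blast
  then have "poly (s * num b + t * den b) u = 1" by simp
  then show ?thesis by auto
qed

lemma height_pos: "0 < height (num b) (den b) u"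
  using chart_value_nonzero[of b u] by (auto simp: height_def less_max_iff_disj av_pos_iff)

lemma twist_chart_nonzero: "twist (num b) (den b) a \<noteq> 0"
proof
  assume T: "twist (num b) (den b) a = 0"
  have *: False if "poly G a \<noteq> 0" "wronskian F G \<noteq> 0" "twist F G a = 0" for F G
    using wronskian_twist[of F G a] that by (simp add: wronskian_def pcompose_eq_0_iff)
  have "wronskian (den b) (num b) \<noteq> 0"
    using wronskian_chart_nonzero by (simp add: wronskian_commute[of "den b"])
  then show False
    using *[of "den b" "num b"] *[of "num b" "den b"] T chart_value_nonzero[of b a] wronskian_chart_nonzero
    by (auto simp: twist_commute[of "den b"])
qed

text \<open>Evaluating a Bezout identity bounds 1 by the height times the Gauss norms of the
  cofactors. This takes the place of a compactness argument on the unit disc.\<close>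

lemma height_lower_bound: "\<exists>c>0. \<forall>u. av u \<le> 1 \<longrightarrow> c \<le> height (num b) (den b) u"
proof -
  obtain s t where st: "s * num b + t * den b = 1" using poly_bezout[OF coprime_chart] by blast
  define D where "D = max 1 (max (gauss_norm 1 s) (gauss_norm 1 t))"
  have D: "1 \<le> D" "gauss_norm 1 s \<le> D" "gauss_norm 1 t \<le> D" by (auto simp: D_def)
  have "1 / D \<le> height (num b) (den b) u" if u: "av u \<le> 1" for u
  proof -
    have b: "av (poly s u) \<le> D" "av (poly t u) \<le> D"
      using D u gauss_norm_le_iff[of 1] by (auto intro!: coeff_bound_poly[of 1])
    have "poly (s * num b + t * den b) u = 1" unfolding st by simp
    then have "1 = av (poly s u * poly (num b) u + poly t u * poly (den b) u)" by (simp add: av_one)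
    also have "\<dots> \<le> max (av (poly s u) * av (poly (num b) u)) (av (poly t u) * av (poly (den b) u))"
      using av_ultrametric by (simp add: av_mult[symmetric])
    also have "\<dots> \<le> D * height (num b) (den b) u"
      using b D(1) by (intro max.boundedI mult_mono) (auto simp: height_def av_nonneg)
    finally show ?thesis using D(1) by (simp add: field_simps)
  qed
  then show ?thesis using D(1) by (intro exI[of _ "1 / D"]) auto
qed

text \<open>On an admissible disc of radius below 1 the height is constant, so the spherical
  distance from the image of \<open>x\<close> to the image of \<open>y\<close> is the absolute value
  of the twist at \<open>co y - co x\<close> divided by the squared height. The Gauss norm replaces
  the largest such value.\<close>

definition image_radius :: "'c proj_line \<Rightarrow> real \<Rightarrow> real" where
  "image_radius x r = gauss_norm r (twist (num (ch x)) (den (ch x)) (co x)) / (height (num (ch x)) (den (ch x)) (co x))\<^sup>2"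

abbreviation adm :: "'c proj_line \<Rightarrow> real \<Rightarrow> bool" where
  "adm x r \<equiv> admissible (num (ch x)) (den (ch x)) (co x) r"

lemma uniform_admissible: "\<exists>r0>0. r0 < 1 \<and> (\<forall>x r. 0 < r \<longrightarrow> r \<le> r0 \<longrightarrow> adm x r)"
proof -
  obtain cb where cb: "\<And>b. cb b > 0 \<and> (\<forall>u. av u \<le> 1 \<longrightarrow> cb b \<le> height (num b) (den b) u)"
    using height_lower_bound by metis
  define c where "c = min (cb True) (cb False)"
  have c: "c > 0" "\<And>b u. av u \<le> 1 \<Longrightarrow> c \<le> height (num b) (den b) u"
  proof -
    show "c > 0" using cb by (simp add: c_def)
    show "c \<le> height (num b) (den b) u" if "av u \<le> 1" for b u
      using cb[of b] that by (cases b) (auto simp: c_def min_le_iff_disj)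
  qed
  define C where "C = Max ((\<lambda>p. gauss_norm 1 p) ` {num True, den True, num False, den False})"
  have C: "coeff_bound 1 C (num b)" "coeff_bound 1 C (den b)" for b
    by (cases b; auto simp: C_def gauss_norm_le_iff[symmetric] intro!: Max_ge)+
  have C0: "0 \<le> C" using C(1) by (rule coeff_bound_nonneg)
  \<comment> \<open>The bound \<open>1 / 2\<close> keeps discs inside one chart; the other entry
    makes \<open>C * r0 \<le> c / 2\<close>, strictly below every height.\<close>
  define r0 where "r0 = min (1 / 2) (c / (2 * (C + 1)))"
  have r0: "0 < r0" "r0 < 1" using c(1) C0 by (auto simp: r0_def)
  have Cr: "C * r0 \<le> c / 2"
  proof -
    have "r0 \<le> c / (2 * (C + 1))" by (simp add: r0_def)
    then have "2 * (C * r0) + 2 * r0 \<le> c" using C0 by (simp add: field_simps)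
    then show ?thesis using r0 by linarith
  qed
  have "adm x r" if r: "0 < r" "r \<le> r0" for x r
    unfolding admissible_def
  proof (intro conjI exI[of _ "c / 2"] allI impI)
    show "c / 2 < height (num (ch x)) (den (ch x)) (co x)"
      using c(1) c(2)[OF av_co_le_1, of "ch x" x] by linarith
    have *: "av (coeff (pcompose p [:co x, 1:]) j) * r ^ j \<le> c / 2" if "coeff_bound 1 C p" "1 \<le> j" for p j
    proof -
      have "av (coeff (pcompose p [:co x, 1:]) j) \<le> C"
        using coeff_bound_translate[OF that(1) av_co_le_1] by (simp add: coeff_bound_def)
      moreover have "r ^ j \<le> r0"
        using power_decreasing[OF that(2), of r] r r0 by simp
      ultimately have "av (coeff (pcompose p [:co x, 1:]) j) * r ^ j \<le> C * r0"
        using C0 r by (intro mult_mono) auto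
      then show ?thesis using Cr by simp
    qed
    show "av (coeff (pcompose (num (ch x)) [:co x, 1:]) j) * r ^ j \<le> c / 2"
      "av (coeff (pcompose (den (ch x)) [:co x, 1:]) j) * r ^ j \<le> c / 2" if "1 \<le> j" for j
      using * C that by blast+
  qed (use r in auto)
  then show ?thesis using r0 by blast
qed

lemma image_dist:
  assumes a: "adm x r" and r: "r < 1" and yz: "spherical av x y \<le> r" "spherical av x z \<le> r"
  shows "spherical av (rat_map f g y) (rat_map f g z) =
    av (poly (num (ch x)) (co y) * poly (den (ch x)) (co z) - poly (num (ch x)) (co z) * poly (den (ch x)) (co y))
      / (height (num (ch x)) (den (ch x)) (co x))\<^sup>2"
proof -
  have *: "height (num (ch x)) (den (ch x)) (co w) = height (num (ch x)) (den (ch x)) (co x)"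
    "w = chart_pt (ch x) (co w)" if "spherical av x w \<le> r" for w
    using height_translate[OF a, of "co w - co x"] that disc_chart[OF that r] chart_pt_co[of w] by auto
  show ?thesis
    using *[OF yz(1)] *[OF yz(2)] spherical_hpt[OF chart_value_nonzero chart_value_nonzero, of "ch x" "co y" "ch x" "co z"]
    by (metis rat_map_chart_pt[OF d_eq] height_def power2_eq_square)
qed

lemma image_radius_translate:
  assumes a: "adm x r" "adm y r" and r: "r < 1" and xy: "spherical av x y \<le> r"
  shows "image_radius y r = image_radius x r"
proof -
  have *: "image_radius y r \<le> image_radius x r" if a: "adm x r" and xy: "spherical av x y \<le> r" for x y
  proof -
    have c: "ch y = ch x" "av (co y - co x) \<le> r" using disc_chart[OF xy r] xy by auto
    show ?thesis
      using gauss_norm_twist_translate[OF a c(2)] height_translate[OF a c(2)] c(1)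
      by (simp add: image_radius_def divide_right_mono)
  qed
  have "spherical av y x \<le> r"
    using xy disc_chart[OF xy r] by (simp add: spherical_eq)
  then show ?thesis using *[OF a(1) xy] *[OF a(2), of x] by linarith
qed

definition crit :: "'c proj_line set" where
  "crit = {x. poly (wronskian (num (ch x)) (den (ch x))) (co x) = 0}"

lemma finite_crit: "finite crit"
proof -
  have "crit \<subseteq> (\<Union>b. chart_pt b ` {u. poly (wronskian (num b) (den b)) u = 0})"
  proof
    fix x assume "x \<in> crit"
    then show "x \<in> (\<Union>b. chart_pt b ` {u. poly (wronskian (num b) (den b)) u = 0})"
      unfolding crit_def using chart_pt_co[of x, symmetric] by blast
  qed
  moreover have "finite \<dots>"
    using wronskian_chart_nonzero by (auto intro!: finite_imageI poly_roots_finite)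
  ultimately show ?thesis by (rule finite_subset)
qed

lemma finite_critical_of_wronskian:
  fixes F G :: "'c poly"
  assumes "poly (wronskian F G) z = 0"
  shows "finite_critical F G z"
  using assms by (auto simp: finite_critical_def quotient_deriv_def wronskian_def algebra_simps)

text \<open>\<open>crit\<close> looks at a finite point with \<open>av z > 1\<close> in the
  coordinate \<open>1/z\<close>, whereas \<open>critical_point\<close> uses \<open>z\<close>;
  \<open>wronskian_rev_poly\<close> translates between the two.\<close>

lemma crit_critical_point:
  assumes "x \<in> crit"
  shows "critical_point f g x"
proof (cases x)
  case (Fin z)
  show ?thesis
  proof (cases "av z \<le> 1")
    case True
    then show ?thesis using assms Fin
      by (auto simp: crit_def ch_def co_def chart_poly_def intro: finite_critical_of_wronskian)
  next
    case False
    then have z: "z \<noteq> 0" by (auto simp: av_zero)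
    have "poly (wronskian (rev_poly d f) (rev_poly d g)) (inverse z) = 0"
      using assms Fin False by (simp add: crit_def ch_def co_def chart_poly_def)
    then have "poly (wronskian f g) z = 0"
      using wronskian_rev_poly[OF degree_le_d, of "inverse z"] z by (simp add: divide_inverse)
    then show ?thesis using Fin by (simp add: finite_critical_of_wronskian)
  qed
next
  case Infty
  then show ?thesis using assms
    by (auto simp: crit_def ch_def co_def chart_poly_def d_eq[symmetric] intro: finite_critical_of_wronskian)
qed

text \<open>A zero of the Wronskian closer than \<open>s < 1\<close> to \<open>co x\<close> would be
  the coordinate of a point in the same chart, hence an element of \<open>crit\<close> within
  spherical distance \<open>s\<close>. So all linear factors are far away and the linear term
  dominates.\<close>

lemma good_disc:
  assumes a: "adm x s" and s: "s < 1" and far: "\<forall>c\<in>crit. s < spherical av x c"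
    and r: "0 < r" "r \<le> av (fact d) / 2 * s"
  defines "P \<equiv> twist (num (ch x)) (den (ch x)) (co x)"
  shows "0 < av (coeff P 1)" "2 \<le> j \<Longrightarrow> av (coeff P j) * r ^ j \<le> av (coeff P 1) * r / 2"
proof -
  define W where "W = wronskian (num (ch x)) (den (ch x))"
  obtain l M where lM: "W = smult l (\<Prod>x\<in>#M. [:- x, 1:])"
    unfolding W_def using wronskian_splits by blast
  have s0: "0 < s" using a by (simp add: admissible_def)
  have sep: "s \<le> av (co x - \<alpha>)" if \<alpha>: "poly W \<alpha> = 0" for \<alpha>
  proof (rule ccontr)
    assume "\<not> ?thesis"
    then have less: "av (co x - \<alpha>) < s" by simp
    have "av \<alpha> \<le> max (av (co x)) (av (co x - \<alpha>))" using av_diff[of "co x" "co x - \<alpha>"] by simp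
    then have \<alpha>1: "av \<alpha> \<le> 1" "ch x \<or> av \<alpha> < 1"
      using less s av_co_le_1[of x] av_co_less_1[of x] by (cases "ch x"; auto simp: le_max_iff_disj)+
    define c where "c = chart_pt (ch x) \<alpha>"
    have c: "ch c = ch x" "co c = \<alpha>" using ch_co_chart_pt[OF \<alpha>1] by (auto simp: c_def)
    then have "c \<in> crit" using \<alpha> by (simp add: crit_def W_def)
    then show False using far less c by (auto simp: spherical_eq)
  qed
  have roots: "s \<le> av (co x - \<alpha>)" if "\<alpha> \<in># M" for \<alpha>
  proof (rule sep)
    show "poly W \<alpha> = 0" using that by (auto simp: lM poly_prod_mset prod_mset_zero_iff)
  qed
  note lM' = lM[unfolded W_def]
  have "poly W (co x) \<noteq> 0" using sep[of "co x"] s0 by (auto simp: av_zero)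
  then show "0 < av (coeff P 1)"
    unfolding P_def by (subst twist_dominated(1)[OF a lM' roots]) (simp_all add: W_def av_pos_iff)
  show "av (coeff P j) * r ^ j \<le> av (coeff P 1) * r / 2" if "2 \<le> j"
    unfolding P_def using twist_linear_term_dominates[OF a lM' roots degree_chart r that] by simp
qed

theorem ultrametric_map_exists:
  "\<exists>r0 kap. ultrametric_map (spherical av) (rat_map f g) image_radius crit d r0 kap"
proof -
  obtain r0 where r0: "0 < r0" "r0 < 1" and adm: "\<And>x r. 0 < r \<Longrightarrow> r \<le> r0 \<Longrightarrow> adm x r"
    using uniform_admissible by blast
  define kap where "kap = av (fact d) / 2"
  have fd: "0 < av (fact d)" "av (fact d) \<le> 1"
    using av_fact_mult_mono[of 0 d 1] by (auto simp: av_pos_iff av_one)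
  have kap: "0 < kap" "kap < 1" using fd by (auto simp: kap_def)
  interpret M: Metric_space "P1 UNIV" "spherical av" by (rule Metric_space_spherical)
  have P1: "x \<in> P1 UNIV" for x :: "'c proj_line" by (cases x) (auto simp: P1_def)
  define H where "H x = (height (num (ch x)) (den (ch x)) (co x))\<^sup>2" for x
  have H: "0 < H x" for x using height_pos[of "ch x" "co x"] by (simp add: H_def)
  define P where "P x = twist (num (ch x)) (den (ch x)) (co x)" for x
  have A: "image_radius x r = gauss_norm r (P x) / H x" for x r by (simp add: image_radius_def P_def H_def)
  have good: "gauss_norm (t * r) (P x) = av (coeff (P x) 1) * (t * r)"
    "\<And>j. 2 \<le> j \<Longrightarrow> av (coeff (P x) j) * r ^ j \<le> av (coeff (P x) 1) * r / 2" "0 < av (coeff (P x) 1)"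
    if r: "0 < r" "r \<le> kap * r0" "\<forall>c\<in>crit. r / kap < spherical av x c" and t: "0 < t" "t \<le> 1" for x r t
  proof -
    \<comment> \<open>\<open>r / kap\<close> is the radius of the disc free of critical points; by
      the choice of \<open>kap\<close>, \<open>r\<close> is the radius to which it has to be
      shrunk.\<close>
    have s: "0 < r / kap" "r / kap \<le> r0" "r \<le> av (fact d) / 2 * (r / kap)"
      using r kap fd by (auto simp: field_simps kap_def)
    then have s1: "r / kap < 1" using r0 by linarith
    note gd = good_disc[OF adm[OF s(1,2)] s1 r(3)]
    have "t * r \<le> 1 * r" using r t by (intro mult_right_mono) auto
    then have s': "t * r \<le> av (fact d) / 2 * (r / kap)" "0 < t * r"
      using order_trans[OF _ s(3), of "t * r"] r t by simp_all
    show "0 < av (coeff (P x) 1)" unfolding P_def by (rule gd(1)[OF r(1) s(3)])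
    show "av (coeff (P x) j) * r ^ j \<le> av (coeff (P x) 1) * r / 2" if "2 \<le> j" for j
      unfolding P_def by (rule gd(2)[OF r(1) s(3) that])
    show "gauss_norm (t * r) (P x) = av (coeff (P x) 1) * (t * r)"
    proof (rule gauss_norm_eq_linear[OF s'(2)])
      show "av (coeff (P x) j) * (t * r) ^ j \<le> av (coeff (P x) 1) * (t * r)" if "2 \<le> j" for j
      proof -
        have "av (coeff (P x) j) * (t * r) ^ j \<le> av (coeff (P x) 1) * (t * r) / 2"
          unfolding P_def by (rule gd(2)[OF s'(2,1) that])
        moreover have "0 \<le> av (coeff (P x) 1) * (t * r)" using s'(2) av_nonneg by simp
        ultimately show ?thesis by linarith
      qed
    qed (simp add: P_def)
  qed
  have "ultrametric_map (spherical av) (rat_map f g) image_radius crit d r0 kap"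
  proof
    show "0 \<le> spherical av x y" for x y by (rule M.nonneg)
    show "spherical av x y = 0 \<longleftrightarrow> x = y" for x y by (rule M.zero[OF P1 P1])
    show "spherical av x y = spherical av y x" for x y by (rule M.commute)
    show "spherical av x z \<le> max (spherical av x y) (spherical av y z)" for x y z
      by (rule spherical_ultrametric)
    show "1 \<le> d" by (rule d_pos)
    show "0 < r0" by (rule r0)
    show "0 < kap" "kap < 1" by (rule kap)+
    show "finite crit" by (rule finite_crit)
    show "0 < image_radius x r" if "0 < r" "r \<le> r0" for r x
      unfolding A P_def using gauss_norm_pos[OF that(1) twist_chart_nonzero] H by simp
    show "image_radius x r \<le> image_radius x s" if "0 < r" "r \<le> s" "s \<le> r0" for r s x
      unfolding A using that H[of x] by (intro divide_right_mono gauss_norm_mono) auto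
    show "spherical av (rat_map f g y) (rat_map f g z) \<le> image_radius x r / r * spherical av y z"
      if r: "0 < r" "r \<le> r0" and yz: "spherical av x y \<le> r" "spherical av x z \<le> r" for r x y z
    proof -
      have r1: "r < 1" using r r0 by simp
      note dy = disc_chart[OF yz(1) r1] and dz = disc_chart[OF yz(2) r1]
      have "spherical av y z = av (co y - co z)" using dy dz by (simp add: spherical_eq)
      moreover have "av (poly (num (ch x)) (co y) * poly (den (ch x)) (co z) - poly (num (ch x)) (co z) * poly (den (ch x)) (co y))
          \<le> gauss_norm r (P x) / r * av (co y - co z)"
        using cross_le[OF adm[OF r], of "co y - co x" "co z - co x" x] dy dz yz by (simp add: P_def)
      ultimately show ?thesis
        unfolding image_dist[OF adm[OF r] r1 yz] A H_def[symmetric] using H[of x]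
        by (simp add: divide_right_mono field_simps)
    qed
    show "t ^ d * image_radius x r \<le> image_radius x (t * r)" if "0 < r" "r \<le> r0" "0 < t" "t \<le> 1" for r t x
      unfolding A P_def using gauss_norm_scale[OF _ that(3,4) degree_twist[OF degree_chart]] that H[of x]
      by (simp add: divide_right_mono)
    show "image_radius y r = image_radius x r" if "0 < r" "r \<le> r0" "spherical av x y \<le> r" for r x y
      using that r0 adm by (intro image_radius_translate) auto
    show "\<exists>Y. finite Y \<and> card Y \<le> d \<and> (\<forall>y. spherical av x y \<le> r \<longrightarrow>
        spherical av (rat_map f g x) (rat_map f g y) < t ^ d * image_radius x r \<longrightarrow> (\<exists>w\<in>Y. spherical av w y < t * r))"
      if r: "0 < r" "r \<le> r0" and t: "0 < t" "t \<le> 1" for r t x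
    proof -
      have r1: "r < 1" using r r0 by simp
      obtain Y where Y: "finite Y" "card Y \<le> d"
        "\<And>u. av u \<le> r \<Longrightarrow> av (poly (P x) u) < t ^ d * gauss_norm r (P x) \<Longrightarrow> \<exists>w\<in>Y. av (u - w) < t * r"
        using polynomial_sublevel_cover[OF r(1) t degree_twist[OF degree_chart]] unfolding P_def by blast
      \<comment> \<open>\<open>Y\<close> consists of displacements from \<open>co x\<close>;
        \<open>Z\<close> are the corresponding points in the chart of \<open>x\<close>.\<close>
      define Z where "Z = (\<lambda>w. chart_pt (ch x) (co x + w)) ` Y"
      have "card Z \<le> d" unfolding Z_def using card_image_le[OF Y(1)] Y(2) order_trans by blast
      moreover have "\<exists>w\<in>Z. spherical av w y < t * r"
        if y: "spherical av x y \<le> r" "spherical av (rat_map f g x) (rat_map f g y) < t ^ d * image_radius x r" for y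
      proof -
        note dy = disc_chart[OF y(1) r1]
        have xx: "spherical av x x \<le> r" using r(1) by (simp add: spherical_eq av_zero)
        have "av (poly (P x) (co y - co x)) / H x < t ^ d * (gauss_norm r (P x) / H x)"
          using y(2) image_dist[OF adm[OF r] r1 xx y(1)] av_diff_commute
          by (simp add: A H_def[symmetric] P_def poly_twist mult.commute)
        then have "av (poly (P x) (co y - co x)) < t ^ d * gauss_norm r (P x)"
          using H[of x] by (simp add: field_simps)
        then obtain w where w: "w \<in> Y" "av (co y - co x - w) < t * r"
          using Y(3)[of "co y - co x"] dy y(1) by auto
        have "t * r \<le> 1 * r" using t r by (intro mult_right_mono) auto
        then have tr: "t * r < 1" using r1 by simp
        have eq: "co x + w = co y - (co y - co x - w)" by simp
        \<comment> \<open>The center need not lie in the original disc, but its coordinate is within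
          \<open>t * r < 1\<close> of that of \<open>y\<close>, so it belongs to the same
          chart.\<close>
        have w1: "av (co x + w) \<le> 1" "ch x \<or> av (co x + w) < 1"
          using av_diff[of "co y" "co y - co x - w"] w(2) tr av_co_le_1[of y] av_co_less_1[of y] dy(1)
          unfolding eq by auto
        have "spherical av (chart_pt (ch x) (co x + w)) y = av (co x + w - co y)"
          using ch_co_chart_pt[OF w1] dy(1) by (simp add: spherical_eq)
        also have "\<dots> < t * r" using w(2) av_diff_commute[of "co x + w" "co y"] by (simp add: algebra_simps)
        finally show ?thesis using w(1) by (auto simp: Z_def)
      qed
      ultimately show ?thesis using Y(1) by (intro exI[of _ Z]) (auto simp: Z_def)
    qed
    show "image_radius x (t * r) = t * image_radius x r"
      if "0 < r" "r \<le> kap * r0" "\<forall>c\<in>crit. r / kap < spherical av x c" "0 < t" "t \<le> 1" for r x t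
      using good(1)[OF that] good(1)[OF that(1-3), of 1] by (simp add: A)
    show "spherical av (rat_map f g y) (rat_map f g z) = image_radius x r / r * spherical av y z"
      if r: "0 < r" "r \<le> kap * r0" "\<forall>c\<in>crit. r / kap < spherical av x c"
        and yz: "spherical av x y \<le> r" "spherical av x z \<le> r" for r x y z
    proof -
      have "kap * r0 \<le> 1 * r0" using kap r0 by (intro mult_right_mono) auto
      then have r': "r \<le> r0" "r < 1" using r(2) r0 by linarith+
      note dy = disc_chart[OF yz(1) r'(2)] and dz = disc_chart[OF yz(2) r'(2)]
      note gd = good[OF r, of 1, simplified]
      have yz': "spherical av y z = av (co y - co z)" using dy dz by (simp add: spherical_eq)
      have less: "av (coeff (P x) 1) * r / 2 < av (coeff (P x) 1) * r" using gd(3) r(1) by simp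
      have "av (poly (num (ch x)) (co y) * poly (den (ch x)) (co z) - poly (num (ch x)) (co z) * poly (den (ch x)) (co y))
          = av (coeff (P x) 1) * av (co y - co z)"
        using cross_eq[OF adm[OF r(1) r'(1)], of "co y - co x" "co z - co x" x "av (coeff (P x) 1) * r / 2"]
          gd(2) less dy dz yz by (simp add: P_def)
      then show ?thesis
        unfolding image_dist[OF adm[OF r(1) r'(1)] r'(2) yz] A yz' H_def[symmetric]
        using gd(1) r(1) by simp
    qed
  qed
  then show ?thesis by blast
qed

end

section \<open>Splitting over the algebraic closure\<close>

lemma is_subfieldD:
  assumes "is_subfield F"
  shows "0 \<in> F" "1 \<in> F" "x \<in> F \<Longrightarrow> y \<in> F \<Longrightarrow> x + y \<in> F" "x \<in> F \<Longrightarrow> y \<in> F \<Longrightarrow> x * y \<in> F"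
    "x \<in> F \<Longrightarrow> - x \<in> F" "x \<in> F \<Longrightarrow> inverse x \<in> F" "x \<in> F \<Longrightarrow> y \<in> F \<Longrightarrow> x - y \<in> F"
    "x \<in> F \<Longrightarrow> y \<in> F \<Longrightarrow> x / y \<in> F" "of_nat n \<in> F" "x \<in> F \<Longrightarrow> x ^ n \<in> F"
proof -
  have *: "0 \<in> F" "1 \<in> F" "\<And>x y. x \<in> F \<Longrightarrow> y \<in> F \<Longrightarrow> x + y \<in> F" "\<And>x y. x \<in> F \<Longrightarrow> y \<in> F \<Longrightarrow> x * y \<in> F"
    "\<And>x. x \<in> F \<Longrightarrow> - x \<in> F" "\<And>x. x \<in> F \<Longrightarrow> inverse x \<in> F"
    using assms by (auto simp: is_subfield_def)
  then show "0 \<in> F" "1 \<in> F" "x \<in> F \<Longrightarrow> y \<in> F \<Longrightarrow> x + y \<in> F" "x \<in> F \<Longrightarrow> y \<in> F \<Longrightarrow> x * y \<in> F"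
    "x \<in> F \<Longrightarrow> - x \<in> F" "x \<in> F \<Longrightarrow> inverse x \<in> F" by simp_all
  show "x \<in> F \<Longrightarrow> y \<in> F \<Longrightarrow> x - y \<in> F" using *(3)[of x "- y"] *(5)[of y] by simp
  show "x \<in> F \<Longrightarrow> y \<in> F \<Longrightarrow> x / y \<in> F" using *(4)[of x "inverse y"] *(6)[of y] by (simp add: divide_inverse)
  show "of_nat n \<in> F" by (induction n) (auto intro: *)
  show "x \<in> F \<Longrightarrow> x ^ n \<in> F" by (induction n) (auto intro: *)
qed

lemma is_subfield_sum:
  assumes "is_subfield F" "\<And>i. i \<in> S \<Longrightarrow> h i \<in> F"
  shows "sum h S \<in> F"
  using assms(2) by (induction S rule: infinite_finite_induct) (auto intro: is_subfieldD(1,3)[OF assms(1)])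

text \<open>Gaussian elimination over the subfield: a row \<open>k\<close> with nonzero entry in
  column \<open>b\<close> clears that column, leaving one row and one column fewer.\<close>

lemma subfield_linear_dependence:
  assumes F: "is_subfield F" and "finite B" "finite I" "card B < card I" "\<And>i b. i \<in> I \<Longrightarrow> b \<in> B \<Longrightarrow> c i b \<in> F"
  shows "\<exists>l. (\<forall>i\<in>I. l i \<in> F) \<and> (\<exists>i\<in>I. l i \<noteq> 0) \<and> (\<forall>b\<in>B. (\<Sum>i\<in>I. l i * c i b) = 0)"
  using assms(2-5)
proof (induction B arbitrary: I c rule: finite_induct)
  case empty
  then have "I \<noteq> {}" by auto
  then show ?case using is_subfieldD(2)[OF F] by (intro exI[of _ "\<lambda>_. 1"]) auto
next
  case (insert b B)
  show ?case
  proof (cases "\<forall>i\<in>I. c i b = 0")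
    case True
    obtain l where "\<forall>i\<in>I. l i \<in> F" "\<exists>i\<in>I. l i \<noteq> 0" "\<forall>b\<in>B. (\<Sum>i\<in>I. l i * c i b) = 0"
      using insert.IH[of I c] insert.prems insert.hyps by auto
    then show ?thesis using True by (intro exI[of _ l]) auto
  next
    case False
    then obtain k where k: "k \<in> I" "c k b \<noteq> 0" by blast
    define c' where "c' i x = c i x - c i b / c k b * c k x" for i x
    have "card (I - {k}) = card I - 1" using k insert.prems by simp
    then have "card B < card (I - {k})" using insert by auto
    moreover have "c' i x \<in> F" if "i \<in> I - {k}" "x \<in> B" for i x
      unfolding c'_def using that k insert.prems by (intro is_subfieldD[OF F]) auto
    ultimately obtain m where m: "\<forall>i\<in>I - {k}. m i \<in> F" "\<exists>i\<in>I - {k}. m i \<noteq> 0"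
      "\<forall>x\<in>B. (\<Sum>i\<in>I - {k}. m i * c' i x) = 0"
      using insert.IH[of "I - {k}" c'] insert.prems by auto
    \<comment> \<open>\<open>- s\<close> is the coefficient of the pivot row that makes column
      \<open>b\<close> sum to zero; in the other columns it turns the relation for the eliminated
      entries \<open>c'\<close> into one for \<open>c\<close>.\<close>
    define s where "s = (\<Sum>i\<in>I - {k}. m i * (c i b / c k b))"
    define l where "l = m(k := - s)"
    have "s \<in> F" unfolding s_def using m(1) k insert.prems
      by (intro is_subfield_sum[OF F] is_subfieldD[OF F]) auto
    then have lF: "\<forall>i\<in>I. l i \<in> F" using m(1) is_subfieldD(5)[OF F] by (auto simp: l_def)
    have split: "(\<Sum>i\<in>I. l i * c i x) = (\<Sum>i\<in>I - {k}. m i * c i x) - s * c k x" for x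
      using sum.remove[OF insert.prems(1) k(1), of "\<lambda>i. l i * c i x"] by (simp add: l_def)
    have "(\<Sum>i\<in>I. l i * c i x) = 0" if x: "x \<in> insert b B" for x
    proof (cases "x = b")
      case True
      then show ?thesis using k(2) by (simp add: split s_def sum_distrib_right)
    next
      case False
      have "(\<Sum>i\<in>I - {k}. m i * c i x) - s * c k x = (\<Sum>i\<in>I - {k}. m i * c' i x)"
        unfolding s_def c'_def sum_distrib_right sum_subtractf[symmetric]
        by (intro sum.cong refl) (simp add: algebra_simps)
      then show ?thesis using m(3) x False by (simp add: split)
    qed
    moreover have "\<exists>i\<in>I. l i \<noteq> 0" using m(2) by (auto simp: l_def)
    ultimately show ?thesis using lF by blast
  qed
qed

text \<open>The \<open>card B + 1\<close> powers of \<open>x\<close> up to exponent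
  \<open>card B\<close> are combinations of the elements of \<open>B\<close>, so their coefficient
  vectors are dependent over \<open>F\<close>.\<close>

lemma finite_extension_algebraic:
  assumes "finite_extension F K" "x \<in> K"
  shows "\<exists>q. q \<noteq> 0 \<and> poly_over F q \<and> poly q x = 0"
proof -
  obtain B where B: "finite B" "K = {\<Sum>b\<in>B. c b * b |c. \<forall>b\<in>B. c b \<in> F}"
    and F: "is_subfield F" and K: "is_subfield K"
    using assms(1) by (auto simp: finite_extension_def)
  have "\<exists>c. (\<forall>b\<in>B. c b \<in> F) \<and> x ^ i = (\<Sum>b\<in>B. c b * b)" for i
    using is_subfieldD(10)[OF K assms(2), of i] B(2) by auto
  then obtain c where c: "\<And>i b. b \<in> B \<Longrightarrow> c i b \<in> F" "\<And>i. x ^ i = (\<Sum>b\<in>B. c i b * b)" by metis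
  obtain l where l: "\<forall>i\<in>{..card B}. l i \<in> F" "\<exists>i\<in>{..card B}. l i \<noteq> 0"
    "\<forall>b\<in>B. (\<Sum>i\<le>card B. l i * c i b) = 0"
    using subfield_linear_dependence[OF F B(1), of "{..card B}" c] c(1) by auto
  define q where "q = (\<Sum>i\<le>card B. monom (l i) i)"
  have cq: "coeff q i = (if i \<le> card B then l i else 0)" for i
    by (simp add: q_def coeff_sum if_distrib[of "\<lambda>x. x = _"] sum.delta cong: if_cong)
  have "poly q x = (\<Sum>i\<le>card B. l i * (\<Sum>b\<in>B. c i b * b))"
    by (simp add: q_def poly_sum poly_monom c(2))
  also have "\<dots> = (\<Sum>b\<in>B. (\<Sum>i\<le>card B. l i * c i b) * b)"
    by (simp add: sum_distrib_left sum_distrib_right mult.assoc) (rule sum.swap)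
  also have "\<dots> = 0" using l(3) by simp
  finally have "poly q x = 0" .
  moreover have "q \<noteq> 0"
  proof
    assume "q = 0"
    then have "coeff q i = 0" for i by simp
    then show False using l(2) cq by (metis atMost_iff)
  qed
  moreover have "poly_over F q" using l(1) is_subfieldD(1)[OF F] by (auto simp: poly_over_def cq)
  ultimately show ?thesis by blast
qed

lemma poly_over_mono: "poly_over F q \<Longrightarrow> F \<subseteq> A \<Longrightarrow> poly_over A q"
  by (auto simp: poly_over_def)

lemma poly_over_pCons: "poly_over A (pCons c q) \<longleftrightarrow> c \<in> A \<and> poly_over A q"
  unfolding poly_over_def by (subst all_nat_iff_0_Suc) simp

lemma poly_over_value:
  assumes "is_subfield A" "poly_over A q" "a \<in> A"
  shows "poly q a \<in> A"
  using assms(2) by (induction q) (auto simp: poly_over_pCons intro!: is_subfieldD(1,3,4)[OF assms(1)] assms(3))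

lemma poly_over_synthetic_div:
  assumes "is_subfield A" "poly_over A q" "a \<in> A"
  shows "poly_over A (synthetic_div q a)"
  using assms(2)
  by (induction q) (auto simp: poly_over_pCons synthetic_div_pCons intro: poly_over_value[OF assms(1) _ assms(3)])

lemma poly_over_wronskian:
  assumes A: "is_subfield A" and FG: "poly_over A F" "poly_over A G"
  shows "poly_over A (wronskian F G)"
  using FG unfolding poly_over_def wronskian_def coeff_diff coeff_mult coeff_pderiv
  by (intro allI is_subfieldD(4,7,9)[OF A] is_subfield_sum[OF A]) auto

lemma algebraic_closure_splits:
  assumes "is_algebraic_closure F A" "poly_over A q" "q \<noteq> 0"
  shows "\<exists>l M. set_mset M \<subseteq> A \<and> q = smult l (\<Prod>x\<in>#M. [:- x, 1:])"
  using assms(2,3)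
proof (induction "degree q" arbitrary: q)
  case 0
  then obtain l where "q = [:l:]" by (metis degree_eq_zeroE)
  then show ?case by (intro exI[of _ l] exI[of _ "{#}"]) auto
next
  case (Suc n)
  have A: "is_subfield A" using assms(1) by (simp add: is_algebraic_closure_def)
  obtain a where a: "a \<in> A" "poly q a = 0"
    using assms(1) Suc by (auto simp: is_algebraic_closure_def)
  define q' where "q' = synthetic_div q a"
  have q: "q = [:- a, 1:] * q'" using synthetic_div_correct'[of a q] a(2) by (simp add: q'_def)
  have "n = degree q'" using Suc.hyps(2) by (simp add: q'_def degree_synthetic_div)
  moreover have "poly_over A q'" unfolding q'_def by (rule poly_over_synthetic_div[OF A Suc.prems(1) a(1)])
  moreover have "q' \<noteq> 0" using q Suc.prems by auto
  ultimately obtain l M where "set_mset M \<subseteq> A" "q' = smult l (\<Prod>x\<in>#M. [:- x, 1:])"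
    using Suc.hyps(1) by blast
  then show ?case using q a(1)
    by (intro exI[of _ l] exI[of _ "add_mset a M"]) (auto simp: mult_smult_right)
qed

text \<open>A polynomial over \<open>F\<close> that kills \<open>x\<close> has all its roots in
  \<open>A\<close>. Consequently the Wronskian of a map defined over \<open>K\<close> splits in
  \<open>A\<close>.\<close>

lemma finite_extension_subset_algebraic_closure:
  assumes "is_algebraic_closure F A" "finite_extension F K"
  shows "K \<subseteq> A"
proof
  fix x assume "x \<in> K"
  then obtain q where q: "q \<noteq> 0" "poly_over F q" "poly q x = 0"
    using finite_extension_algebraic[OF assms(2)] by blast
  have "poly_over A q" using poly_over_mono[OF q(2)] assms(1) by (simp add: is_algebraic_closure_def)
  then obtain l M where lM: "set_mset M \<subseteq> A" "q = smult l (\<Prod>x\<in>#M. [:- x, 1:])"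
    using algebraic_closure_splits[OF assms(1) _ q(1)] by blast
  have "l \<noteq> 0" using lM(2) q(1) by auto
  then have "x \<in># M" using q(3) by (auto simp: lM(2) poly_prod_mset prod_mset_zero_iff)
  then show "x \<in> A" using lM(1) by blast
qed

section \<open>Comparison of the Fatou sets over C_p and over K\<close>

context split_rational_map
begin

text \<open>The powers of \<open>w\<close> provide arbitrarily small scales inside \<open>K\<close>,
  at each of which a rescaled copy of the same integer configuration is placed next to
  \<open>x\<close>.\<close>

theorem julia_set_restrict:
  assumes K: "is_subfield K" and w: "w \<in> K" "0 < av w" "av w < 1"
    and sh: "semi_hyperbolic av f g"
  shows "julia_set av UNIV f g \<inter> P1 K = julia_set av K f g"
proof -
  obtain r0 kap where um: "ultrametric_map (spherical av) (rat_map f g) image_radius crit d r0 kap"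
    using ultrametric_map_exists by blast
  interpret U: ultrametric_map "spherical av" "rat_map f g" image_radius crit d r0 kap by (rule um)
  have P1: "P1 UNIV = (UNIV :: 'c proj_line set)"
  proof -
    have "x \<in> P1 UNIV" for x :: "'c proj_line" by (cases x) (auto simp: P1_def)
    then show ?thesis by blast
  qed
  have Fatou_in: "x \<in> fatou_set av L f g" if x: "x \<in> U.Fatou" "x \<in> P1 L" for x L
  proof -
    interpret B: Metric_space "P1 L" "spherical av" by (rule Metric_space_spherical)
    obtain \<delta> where \<delta>: "\<delta> > 0" "\<forall>y. spherical av x y < \<delta> \<longrightarrow> (\<forall>e>0. \<exists>h>0. \<forall>z. spherical av x z < \<delta> \<longrightarrow>
        spherical av y z < h \<longrightarrow> (\<forall>n. spherical av ((rat_map f g ^^ n) y) ((rat_map f g ^^ n) z) < e))"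
      using x(1) unfolding U.Fatou_def by blast
    have "equicontinuous_family av (B.mball x \<delta>) (\<lambda>n. rat_map f g ^^ n)"
      unfolding equicontinuous_family_def
    proof (intro ballI allI impI)
      fix y and e :: real assume y: "y \<in> B.mball x \<delta>" and e: "0 < e"
      have "spherical av x y < \<delta>" using y by simp
      then obtain h where "h > 0" "\<forall>z. spherical av x z < \<delta> \<longrightarrow> spherical av y z < h \<longrightarrow>
          (\<forall>n. spherical av ((rat_map f g ^^ n) y) ((rat_map f g ^^ n) z) < e)"
        using \<delta>(2) e by meson
      then show "\<exists>h>0. \<forall>z\<in>B.mball x \<delta>. spherical av y z < h \<longrightarrow>
          (\<forall>n. spherical av ((rat_map f g ^^ n) y) ((rat_map f g ^^ n) z) < e)" by auto
    qed
    then show ?thesis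
      unfolding fatou_set_def using x(2) \<delta>(1) by (intro CollectI conjI exI[of _ "B.mball x \<delta>"]) auto
  qed
  have fatou_ball: "\<exists>r>0. \<forall>y\<in>P1 L. spherical av x y < r \<longrightarrow> (\<forall>e>0. \<exists>h>0. \<forall>z\<in>P1 L. spherical av x z < r \<longrightarrow>
      spherical av y z < h \<longrightarrow> (\<forall>n. spherical av ((rat_map f g ^^ n) y) ((rat_map f g ^^ n) z) < e))"
    if x: "x \<in> fatou_set av L f g" for x L
  proof -
    interpret B: Metric_space "P1 L" "spherical av" by (rule Metric_space_spherical)
    obtain V where V: "openin B.mtopology V" "x \<in> V" "equicontinuous_family av V (\<lambda>n. rat_map f g ^^ n)"
      and xL: "x \<in> P1 L"
      using x by (auto simp: fatou_set_def)
    obtain r where r: "r > 0" "B.mball x r \<subseteq> V" using V(1,2) by (auto simp: B.openin_mtopology)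
    have inV: "y \<in> V" if "y \<in> P1 L" "spherical av x y < r" for y
      using that r(2) xL by (auto simp: subset_iff)
    show ?thesis
    proof (rule exI[of _ r], intro conjI ballI impI allI)
      fix y and e :: real assume y: "y \<in> P1 L" "spherical av x y < r" and e: "0 < e"
      obtain h where "h > 0" "\<forall>z\<in>V. spherical av y z < h \<longrightarrow>
          (\<forall>n. spherical av ((rat_map f g ^^ n) y) ((rat_map f g ^^ n) z) < e)"
        using V(3) inV[OF y] e unfolding equicontinuous_family_def by blast
      then show "\<exists>h>0. \<forall>z\<in>P1 L. spherical av x z < r \<longrightarrow> spherical av y z < h \<longrightarrow>
          (\<forall>n. spherical av ((rat_map f g ^^ n) y) ((rat_map f g ^^ n) z) < e)"
        using inV by blast
    qed (rule r(1))
  qed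
  have Fatou_eq: "fatou_set av UNIV f g = U.Fatou"
  proof
    show "U.Fatou \<subseteq> fatou_set av UNIV f g"
    proof
      show "x \<in> fatou_set av UNIV f g" if "x \<in> U.Fatou" for x
        by (rule Fatou_in[OF that]) (simp add: P1)
    qed
    show "fatou_set av UNIV f g \<subseteq> U.Fatou"
    proof
      show "x \<in> U.Fatou" if "x \<in> fatou_set av UNIV f g" for x
        using fatou_ball[OF that] unfolding P1 U.Fatou_def by simp
    qed
  qed
  have nonrec: "\<forall>c\<in>crit - U.Fatou. \<not> U.accum c c"
  proof (intro ballI notI)
    fix c assume c: "c \<in> crit - U.Fatou"
    assume "U.accum c c"
    then have "recurrent av f g c" using U.accum_self_recurrent unfolding recurrent_def by blast
    moreover have "c \<in> julia_set av UNIV f g" using c P1 by (simp add: julia_set_def Fatou_eq)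
    ultimately show False using sh crit_critical_point[of c] c by (auto simp: semi_hyperbolic_def)
  qed
  have key: "x \<in> U.Fatou" if x: "x \<in> fatou_set av K f g" for x
  proof (rule ccontr)
    assume J: "x \<notin> U.Fatou"
    have xK: "x \<in> P1 K" using x by (simp add: fatou_set_def)
    obtain e N where e: "0 < e" and spread:
      "\<forall>t \<delta> S. 0 < t \<longrightarrow> t \<le> 1 \<longrightarrow> 0 < \<delta> \<longrightarrow> \<delta> \<le> e \<longrightarrow> finite S \<longrightarrow> N < card S \<longrightarrow>
        (\<forall>y\<in>S. spherical av x y \<le> \<delta>) \<longrightarrow>
        (\<forall>y\<in>S. \<forall>z\<in>S. y \<noteq> z \<longrightarrow> t * \<delta> \<le> spherical av y z) \<longrightarrow>
        (\<exists>n. \<exists>y\<in>S. t ^ N * e \<le> spherical av ((rat_map f g ^^ n) x) ((rat_map f g ^^ n) y))"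
      using U.separated_points_spread[OF nonrec J] by (elim exE conjE) (rule that)
    \<comment> \<open>\<open>t\<close> is to be the least absolute value of a difference of two
      distinct integers in \<open>0..N\<close>, so it depends on \<open>N\<close> but not on the
      scale. Inserting 1 makes \<open>D\<close> nonempty and gives \<open>t \<le> 1\<close>.\<close>
    define D where "D = insert 1 ((\<lambda>(i, j). av (of_nat i - of_nat j)) ` {(i, j). i \<le> N \<and> j \<le> N \<and> i \<noteq> j})"
    have "finite {(i, j). i \<le> N \<and> j \<le> N \<and> i \<noteq> j}"
      by (rule finite_subset[of _ "{..N} \<times> {..N}"]) auto
    then have finD: "finite D" unfolding D_def by (intro finite.insertI finite_imageI)
    define t where "t = Min D"
    have t: "0 < t" "t \<le> 1" "\<And>i j. i \<le> N \<Longrightarrow> j \<le> N \<Longrightarrow> i \<noteq> j \<Longrightarrow> t \<le> av (of_nat i - of_nat j)"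
    proof -
      have "\<forall>s\<in>D. 0 < s" by (auto simp: D_def av_pos_iff)
      then show "0 < t" unfolding t_def using finD by (subst Min_gr_iff) (auto simp: D_def)
      show "t \<le> 1" unfolding t_def using finD by (intro Min_le) (auto simp: D_def)
      show "t \<le> av (of_nat i - of_nat j)" if "i \<le> N" "j \<le> N" "i \<noteq> j" for i j
        unfolding t_def using finD that by (intro Min_le) (auto simp: D_def)
    qed
    obtain r where r: "r > 0" "\<forall>y\<in>P1 K. spherical av x y < r \<longrightarrow> (\<forall>e>0. \<exists>h>0. \<forall>z\<in>P1 K. spherical av x z < r \<longrightarrow>
      spherical av y z < h \<longrightarrow> (\<forall>n. spherical av ((rat_map f g ^^ n) y) ((rat_map f g ^^ n) z) < e))"
      using fatou_ball[OF x] by blast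
    have "0 < t ^ N * e" using t(1) e by simp
    \<comment> \<open>Equicontinuity at the center \<open>x\<close> is used with tolerance
      \<open>t ^ N * e\<close>, the very displacement that \<open>spread\<close> produces at every
      scale.\<close>
    then obtain h where h: "h > 0" "\<And>z n. z \<in> P1 K \<Longrightarrow> spherical av x z < r \<Longrightarrow> spherical av x z < h \<Longrightarrow>
        spherical av ((rat_map f g ^^ n) x) ((rat_map f g ^^ n) z) < t ^ N * e"
    proof -
      have "spherical av x x < r" using r(1) by simp
      then have "\<exists>h>0. \<forall>z\<in>P1 K. spherical av x z < r \<longrightarrow> spherical av x z < h \<longrightarrow>
          (\<forall>n. spherical av ((rat_map f g ^^ n) x) ((rat_map f g ^^ n) z) < t ^ N * e)"
        using r(2) xK \<open>0 < t ^ N * e\<close> by blast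
      then show ?thesis using that by blast
    qed
    have "0 < min (min r h) (min e 1)" using r(1) h(1) e by simp
    then obtain k where k: "av w ^ k < min (min r h) (min e 1)"
      using real_arch_pow_inv[OF _ w(3)] by blast
    define \<delta> where "\<delta> = av w ^ k"
    have \<delta>: "0 < \<delta>" "\<delta> < r" "\<delta> < h" "\<delta> \<le> e" "\<delta> < 1" using k w by (auto simp: \<delta>_def)
    \<comment> \<open>The \<open>N + 1\<close> points are taken in the coordinate of the chart of
      \<open>x\<close>; since \<open>\<delta> < 1\<close> they stay in that chart, so spherical
      distances are differences of coordinates.\<close>
    define u where "u j = co x + w ^ k * of_nat j" for j :: nat
    define y where "y j = chart_pt (ch x) (u j)" for j :: nat
    have av_step: "av (w ^ k * of_nat j) \<le> \<delta>" for j
      using av_of_nat_le_1[of j] \<delta>(1) by (simp add: av_mult av_power \<delta>_def mult_left_le)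
    have u: "av (u j) \<le> 1" "ch x \<or> av (u j) < 1" for j
      using av_ultrametric[of "co x" "w ^ k * of_nat j"] av_step[of j] \<delta>(5) av_co_le_1[of x] av_co_less_1[of x]
      by (cases "ch x"; auto simp: u_def le_max_iff_disj)+
    have coK: "co x \<in> K"
      using xK is_subfieldD(1,6)[OF K] by (cases x) (auto simp: co_def P1_def)
    have uK: "u j \<in> K" for j
      unfolding u_def using w(1) coK by (intro is_subfieldD[OF K])
    have yK: "y j \<in> P1 K" for j
      using uK[of j] is_subfieldD(6)[OF K uK[of j]] by (auto simp: y_def chart_pt_def hpt_def P1_def divide_inverse)
    have dist: "spherical av x (y j) \<le> \<delta>" for j
    proof -
      have "spherical av x (y j) = av (- (w ^ k * of_nat j))"
        using ch_co_chart_pt[OF u] by (simp add: spherical_eq y_def u_def)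
      then show ?thesis using av_step[of j] by (simp add: av_minus)
    qed
    have sep: "t * \<delta> \<le> spherical av (y i) (y j)" if "i \<le> N" "j \<le> N" "i \<noteq> j" for i j
    proof -
      have "spherical av (y i) (y j) = av (w ^ k * (of_nat i - of_nat j))"
        using ch_co_chart_pt[OF u] by (simp add: spherical_eq y_def u_def algebra_simps)
      then show ?thesis using t(3)[OF that] \<delta>(1) by (simp add: av_mult av_power \<delta>_def mult.commute)
    qed
    have "inj_on y {..N}"
    proof (rule inj_onI, rule ccontr)
      fix i j assume "i \<in> {..N}" "j \<in> {..N}" "y i = y j" "i \<noteq> j"
      then show False using sep[of i j] mult_pos_pos[OF t(1) \<delta>(1)] by simp
    qed
    then have card: "N < card (y ` {..N})" by (simp add: card_image)
    have "\<exists>n. \<exists>z\<in>y ` {..N}. t ^ N * e \<le> spherical av ((rat_map f g ^^ n) x) ((rat_map f g ^^ n) z)"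
      by (rule spread[rule_format, OF t(1,2) \<delta>(1,4) _ card]) (use dist in auto, metis atMost_iff imageE sep)
    then obtain n z where z: "z \<in> y ` {..N}"
      "t ^ N * e \<le> spherical av ((rat_map f g ^^ n) x) ((rat_map f g ^^ n) z)"
      by blast
    from z(1) obtain j where "z = y j" by blast
    then show False using h(2)[OF yK, of j n] dist[of j] \<delta> z(2) by auto
  qed
  have sub: "P1 K \<subseteq> P1 UNIV" by (auto simp: P1_def)
  show ?thesis
    unfolding julia_set_def Fatou_eq using key Fatou_in[of _ K] sub by fast
qed

end

theorem theorem1p3:
  fixes p :: nat and av :: "'c::field_char_0 \<Rightarrow> real"
    and K :: "'c set" and f g :: "'c poly"
  assumes "prime p"
    and "padic_complex_numbers p av"
    and "finite_extension (Qp av) K"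
    and "rational_over K f g"
    and "2 \<le> rat_degree f g"
    and "semi_hyperbolic av f g"
  shows "julia_set av UNIV f g \<inter> P1 K = julia_set av K f g"
proof -
  interpret padic_complex_numbers p av by (rule assms)
  have K: "is_subfield K" using assms(3) by (simp add: finite_extension_def)
  obtain A where A: "is_algebraic_closure (Qp av) A" using dense_algebraic_closure by blast
  have KA: "K \<subseteq> A" by (rule finite_extension_subset_algebraic_closure[OF A assms(3)])
  have fg: "poly_over K f" "poly_over K g" "coprime f g" using assms(4) by (auto simp: rational_over_def)
  have rev: "poly_over K (rev_poly n q)" if "poly_over K q" for n q
    using that is_subfieldD(1)[OF K] by (simp add: poly_over_def coeff_rev_poly)
  interpret split_rational_map av f g "rat_degree f g"
  proof
    show "\<exists>l M. wronskian (chart_poly (rat_degree f g) b f) (chart_poly (rat_degree f g) b g)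
        = smult l (\<Prod>x\<in>#M. [:- x, 1:])" for b
    proof (cases "wronskian (chart_poly (rat_degree f g) b f) (chart_poly (rat_degree f g) b g) = 0")
      \<comment> \<open>That the Wronskian is nonzero is derived inside the locale being
        interpreted, so the zero polynomial is split here with leading factor 0.\<close>
      case True
      then show ?thesis by (intro exI[of _ 0]) auto
    next
      case False
      have "poly_over A (wronskian (chart_poly (rat_degree f g) b f) (chart_poly (rat_degree f g) b g))"
        using fg rev by (intro poly_over_mono[OF poly_over_wronskian[OF K] KA]) (auto simp: chart_poly_def)
      from algebraic_closure_splits[OF A this False] show ?thesis by blast
    qed
  qed (use fg assms(5) in auto)
  have p: "0 < av (of_nat p)" "av (of_nat p) < 1"
    using prime_gt_1_nat[OF assms(1)] by (auto simp: av_p)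
  \<comment> \<open>The scaling element of \<open>K\<close> is \<open>p\<close> itself, with
    absolute value \<open>1 / p\<close>.\<close>
  show ?thesis by (rule julia_set_restrict[OF K is_subfieldD(9)[OF K] p assms(6)])
qed

end
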